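(* The two-stage robust multi-representative selection problem with alternative continuous budgeted uncertainty, (2MRS-AC), can be solved in polynomial time.
   Context: Problem (2MRS-AC). Input: a number $n$ of items, a partition $[n]=T_1\cup\dots\cup T_m$ of $[n]=\{1,\dots,n\}$ into nonempty disjoint sets, integers $p_j\in\{1,\dots,|T_j|\}$ for $j\in[m]$, first-stage costs $C\in\mathbb{R}_{\ge 0}^n$, vectors $\underline c,d\in\mathbb{R}_{\ge 0}^n$, and a budget $\Gamma\in\mathbb{R}_{\ge 0}$ (for complexity statements, all numbers are rational and encoded in binary). The alternative continuous budgeted uncertainty set is $$U^{AC}=\Big\{c\in\mathbb{R}_{\ge 0}^n:\ \exists\,\delta\in\prod_{i=1}^n[0,d_i] \text{ with } c_i=\underline c_i+\delta_i\ \forall i\in[n],\ \sum_{i=1}^n\delta_i\le\Gamma\Big\}.$$ Let $X'=\{x\in\{0,1\}^n:\ \sum_{i\in T_j}x_i\le p_j\ \forall j\in[m]\}$ and, for $x\in X'$, $Y(x)=\{y\in\{0,1\}^n:\ \sum_{i\in T_j}(x_i+y_i)=p_j\ \forall j\in[m],\ x_i+y_i\le 1\ \forall i\in[n]\}$. The task is to solve $$\min_{x\in X'}\Big(\sum_{i=1}^n C_ix_i+\max_{c\in U^{AC}}\min_{y\in Y(x)}\sum_{i=1}^n c_iy_i\Big).$$ By linear programming duality this is equivalent to the mixed-integer program: minimize $\sum_{i=1}^n C_ix_i+\sum_{i=1}^n\underline c_iy_i+\Gamma\pi+\sum_{i=1}^n d_i\rho_i$ subject to $\sum_{i\in T_j}(x_i+y_i)=p_j$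 for all $j\in[m]$; $x_i+y_i\le 1$ and $\pi+\rho_i\ge y_i$ for all $i\in[n]$; $x\in\{0,1\}^n$, $y\in[0,1]^n$, $\pi\in\mathbb{R}_{\ge 0}$, $\rho\in\mathbb{R}_{\ge 0}^n$. *)

theory Defs
  imports
    "HOL-Analysis.Analysis"
    "HOL-Computational_Algebra.Polynomial"
    "HOL-Library.Disjoint_Sets"
    "HOL-Library.FuncSet"
    "HOL-Library.Log_Nat"
begin

section \<open>Polynomial time\<close>

text \<open>
  The machine model is the random access machine with logarithmic cost (Aho, Hopcroft and Ullman,
  The Design and Analysis of Computer Algorithms, Section 1.3), which is polynomially equivalent
  to the multitape Turing machine.  Control flow is given by while programs instead of jumps.
  The memory is a bank of arrays of unbounded integers; a program mentions only finitely many
  of them, and every array cell may be addressed indirectly.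
\<close>

type_synonym memory = "string \<Rightarrow> int \<Rightarrow> int"

datatype aexp =
    Const int
  | Read string aexp
  | Add aexp aexp
  | Sub aexp aexp
  | Mul aexp aexp
  | Quot aexp aexp

datatype bexp =
    Less aexp aexp
  | Neg bexp
  | Conj bexp bexp

datatype com =
    Skip
  | Write string aexp aexp
  | Seq com com
  | Cond bexp com com
  | While bexp com

fun aval :: "aexp \<Rightarrow> memory \<Rightarrow> int" where
  "aval (Const k) s = k"
| "aval (Read A e) s = s A (aval e s)"
| "aval (Add e f) s = aval e s + aval f s"
| "aval (Sub e f) s = aval e s - aval f s"
| "aval (Mul e f) s = aval e s * aval f s"
| "aval (Quot e f) s = aval e s div aval f s"

fun bval :: "bexp \<Rightarrow> memory \<Rightarrow> bool" where
  "bval (Less e f) s \<longleftrightarrow> aval e s < aval f s"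
| "bval (Neg b) s \<longleftrightarrow> \<not> bval b s"
| "bval (Conj b b') s \<longleftrightarrow> bval b s \<and> bval b' s"

text \<open>The length of the binary representation of an integer, including one bit for the sign.\<close>

definition int_size :: "int \<Rightarrow> nat" where
  "int_size k = floorlog 2 (nat \<bar>k\<bar>) + 1"

text \<open>
  Every node of an expression is charged the size of its value.  Hence each operation pays for its
  operands and its result, and each memory access pays for the address and for the contents.
\<close>

fun acost :: "aexp \<Rightarrow> memory \<Rightarrow> nat" where
  "acost (Const k) s = int_size k"
| "acost (Read A e) s = acost e s + int_size (aval (Read A e) s)"
| "acost (Add e f) s = acost e s + acost f s + int_size (aval (Add e f) s)"
| "acost (Sub e f) s = acost e s + acost f s + int_size (aval (Sub e f) s)"
| "acost (Mul e f) s = acost e s + acost f s + int_size (aval (Mul e f) s)"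
| "acost (Quot e f) s = acost e s + acost f s + int_size (aval (Quot e f) s)"

fun bcost :: "bexp \<Rightarrow> memory \<Rightarrow> nat" where
  "bcost (Less e f) s = acost e s + acost f s + 1"
| "bcost (Neg b) s = bcost b s + 1"
| "bcost (Conj b b') s = bcost b s + bcost b' s + 1"

definition upd :: "memory \<Rightarrow> string \<Rightarrow> int \<Rightarrow> int \<Rightarrow> memory" where
  "upd s A i v = s(A := (s A)(i := v))"

text \<open>\<open>runs c s t s'\<close>: started in \<open>s\<close>, the program \<open>c\<close> halts in \<open>s'\<close> after time \<open>t\<close>.\<close>

inductive runs :: "com \<Rightarrow> memory \<Rightarrow> nat \<Rightarrow> memory \<Rightarrow> bool" where
  Skip: "runs Skip s 1 s"
| Write: "runs (Write A e f) s (acost e s + acost f s + 1) (upd s A (aval e s) (aval f s))"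
| Seq: "runs c s t s' \<Longrightarrow> runs c' s' t' s'' \<Longrightarrow> runs (Seq c c') s (t + t') s''"
| CondTrue: "bval b s \<Longrightarrow> runs c s t s' \<Longrightarrow> runs (Cond b c c') s (bcost b s + t + 1) s'"
| CondFalse: "\<not> bval b s \<Longrightarrow> runs c' s t s' \<Longrightarrow> runs (Cond b c c') s (bcost b s + t + 1) s'"
| WhileFalse: "\<not> bval b s \<Longrightarrow> runs (While b c) s (bcost b s + 1) s"
| WhileTrue: "bval b s \<Longrightarrow> runs c s t s' \<Longrightarrow> runs (While b c) s' t' s'' \<Longrightarrow>
    runs (While b c) s (bcost b s + t + t' + 1) s''"

inductive_cases Skip_runsE: "runs Skip s t s'"
inductive_cases Write_runsE: "runs (Write A e f) s t s'"
inductive_cases Seq_runsE: "runs (Seq c c') s t s'"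
inductive_cases Cond_runsE: "runs (Cond b c c') s t s'"
inductive_cases While_runsE: "runs (While b c) s t s'"

lemma runs_deterministic:
  assumes "runs c s t s'" and "runs c s u z"
  shows "t = u \<and> s' = z"
  using assms
proof (induction arbitrary: u z rule: runs.induct)
  case (Skip s)
  then show ?case by (auto elim: Skip_runsE)
next
  case (Write A e f s)
  then show ?case by (auto elim: Write_runsE)
next
  case (Seq c s t s' c' t' s'')
  from Seq.prems obtain v v' r where
    r: "runs c s v r" and r': "runs c' r v' z" and u: "u = v + v'"
    by (rule Seq_runsE)
  have 1: "t = v \<and> s' = r" by (rule Seq.IH(1)[OF r])
  have "t' = v' \<and> s'' = z" by (rule Seq.IH(2)) (simp add: 1 r')
  with 1 show ?case by (simp add: u)
next
  case (CondTrue b s c t s' c')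
  from CondTrue.prems show ?case
  proof (rule Cond_runsE)
    fix v assume "runs c s v z" and u: "u = Suc (bcost b s + v)"
    then have "t = v \<and> s' = z" by (intro CondTrue.IH)
    then show ?thesis by (simp add: u)
  next
    assume "\<not> bval b s"
    with CondTrue.hyps(1) show ?thesis by contradiction
  qed
next
  case (CondFalse b s c' t s' c)
  from CondFalse.prems show ?case
  proof (rule Cond_runsE)
    fix v assume "runs c' s v z" and u: "u = Suc (bcost b s + v)"
    then have "t = v \<and> s' = z" by (intro CondFalse.IH)
    then show ?thesis by (simp add: u)
  next
    assume "bval b s"
    with CondFalse.hyps(1) show ?thesis by contradiction
  qed
next
  case (WhileFalse b s c)
  from WhileFalse.prems show ?case
  proof (rule While_runsE)
    assume "u = Suc (bcost b s)" and "z = s"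
    then show ?thesis by simp
  next
    assume "bval b s"
    with WhileFalse.hyps show ?thesis by contradiction
  qed
next
  case (WhileTrue b s c t s' t' s'')
  from WhileTrue.prems show ?case
  proof (rule While_runsE)
    assume "\<not> bval b s"
    with WhileTrue.hyps(1) show ?thesis by contradiction
  next
    fix v r v'
    assume r: "runs c s v r" and r': "runs (While b c) r v' z"
      and u: "u = Suc (bcost b s + v + v')"
    have 1: "t = v \<and> s' = r" by (rule WhileTrue.IH(1)[OF r])
    have "t' = v' \<and> s'' = z" by (rule WhileTrue.IH(2)) (simp add: 1 r')
    with 1 show ?thesis by (simp add: u)
  qed
qed

text \<open>A list is stored with its length in cell 0 and its entries in the cells from 1 onwards.\<close>

definition list_cells :: "int list \<Rightarrow> int \<Rightarrow> int" where
  "list_cells xs i =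
    (if i = 0 then int (length xs)
     else if 1 \<le> i \<and> i \<le> int (length xs) then xs ! nat (i - 1) else 0)"

definition input_memory :: "int list \<Rightarrow> memory" where
  "input_memory xs = (\<lambda>A i. if A = ''input'' then list_cells xs i else 0)"

definition has_output :: "memory \<Rightarrow> int list \<Rightarrow> bool" where
  "has_output s ys \<longleftrightarrow> (\<forall>i\<in>{0..int (length ys)}. s ''output'' i = list_cells ys i)"

definition list_size :: "int list \<Rightarrow> nat" where
  "list_size xs = (\<Sum>k\<leftarrow>xs. int_size k)"

text \<open>
  A computational problem has instances \<open>Inst\<close>, an encoding \<open>enc\<close> of the instances, and a relation
  \<open>Sol\<close> between instances and the encodings of their admissible answers.  There is one program and
  one polynomial for all instances.
\<close>

definition polynomial_time_solvable ::
    "'i set \<Rightarrow> ('i \<Rightarrow> int list) \<Rightarrow> ('i \<Rightarrow> int list \<Rightarrow> bool) \<Rightarrow> bool" where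
  "polynomial_time_solvable Inst enc Sol \<longleftrightarrow>
    (\<exists>(c :: com) (q :: nat poly). \<forall>I\<in>Inst. \<exists>t s ys.
       runs c (input_memory (enc I)) t s \<and> t \<le> poly q (list_size (enc I)) \<and>
       has_output s ys \<and> Sol I ys)"


section \<open>Two-stage robust multi-representative selection\<close>

record mrs =
  num_items :: nat                      (* n *)
  num_parts :: nat                      (* m *)
  part :: "nat \<Rightarrow> nat set"              (* T *)
  demand :: "nat \<Rightarrow> nat"                (* p *)
  first_cost :: "nat \<Rightarrow> rat"            (* C *)
  lower_cost :: "nat \<Rightarrow> rat"            (* c underlined *)
  deviation :: "nat \<Rightarrow> rat"             (* d *)
  budget :: rat                         (* Gamma *)

definition mrs_instances :: "mrs set" where
  "mrs_instances = {I.
     (\<Union>j\<in>{1..num_parts I}. part I j) = {1..num_items I} \<and>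
     disjoint_family_on (part I) {1..num_parts I} \<and>
     (\<forall>j\<in>{1..num_parts I}. part I j \<noteq> {} \<and> demand I j \<in> {1..card (part I j)}) \<and>
     (\<forall>i\<in>{1..num_items I}. 0 \<le> first_cost I i \<and> 0 \<le> lower_cost I i \<and> 0 \<le> deviation I i) \<and>
     0 \<le> budget I}"

text \<open>Vectors indexed by \<open>{1..n}\<close> are extensional functions on that set.\<close>

definition uncertainty_set :: "mrs \<Rightarrow> (nat \<Rightarrow> real) set" where
  "uncertainty_set I = {c \<in> {1..num_items I} \<rightarrow>\<^sub>E {0..}.
     \<exists>\<delta> \<in> (\<Pi>\<^sub>E i\<in>{1..num_items I}. {0..of_rat (deviation I i)}).
       (\<forall>i\<in>{1..num_items I}. c i = of_rat (lower_cost I i) + \<delta> i) \<and>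
       (\<Sum>i\<in>{1..num_items I}. \<delta> i) \<le> of_rat (budget I)}"

definition first_stage :: "mrs \<Rightarrow> (nat \<Rightarrow> nat) set" where
  "first_stage I = {x \<in> {1..num_items I} \<rightarrow>\<^sub>E {0, 1}.
     \<forall>j\<in>{1..num_parts I}. (\<Sum>i\<in>part I j. x i) \<le> demand I j}"

definition second_stage :: "mrs \<Rightarrow> (nat \<Rightarrow> nat) \<Rightarrow> (nat \<Rightarrow> nat) set" where
  "second_stage I x = {y \<in> {1..num_items I} \<rightarrow>\<^sub>E {0, 1}.
     (\<forall>j\<in>{1..num_parts I}. (\<Sum>i\<in>part I j. x i + y i) = demand I j) \<and>
     (\<forall>i\<in>{1..num_items I}. x i + y i \<le> 1)}"

definition recourse_cost :: "mrs \<Rightarrow> (nat \<Rightarrow> nat) \<Rightarrow> (nat \<Rightarrow> real) \<Rightarrow> real" where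
  "recourse_cost I x c =
     Min ((\<lambda>y. \<Sum>i\<in>{1..num_items I}. c i * real (y i)) ` second_stage I x)"

text \<open>The supremum is attained and the set under \<^const>\<open>Min\<close> is nonempty; see the lemmas below.\<close>

definition worst_case_cost :: "mrs \<Rightarrow> (nat \<Rightarrow> nat) \<Rightarrow> real" where
  "worst_case_cost I x = (SUP c\<in>uncertainty_set I. recourse_cost I x c)"

definition objective :: "mrs \<Rightarrow> (nat \<Rightarrow> nat) \<Rightarrow> real" where
  "objective I x =
     (\<Sum>i\<in>{1..num_items I}. of_rat (first_cost I i) * real (x i)) + worst_case_cost I x"

definition optimal_first_stage :: "mrs \<Rightarrow> (nat \<Rightarrow> nat) \<Rightarrow> bool" where
  "optimal_first_stage I x \<longleftrightarrow> is_arg_min (objective I) (\<lambda>x. x \<in> first_stage I) x"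


subsection \<open>The minima and the maximum exist\<close>

lemma finite_part:
  assumes "I \<in> mrs_instances" and "j \<in> {1..num_parts I}"
  shows "finite (part I j)" and "part I j \<subseteq> {1..num_items I}"
proof -
  show "part I j \<subseteq> {1..num_items I}"
    using assms unfolding mrs_instances_def by blast
  then show "finite (part I j)"
    by (rule finite_subset) simp
qed

lemma finite_first_stage: "finite (first_stage I)"
  by (rule finite_subset[of _ "{1..num_items I} \<rightarrow>\<^sub>E {0, 1}"])
    (auto simp: first_stage_def intro!: finite_PiE)

lemma finite_second_stage: "finite (second_stage I x)"
  by (rule finite_subset[of _ "{1..num_items I} \<rightarrow>\<^sub>E {0, 1}"])
    (auto simp: second_stage_def intro!: finite_PiE)

lemma first_stage_nonempty: "I \<in> mrs_instances \<Longrightarrow> first_stage I \<noteq> {}"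
proof -
  assume I: "I \<in> mrs_instances"
  have "(\<Sum>i\<in>part I j. (\<lambda>i\<in>{1..num_items I}. 0::nat) i) = 0" if "j \<in> {1..num_parts I}" for j
    using finite_part(2)[OF I that] by (intro sum.neutral) auto
  then have "(\<lambda>i\<in>{1..num_items I}. 0) \<in> first_stage I"
    by (auto simp: first_stage_def)
  then show ?thesis by blast
qed

lemma second_stage_nonempty:
  assumes I: "I \<in> mrs_instances" and x: "x \<in> first_stage I"
  shows "second_stage I x \<noteq> {}"
proof -
  let ?N = "{1..num_items I}" and ?M = "{1..num_parts I}"
  define Z where "Z j = {i \<in> part I j. x i = 0}" for j
  have x01: "x i = 0 \<or> x i = 1" if "i \<in> ?N" for i
    using x that by (auto simp: first_stage_def PiE_iff)
  have sum_x: "(\<Sum>i\<in>part I j. x i) + card (Z j) = card (part I j)" if j: "j \<in> ?M" for j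
  proof -
    have fin: "finite (part I j)" and sub: "part I j \<subseteq> ?N"
      using finite_part[OF I j] by auto
    have "(\<Sum>i\<in>part I j. x i) + card (Z j) = (\<Sum>i\<in>part I j. x i + (if x i = 0 then 1 else 0))"
      using fin by (simp add: sum.distrib Z_def sum.If_cases Int_def conj_commute)
    also have "\<dots> = (\<Sum>i\<in>part I j. 1)"
      using x01 sub by (intro sum.cong) force+
    finally show ?thesis by simp
  qed
  have "\<exists>B. B \<subseteq> Z j \<and> card B = demand I j - (\<Sum>i\<in>part I j. x i)" if j: "j \<in> ?M" for j
  proof -
    have "demand I j \<le> card (part I j)"
      using I j by (auto simp: mrs_instances_def)
    then have "demand I j - (\<Sum>i\<in>part I j. x i) \<le> card (Z j)"
      using sum_x[OF j] by linarith
    then show ?thesis by (metis obtain_subset_with_card_n)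
  qed
  then obtain B where B: "\<And>j. j \<in> ?M \<Longrightarrow> B j \<subseteq> Z j"
    and cB: "\<And>j. j \<in> ?M \<Longrightarrow> card (B j) = demand I j - (\<Sum>i\<in>part I j. x i)"
    by metis
  define y where "y = (\<lambda>i\<in>?N. if \<exists>j\<in>?M. i \<in> B j then 1 else 0 :: nat)"
  have dis: "j = k" if "i \<in> part I j" "i \<in> part I k" "j \<in> ?M" "k \<in> ?M" for i j k
  proof (rule ccontr)
    assume "j \<noteq> k"
    moreover have "disjoint_family_on (part I) ?M"
      using I by (simp add: mrs_instances_def)
    ultimately have "part I j \<inter> part I k = {}"
      using that(3,4) by (simp add: disjoint_family_on_def)
    with that(1,2) show False by blast
  qed
  have y_eq: "y i = (if i \<in> B j then 1 else 0)" if "i \<in> part I j" "j \<in> ?M" for i j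
  proof -
    have "i \<in> ?N" using finite_part(2)[OF I] that by blast
    moreover have "(\<exists>k\<in>?M. i \<in> B k) \<longleftrightarrow> i \<in> B j"
    proof
      assume "\<exists>k\<in>?M. i \<in> B k"
      then obtain k where k: "k \<in> ?M" "i \<in> B k" by blast
      then have "i \<in> part I k" using B[OF k(1)] by (auto simp: Z_def)
      then show "i \<in> B j" using dis[OF _ that(1) k(1) that(2)] k(2) by simp
    next
      assume "i \<in> B j"
      then show "\<exists>k\<in>?M. i \<in> B k" using that(2) by blast
    qed
    ultimately show ?thesis by (simp add: y_def)
  qed
  have "(\<Sum>i\<in>part I j. x i + y i) = demand I j" if j: "j \<in> ?M" for j
  proof -
    have fin: "finite (part I j)" using finite_part[OF I j] by simp
    have "(\<Sum>i\<in>part I j. y i) = (\<Sum>i\<in>part I j. if i \<in> B j then 1 else 0)"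
      using y_eq j by (intro sum.cong) auto
    also have "\<dots> = card (part I j \<inter> B j)"
      using fin by (simp add: sum.If_cases)
    also have "part I j \<inter> B j = B j" using B[OF j] by (auto simp: Z_def)
    finally have "(\<Sum>i\<in>part I j. y i) = demand I j - (\<Sum>i\<in>part I j. x i)"
      using cB[OF j] by simp
    moreover have "(\<Sum>i\<in>part I j. x i) \<le> demand I j"
      using x j by (auto simp: first_stage_def)
    ultimately show ?thesis by (simp add: sum.distrib)
  qed
  moreover have "x i + y i \<le> 1" if "i \<in> ?N" for i
  proof (cases "\<exists>j\<in>?M. i \<in> B j")
    case True
    then have "x i = 0" using B unfolding Z_def by blast
    then show ?thesis using that by (simp add: y_def)
  next
    case False
    then show ?thesis using x01[OF that] that by (auto simp: y_def)
  qed
  moreover have "y \<in> ?N \<rightarrow>\<^sub>E {0, 1}" by (auto simp: y_def)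
  ultimately have "y \<in> second_stage I x" by (simp add: second_stage_def)
  then show ?thesis by blast
qed

lemma uncertainty_set_nonempty: "I \<in> mrs_instances \<Longrightarrow> uncertainty_set I \<noteq> {}"
proof -
  let ?N = "{1..num_items I}"
  assume I: "I \<in> mrs_instances"
  then have "(\<lambda>i\<in>?N. of_rat (lower_cost I i)) \<in> uncertainty_set I"
    by (auto simp: uncertainty_set_def mrs_instances_def intro!: bexI[of _ "\<lambda>i\<in>?N. 0"])
  then show ?thesis by blast
qed

lemma compact_uncertainty_set:
  assumes I: "I \<in> mrs_instances"
  shows "compact (uncertainty_set I)"
proof -
  let ?N = "{1..num_items I}"
  let ?l = "\<lambda>i. of_rat (lower_cost I i) :: real" and ?d = "\<lambda>i. of_rat (deviation I i) :: real"
  let ?K = "\<lambda>i. if i \<in> ?N then {?l i..?l i + ?d i} else {undefined}"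
  let ?H = "{c :: nat \<Rightarrow> real. (\<Sum>i\<in>?N. c i - ?l i) \<le> of_rat (budget I)}"
  have "uncertainty_set I = PiE UNIV ?K \<inter> ?H"
  proof (intro set_eqI iffI)
    fix c assume "c \<in> uncertainty_set I"
    then obtain \<delta> where c: "c \<in> ?N \<rightarrow>\<^sub>E {0..}" and \<delta>: "\<And>i. i \<in> ?N \<Longrightarrow> \<delta> i \<in> {0..?d i}"
      and eq: "\<And>i. i \<in> ?N \<Longrightarrow> c i = ?l i + \<delta> i" and le: "(\<Sum>i\<in>?N. \<delta> i) \<le> of_rat (budget I)"
      by (auto simp: uncertainty_set_def PiE_iff)
    have "(\<Sum>i\<in>?N. c i - ?l i) = (\<Sum>i\<in>?N. \<delta> i)"
      using eq by (intro sum.cong) auto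
    with le have "c \<in> ?H" by simp
    moreover have "c \<in> PiE UNIV ?K"
      using c \<delta> eq by (auto simp: PiE_iff extensional_def)
    ultimately show "c \<in> PiE UNIV ?K \<inter> ?H" by blast
  next
    fix c assume c: "c \<in> PiE UNIV ?K \<inter> ?H"
    then have K: "c i \<in> ?K i" for i by (intro PiE_mem[of c UNIV ?K i]) simp_all
    have ci: "?l i \<le> c i" "c i \<le> ?l i + ?d i" if "i \<in> ?N" for i
      using K[of i] that by auto
    have l: "0 \<le> ?l i" if "i \<in> ?N" for i
      using I that by (auto simp: mrs_instances_def)
    have "c \<in> ?N \<rightarrow>\<^sub>E {0..}"
    proof (rule PiE_I)
      fix i assume "i \<in> ?N"
      then show "c i \<in> {0..}" using order_trans[OF l ci(1)] by simp
    next
      fix i assume "i \<notin> ?N"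
      then show "c i = undefined" using K[of i] by (simp split: if_splits)
    qed
    moreover have "(\<lambda>i\<in>?N. c i - ?l i) \<in> (\<Pi>\<^sub>E i\<in>?N. {0..?d i})"
      using ci by (auto simp: algebra_simps)
    ultimately show "c \<in> uncertainty_set I"
      using c by (auto simp: uncertainty_set_def intro!: bexI[of _ "\<lambda>i\<in>?N. c i - ?l i"])
  qed
  moreover have "compact (PiE UNIV ?K)"
  proof -
    have "compactin (product_topology (\<lambda>i. euclidean) UNIV) (PiE UNIV ?K)"
      by (subst compactin_PiE) auto
    then show ?thesis by (simp add: euclidean_product_topology)
  qed
  moreover have "closed ?H"
    by (intro closed_Collect_le continuous_intros continuous_on_product_coordinates)
  ultimately show ?thesis by (simp add: compact_Int_closed)
qed

lemma continuous_on_Min_image: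
  fixes f :: "'a \<Rightarrow> 'b::topological_space \<Rightarrow> real"
  assumes "finite A" and "A \<noteq> {}" and "\<And>a. a \<in> A \<Longrightarrow> continuous_on S (f a)"
  shows "continuous_on S (\<lambda>z. Min ((\<lambda>a. f a z) ` A))"
  using assms
proof (induction A rule: finite_ne_induct)
  case (singleton a)
  then show ?case by simp
next
  case (insert a A)
  have "continuous_on S (\<lambda>z. min (f a z) (Min ((\<lambda>a. f a z) ` A)))"
    using insert by (intro continuous_on_min) auto
  then show ?case using insert by simp
qed

lemma worst_case_attained:
  assumes I: "I \<in> mrs_instances" and x: "x \<in> first_stage I"
  shows "\<exists>c\<in>uncertainty_set I. worst_case_cost I x = recourse_cost I x c \<and>
    (\<forall>c'\<in>uncertainty_set I. recourse_cost I x c' \<le> recourse_cost I x c)"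
proof -
  have "continuous_on (uncertainty_set I) (recourse_cost I x)"
    unfolding recourse_cost_def
    by (intro continuous_on_Min_image finite_second_stage second_stage_nonempty[OF I x]
        continuous_intros continuous_on_subset[OF continuous_on_product_coordinates] subset_UNIV)
  then obtain c where c: "c \<in> uncertainty_set I"
      and max: "\<forall>c'\<in>uncertainty_set I. recourse_cost I x c' \<le> recourse_cost I x c"
    using continuous_attains_sup[OF compact_uncertainty_set[OF I] uncertainty_set_nonempty[OF I]]
    by blast
  have "worst_case_cost I x = recourse_cost I x c"
    unfolding worst_case_cost_def using c max by (intro cSup_eq_maximum) auto
  with c max show ?thesis by blast
qed


subsection \<open>Encoding\<close>

definition encode_rat :: "rat \<Rightarrow> int list" where
  "encode_rat r = [fst (quotient_of r), snd (quotient_of r)]"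

text \<open>The partition is encoded by listing, for each item, the index of the set containing it.\<close>

definition part_of :: "mrs \<Rightarrow> nat \<Rightarrow> nat" where
  "part_of I i = (THE j. j \<in> {1..num_parts I} \<and> i \<in> part I j)"

definition encode_mrs :: "mrs \<Rightarrow> int list" where
  "encode_mrs I =
     [int (num_items I), int (num_parts I)]
     @ map (\<lambda>i. int (part_of I i)) [1..<num_items I + 1]
     @ map (\<lambda>j. int (demand I j)) [1..<num_parts I + 1]
     @ concat (map (\<lambda>i. encode_rat (first_cost I i)) [1..<num_items I + 1])
     @ concat (map (\<lambda>i. encode_rat (lower_cost I i)) [1..<num_items I + 1])
     @ concat (map (\<lambda>i. encode_rat (deviation I i)) [1..<num_items I + 1])
     @ encode_rat (budget I)"

text \<open>
  An answer consists of the optimal value, as a fraction with positive denominator that need not be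
  in lowest terms, followed by an optimal first-stage solution.
\<close>

definition solves_mrs :: "mrs \<Rightarrow> int list \<Rightarrow> bool" where
  "solves_mrs I ys \<longleftrightarrow>
     (\<exists>x a b. optimal_first_stage I x \<and> b > 0 \<and> objective I x = of_int a / of_int b \<and>
        ys = [a, b] @ map (\<lambda>i. int (x i)) [1..<num_items I + 1])"

end

(*
  Moving the budget constraint of the adversary into the objective with a Lagrange multiplier pi in
  [0, 1] shows that, for a fixed first-stage solution x, the worst case is the minimum over pi and
  over fractional completions y of
    Gamma * pi + sum_i (lower_i * y_i + deviation_i * max 0 (y_i - pi)).
  For fixed pi each part of the partition is a fractional selection problem in which item i offers pi
  units at price lower_i and 1 - pi units at price lower_i + deviation_i.  A market price tau
  clears this market as long as two affine functions of pi with integer coefficients of size at most n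
  keep their sign, so on an interval between consecutive fractions with denominators at most n the
  value is affine in pi.  Hence an optimal pi is such a fraction a / b, and then an optimal y has
  entries in {0, 1/b, ..., 1}.

  For each of the polynomially many pairs (a, b) the joint choice of x and y is a knapsack with integral
  sizes, solved by dynamic programming over the parts, items, used capacity and size of the current
  item.  All states are laid out as the digits of a single index, so the algorithm is one loop
  without inner loops that fills an array.  The costs are scaled to integers and multiplied by 2 ^ n,
  and the low-order bits record x.
*)

theory Submission
  imports Defs
begin

section \<open>Execution and cost of programs without nested loops\<close>

text \<open>The candidate fractions \<open>a / b\<close> do not depend on x, which is what allows
  the minimization over x to be exchanged with the one over pi: a single knapsack per pair covers
  all exponentially many x. Correctness rests on two inequalities. Conversely, for each x some pair
  reaches the worst case; this needs an optimal multiplier, whose existence follows from concavity.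
  Denominators stay small because clearing the market means comparing r * e + (1 - r) * w with an
  integer, where e and w count items; the slope in r is a difference of counts. The code searches up
  to \<open>G = n + 1\<close>, which is positive even without items. The machine charges for bit
  lengths, so every stored number must stay polynomially long: the product of all denominators has
  at most as many bits as the input, and infinity is an explicit strict upper bound on tagged
  costs.\<close>

fun loop_free :: "com \<Rightarrow> bool" where
  "loop_free (While b c) = False"
| "loop_free (Seq c c') = (loop_free c \<and> loop_free c')"
| "loop_free (Cond b c c') = (loop_free c \<and> loop_free c')"
| "loop_free _ = True"

text \<open>The value on \<^const>\<open>While\<close> is a dummy; \<open>sem\<close> is only used on programs without loops.\<close>

fun sem :: "com \<Rightarrow> memory \<Rightarrow> memory" where
  "sem Skip s = s"
| "sem (Write A e f) s = upd s A (aval e s) (aval f s)"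
| "sem (Seq c c') s = sem c' (sem c s)"
| "sem (Cond b c c') s = (if bval b s then sem c s else sem c' s)"
| "sem (While b c) s = s"

definition bounded_memory :: "nat \<Rightarrow> memory \<Rightarrow> bool" where
  "bounded_memory l s \<longleftrightarrow> (\<forall>A i. \<bar>s A i\<bar> \<le> 2 ^ l)"

text \<open>
  If all memory cells are bounded by \<open>2 ^ l\<close> then the value of \<open>e\<close> is bounded by
  \<open>2 ^ (l * adeg e)\<close> and its evaluation costs at most \<open>acoef e * l\<close>.  Thus the running time of a
  loop only requires a bound on the memory between iterations; degrees and coefficients are
  constants of the program.
\<close>

fun adeg :: "aexp \<Rightarrow> nat" where
  "adeg (Const k) = nat \<bar>k\<bar> + 1"
| "adeg (Read A e) = adeg e"
| "adeg (Add e f) = adeg e + adeg f"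
| "adeg (Sub e f) = adeg e + adeg f"
| "adeg (Mul e f) = adeg e + adeg f"
| "adeg (Quot e f) = adeg e + adeg f"

fun acoef :: "aexp \<Rightarrow> nat" where
  "acoef (Const k) = nat \<bar>k\<bar> + 3"
| "acoef (Read A e) = acoef e + adeg e + 2"
| "acoef (Add e f) = acoef e + acoef f + adeg e + adeg f + 2"
| "acoef (Sub e f) = acoef e + acoef f + adeg e + adeg f + 2"
| "acoef (Mul e f) = acoef e + acoef f + adeg e + adeg f + 2"
| "acoef (Quot e f) = acoef e + acoef f + adeg e + adeg f + 2"

fun bcoef :: "bexp \<Rightarrow> nat" where
  "bcoef (Less e f) = acoef e + acoef f + 1"
| "bcoef (Neg b) = bcoef b + 1"
| "bcoef (Conj b b') = bcoef b + bcoef b' + 1"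

text \<open>One execution multiplies the bit bound by at most \<open>cdeg\<close>. For
  \<open>Cond\<close> the product is a common bound of both branches because degrees are
  positive.\<close>

fun cdeg :: "com \<Rightarrow> nat" where
  "cdeg (Write A e f) = adeg f"
| "cdeg (Seq c c') = cdeg c * cdeg c'"
| "cdeg (Cond b c c') = cdeg c * cdeg c'"
| "cdeg _ = 1"

fun ccoef :: "com \<Rightarrow> nat" where
  "ccoef (Write A e f) = acoef e + acoef f + 1"
| "ccoef (Seq c c') = ccoef c + cdeg c * ccoef c'"
| "ccoef (Cond b c c') = bcoef b + ccoef c + ccoef c' + 1"
| "ccoef _ = 1"

lemma adeg_pos: "0 < adeg e"
  by (induction e) auto

lemma cdeg_pos: "0 < cdeg c"
  by (induction c) (auto simp: adeg_pos)

lemma bounded_memory_mono: "bounded_memory l s \<Longrightarrow> l \<le> l' \<Longrightarrow> bounded_memory l' s"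
  unfolding bounded_memory_def
  by (meson order_trans power_increasing one_le_numeral)

lemma int_size_le: "\<bar>k\<bar> \<le> 2 ^ e \<Longrightarrow> int_size k \<le> e + 2"
proof -
  assume "\<bar>k\<bar> \<le> 2 ^ e"
  also have "(2::int) ^ e < 2 ^ (e + 1)" by simp
  finally have "nat \<bar>k\<bar> < 2 ^ (e + 1)" by (simp add: nat_less_iff del: power_Suc)
  then show ?thesis
    unfolding int_size_def by (cases "nat \<bar>k\<bar> = 0") (auto simp: floorlog_le_iff)
qed

text \<open>\<open>div\<close> rounds towards minus infinity, so a negative quotient needs an
  argument: for negative \<open>u\<close> and positive \<open>v\<close>, division of
  \<open>u * v \<le> u\<close> by \<open>v\<close> gives \<open>u \<le> u div v < 0\<close>.\<close>

lemma abs_div_le_abs: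
  fixes x y :: int
  shows "\<bar>x div y\<bar> \<le> \<bar>x\<bar>"
proof (cases "y = 0")
  case False
  show ?thesis
  proof (cases "x = 0")
    case False
    have *: "\<bar>u div v\<bar> \<le> \<bar>u\<bar>" if v: "v > 0" for u v :: int
    proof (cases "u \<ge> 0")
      case True
      then have "0 \<le> u div v" using v by (simp add: pos_imp_zdiv_nonneg_iff)
      moreover have "u div v * 1 \<le> u div v * v"
        using v calculation by (intro mult_left_mono) auto
      moreover have "u div v * v \<le> u"
        using v div_mult_mod_eq[of u v] pos_mod_sign[of v u] by linarith
      ultimately show ?thesis by linarith
    next
      case False
      then have "u * v \<le> u" using v mult_left_mono_neg[of 1 v u] by simp
      then have "u * v div v \<le> u div v" using v by (rule zdiv_mono1)
      then have "u \<le> u div v" using v by simp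
      moreover have "u div v < 0" using v False pos_imp_zdiv_neg_iff[of v u] by linarith
      ultimately show ?thesis by simp
    qed
    show ?thesis
      using *[of y x] *[of "-y" "-x"] \<open>y \<noteq> 0\<close> by (cases "y > 0") auto
  qed simp
qed simp

text \<open>Powers of 2 with positive exponent are at least 2, and X + Y \<le> X * Y for X, Y \<ge>
  2, by (X - 1) * (Y - 1) \<ge> 1. Hence sums can be charged like products.\<close>

lemma two_power_add_le:
  assumes "\<bar>x\<bar> \<le> (2::int) ^ (l * p)" and "\<bar>y\<bar> \<le> 2 ^ (l * q)" and "0 < l * p" and "0 < l * q"
  shows "\<bar>x\<bar> + \<bar>y\<bar> \<le> 2 ^ (l * (p + q))"
proof -
  have "2 ^ 1 \<le> (2::int) ^ (l * p)" "2 ^ 1 \<le> (2::int) ^ (l * q)"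
    using assms(3,4) by (intro power_increasing; simp)+
  then have "0 \<le> ((2::int) ^ (l * p) - 1) * (2 ^ (l * q) - 1) - 1"
    using mult_mono[of 1 "(2::int) ^ (l * p) - 1" 1 "2 ^ (l * q) - 1"] by simp
  then show ?thesis
    using assms(1,2) by (simp add: distrib_left power_add algebra_simps)
qed

lemma two_power_mult_le:
  assumes "\<bar>x\<bar> \<le> (2::int) ^ (l * p)" and "\<bar>y\<bar> \<le> 2 ^ (l * q)"
  shows "\<bar>x\<bar> * \<bar>y\<bar> \<le> 2 ^ (l * (p + q))"
  using mult_mono[OF assms] by (simp add: distrib_left power_add)

lemma abs_aval_le:
  assumes "bounded_memory l s" and "0 < l"
  shows "\<bar>aval e s\<bar> \<le> 2 ^ (l * adeg e)"
proof (induction e)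
  case (Const k)
  have "int (nat \<bar>k\<bar>) < int (2 ^ nat \<bar>k\<bar>)" by (simp only: of_nat_less_iff less_exp)
  then have "\<bar>k\<bar> \<le> 2 ^ nat \<bar>k\<bar>" by simp
  also have "\<dots> \<le> 2 ^ (l * (nat \<bar>k\<bar> + 1))"
    using assms(2) by (intro power_increasing) (cases l; simp)+
  finally show ?case by simp
next
  case (Read A e)
  have "\<bar>s A (aval e s)\<bar> \<le> 2 ^ (l * 1)" using assms(1) by (simp add: bounded_memory_def)
  also have "\<dots> \<le> 2 ^ (l * adeg e)"
    using adeg_pos[of e] by (intro power_increasing mult_le_mono) auto
  finally show ?case by simp
next
  case (Add e f)
  have "\<bar>aval e s\<bar> + \<bar>aval f s\<bar> \<le> 2 ^ (l * (adeg e + adeg f))"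
    using assms(2) by (intro two_power_add_le Add) (simp_all add: adeg_pos)
  then show ?case
    using abs_triangle_ineq[of "aval e s" "aval f s"] by simp
next
  case (Sub e f)
  have "\<bar>aval e s\<bar> + \<bar>aval f s\<bar> \<le> 2 ^ (l * (adeg e + adeg f))"
    using assms(2) by (intro two_power_add_le Sub) (simp_all add: adeg_pos)
  then show ?case
    using abs_triangle_ineq4[of "aval e s" "aval f s"] by simp
next
  case (Mul e f)
  show ?case using two_power_mult_le[OF Mul] by (simp add: abs_mult)
next
  case (Quot e f)
  have "\<bar>aval e s div aval f s\<bar> \<le> 2 ^ (l * adeg e)"
    using abs_div_le_abs Quot(1) by (rule order_trans)
  also have "\<dots> \<le> 2 ^ (l * (adeg e + adeg f))"
    by (intro power_increasing) auto
  finally show ?case by simp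
qed

lemma int_size_aval_le:
  assumes "bounded_memory l s" and "0 < l"
  shows "int_size (aval e s) \<le> (adeg e + 2) * l"
proof -
  have "int_size (aval e s) \<le> l * adeg e + 2"
    by (rule int_size_le[OF abs_aval_le[OF assms]])
  also have "\<dots> \<le> (adeg e + 2) * l" using assms(2) by (simp add: algebra_simps)
  finally show ?thesis .
qed

lemma acost_le:
  assumes "bounded_memory l s" and "0 < l"
  shows "acost e s \<le> acoef e * l"
proof (induction e)
  case (Const k)
  show ?case using int_size_aval_le[OF assms, of "Const k"] by (simp add: algebra_simps)
next
  case (Read A e)
  then show ?case using int_size_aval_le[OF assms, of "Read A e"] by (simp add: algebra_simps)
next
  case (Add e f)
  then show ?case using int_size_aval_le[OF assms, of "Add e f"] by (simp add: algebra_simps)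
next
  case (Sub e f)
  then show ?case using int_size_aval_le[OF assms, of "Sub e f"] by (simp add: algebra_simps)
next
  case (Mul e f)
  then show ?case using int_size_aval_le[OF assms, of "Mul e f"] by (simp add: algebra_simps)
next
  case (Quot e f)
  then show ?case using int_size_aval_le[OF assms, of "Quot e f"] by (simp add: algebra_simps)
qed

lemma bcost_le:
  assumes "bounded_memory l s" and "0 < l"
  shows "bcost b s \<le> bcoef b * l"
proof (induction b)
  case (Less e f)
  show ?case using acost_le[OF assms, of e] acost_le[OF assms, of f] assms(2)
    by (simp add: algebra_simps)
qed (use assms(2) in \<open>auto simp: algebra_simps\<close>)

definition runs_within :: "com \<Rightarrow> memory \<Rightarrow> nat \<Rightarrow> memory \<Rightarrow> bool" where
  "runs_within c s T s' \<longleftrightarrow> (\<exists>t\<le>T. runs c s t s')"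

lemma runs_within_Seq:
  assumes "runs_within c s T s'" and "runs_within c' s' T' s''"
  shows "runs_within (Seq c c') s (T + T') s''"
  using assms unfolding runs_within_def by (meson add_mono runs.Seq)

lemma loop_free_runs:
  assumes "loop_free c" and "bounded_memory l s" and "0 < l"
  shows "runs_within c s (ccoef c * l) (sem c s) \<and> bounded_memory (l * cdeg c) (sem c s)"
  using assms
proof (induction c arbitrary: s l)
  case Skip
  then show ?case using runs.Skip[of s] by (auto simp: runs_within_def intro!: exI[of _ 1])
next
  case (Write A e f)
  have "acost e s + acost f s + 1 \<le> ccoef (Write A e f) * l"
    using acost_le[OF Write(2,3), of e] acost_le[OF Write(2,3), of f] Write(3)
    by (simp add: algebra_simps)
  moreover have "bounded_memory (l * adeg f) (upd s A (aval e s) (aval f s))"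
    using abs_aval_le[OF Write(2,3), of f] adeg_pos[of f]
      bounded_memory_mono[OF Write(2), of "l * adeg f"]
    by (auto simp: bounded_memory_def upd_def)
  ultimately show ?case
    using runs.Write[of A e f s] by (auto simp: runs_within_def simp del: ccoef.simps)
next
  case (Seq c c')
  have 1: "runs_within c s (ccoef c * l) (sem c s)" "bounded_memory (l * cdeg c) (sem c s)"
    using Seq.IH(1)[of l s] Seq.prems by auto
  have 2: "runs_within c' (sem c s) (ccoef c' * (l * cdeg c)) (sem c' (sem c s))"
    "bounded_memory (l * cdeg c * cdeg c') (sem c' (sem c s))"
    using Seq.IH(2)[OF _ 1(2)] Seq.prems cdeg_pos[of c] by auto
  show ?case
    using runs_within_Seq[OF 1(1) 2(1)] 2(2) by (simp add: algebra_simps)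
next
  case (Cond b c c')
  have b: "bcost b s \<le> bcoef b * l" by (rule bcost_le[OF Cond.prems(2,3)])
  show ?case
  proof (cases "bval b s")
    case True
    obtain t where t: "t \<le> ccoef c * l" "runs c s t (sem c s)"
      and m: "bounded_memory (l * cdeg c) (sem c s)"
      using Cond.IH(1)[OF _ Cond.prems(2,3)] Cond.prems by (auto simp: runs_within_def)
    have "bcost b s + t + 1 \<le> ccoef (Cond b c c') * l"
      using b t(1) Cond.prems(3) by (simp add: algebra_simps)
    moreover have "bounded_memory (l * (cdeg c * cdeg c')) (sem c s)"
      by (rule bounded_memory_mono[OF m]) (simp add: cdeg_pos Suc_leI)
    ultimately show ?thesis
      using runs.CondTrue[OF True t(2), of c'] True
      by (auto simp: runs_within_def simp del: ccoef.simps)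
  next
    case False
    obtain t where t: "t \<le> ccoef c' * l" "runs c' s t (sem c' s)"
      and m: "bounded_memory (l * cdeg c') (sem c' s)"
      using Cond.IH(2)[OF _ Cond.prems(2,3)] Cond.prems by (auto simp: runs_within_def)
    have "bcost b s + t + 1 \<le> ccoef (Cond b c c') * l"
      using b t(1) Cond.prems(3) by (simp add: algebra_simps)
    moreover have "bounded_memory (l * (cdeg c * cdeg c')) (sem c' s)"
      by (rule bounded_memory_mono[OF m]) (simp add: cdeg_pos Suc_leI)
    ultimately show ?thesis
      using runs.CondFalse[OF False t(2), of c] False
      by (auto simp: runs_within_def simp del: ccoef.simps)
  qed
qed simp

text \<open>Induction on the number \<open>r\<close> of remaining iterations. Bit lengths may grow
  within an iteration, but the growth does not accumulate, since the invariant reinstates the bound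
  \<open>2 ^ l\<close> each time.\<close>

lemma while_runs_from:
  assumes lf: "loop_free c" and l: "0 < l"
    and step: "\<And>k s. Inv k s \<Longrightarrow> k < K \<Longrightarrow> bval b s \<and> Inv (k + 1) (sem c s)"
    and stop: "\<And>s. Inv K s \<Longrightarrow> \<not> bval b s"
    and bd: "\<And>k s. Inv k s \<Longrightarrow> bounded_memory l s"
  shows "Inv k s \<Longrightarrow> k + r = K \<Longrightarrow>
    \<exists>s'. runs_within (While b c) s ((r + 1) * ((bcoef b + ccoef c + 1) * l)) s' \<and> Inv K s'"
proof (induction r arbitrary: k s)
  case 0
  then have "\<not> bval b s" using stop by simp
  moreover have "bcost b s + 1 \<le> (bcoef b + ccoef c + 1) * l"
    using bcost_le[OF bd[OF 0(1)] l, of b] l by (simp add: algebra_simps)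
  ultimately show ?case
    using runs.WhileFalse[of b s c] 0 by (auto simp: runs_within_def)
next
  case (Suc r)
  have b: "bval b s" and inv: "Inv (k + 1) (sem c s)"
    using step[OF Suc.prems(1)] Suc.prems(2) by auto
  obtain t where t: "t \<le> ccoef c * l" "runs c s t (sem c s)"
    using loop_free_runs[OF lf bd[OF Suc.prems(1)] l] by (auto simp: runs_within_def)
  obtain s' t' where t': "t' \<le> (r + 1) * ((bcoef b + ccoef c + 1) * l)"
    "runs (While b c) (sem c s) t' s'" "Inv K s'"
    using Suc.IH[OF inv] Suc.prems(2) by (auto simp: runs_within_def)
  have "bcost b s + t + t' + 1 \<le> (Suc r + 1) * ((bcoef b + ccoef c + 1) * l)"
    using bcost_le[OF bd[OF Suc.prems(1)] l, of b] l t(1) t'(1) by (simp add: algebra_simps)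
  then show ?case
    using runs.WhileTrue[OF b t(2) t'(2)] t'(3) unfolding runs_within_def by blast
qed

definition loop_coef :: "bexp \<Rightarrow> com \<Rightarrow> nat" where
  "loop_coef b c = bcoef b + ccoef c + 1"

lemma loop_runs:
  assumes "loop_free c" and "0 < l"
    and "\<And>k s. Inv k s \<Longrightarrow> k < K \<Longrightarrow> bval b s \<and> Inv (k + 1) (sem c s)"
    and "\<And>s. Inv K s \<Longrightarrow> \<not> bval b s"
    and "\<And>k s. Inv k s \<Longrightarrow> bounded_memory l s"
    and "Inv 0 s"
  obtains s' where "runs_within (While b c) s ((K + 1) * (loop_coef b c * l)) s'" and "Inv K s'"
proof -
  have "\<exists>s'. runs_within (While b c) s ((K + 1) * ((bcoef b + ccoef c + 1) * l)) s' \<and> Inv K s'"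
    using while_runs_from[where Inv = Inv and k = 0 and r = K and K = K, OF assms(1-5) assms(6)] by simp
  then show ?thesis using that unfolding loop_coef_def by blast
qed

fun written :: "com \<Rightarrow> string set" where
  "written (Write A e f) = {A}"
| "written (Seq c c') = written c \<union> written c'"
| "written (Cond b c c') = written c \<union> written c'"
| "written _ = {}"

lemma sem_unwritten: "A \<notin> written c \<Longrightarrow> sem c s A = s A"
  by (induction c arbitrary: s) (auto simp: upd_def)

abbreviation var :: "string \<Rightarrow> aexp" where "var x \<equiv> Read x (Const 0)"
abbreviation assign :: "string \<Rightarrow> aexp \<Rightarrow> com" where "assign x e \<equiv> Write x (Const 0) e"

lemma bounded_memory_upd:
  "bounded_memory l s \<Longrightarrow> \<bar>v\<bar> \<le> 2 ^ l \<Longrightarrow> bounded_memory l (upd s A i v)"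
  by (auto simp: bounded_memory_def upd_def)

text \<open>Scalars live in cell 0. If only such cells are written and the temporaries are cleared
  afterwards, the memory bound is restored without estimating intermediate values.\<close>

fun scalar_writes :: "com \<Rightarrow> bool" where
  "scalar_writes (Write A e f) = (e = Const 0)"
| "scalar_writes (Seq c c') = (scalar_writes c \<and> scalar_writes c')"
| "scalar_writes (Cond b c c') = (scalar_writes c \<and> scalar_writes c')"
| "scalar_writes _ = True"

lemma sem_scalar_writes: "scalar_writes c \<Longrightarrow> i \<noteq> 0 \<Longrightarrow> sem c s A i = s A i"
  by (induction c arbitrary: s) (auto simp: upd_def)

lemma sem_Cond_assign:
  "sem (Cond t (assign x e) Skip) s = upd s x 0 (if bval t s then aval e s else s x 0)"
  by (simp add: upd_def)

lemma sem_assign: "sem (assign x e) s x 0 = aval e s"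
  by (simp add: upd_def)

lemma upd_eq: "upd s A i v B = (if A = B then (s B)(i := v) else s B)"
  by (simp add: upd_def)

section \<open>The worst case as a minimum over fractional completions\<close>

lemma integral_fill:
  fixes lo hi :: "'a \<Rightarrow> nat"
  assumes "finite A" and "\<And>i. i \<in> A \<Longrightarrow> lo i \<le> hi i" and "sum lo A \<le> K" and "K \<le> sum hi A"
  shows "\<exists>z. (\<forall>i\<in>A. lo i \<le> z i \<and> z i \<le> hi i) \<and> sum z A = K"
  using assms
proof (induction A arbitrary: K rule: finite_induct)
  case (insert j A)
  \<comment> \<open>The new element gets as much as the lower bounds of the others leave
    available.\<close>
  define v where "v = min (hi j) (K - sum lo A)"
  have lh: "sum lo A \<le> sum hi A" using insert.prems(1) by (intro sum_mono) auto
  have v: "lo j \<le> v" "v \<le> hi j" "sum lo A \<le> K - v" "K - v \<le> sum hi A" "v \<le> K"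
    using insert.prems insert.hyps lh by (auto simp: v_def min_def)
  obtain z where z: "\<forall>i\<in>A. lo i \<le> z i \<and> z i \<le> hi i" "sum z A = K - v"
    using insert.IH[OF _ v(3,4)] insert.prems(1) by auto
  have "sum (z(j := v)) A = sum z A" using insert.hyps by (intro sum.cong) auto
  then show ?case
    using z v insert.hyps by (intro exI[of _ "z(j := v)"]) auto
qed simp

text \<open>\<open>\<tau>\<close> is a market price: each item offers \<open>r\<close> units at
  \<open>c\<close> and \<open>1 - r\<close> units at \<open>c + d\<close>; offers strictly below the
  price do not exceed the demand \<open>k\<close>, offers up to the price cover it. The load changes
  only at the finitely many offer prices \<open>B\<close>, so the first of them that covers the
  demand works.\<close>

lemma exists_threshold:
  fixes c d :: "'a \<Rightarrow> real" and r :: real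
  assumes A: "finite A" and k: "k \<le> card A"
  shows "\<exists>\<tau>. r * card {i\<in>A. c i < \<tau>} + (1 - r) * card {i\<in>A. c i + d i < \<tau>} \<le> k
    \<and> k \<le> r * card {i\<in>A. c i \<le> \<tau>} + (1 - r) * card {i\<in>A. c i + d i \<le> \<tau>}"
proof (cases "A = {}")
  case True
  then show ?thesis using k by simp
next
  case False
  define B where "B = c ` A \<union> (\<lambda>i. c i + d i) ` A"
  define load where "load \<tau> = r * card {i\<in>A. c i \<le> \<tau>} + (1 - r) * card {i\<in>A. c i + d i \<le> \<tau>}" for \<tau>
  have B: "finite B" "B \<noteq> {}" using A False by (auto simp: B_def)
  have "{i\<in>A. c i \<le> Max B} = A" "{i\<in>A. c i + d i \<le> Max B} = A"
    using B by (auto simp: B_def intro!: Max_ge)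
  then have "real k \<le> load (Max B)" using k by (simp add: load_def algebra_simps)
  then have ne: "{t\<in>B. k \<le> load t} \<noteq> {}" using Max_in[OF B] by auto
  define \<tau> where "\<tau> = Min {t\<in>B. k \<le> load t}"
  have \<tau>: "\<tau> \<in> B" "k \<le> load \<tau>" using Min_in[OF _ ne] B(1) by (auto simp: \<tau>_def)
  have min: "load t < k" if "t \<in> B" "t < \<tau>" for t
  proof (rule ccontr)
    assume "\<not> load t < k"
    then have "\<tau> \<le> t" unfolding \<tau>_def using that B(1) by (intro Min_le) auto
    with that show False by simp
  qed
  have "r * card {i\<in>A. c i < \<tau>} + (1 - r) * card {i\<in>A. c i + d i < \<tau>} \<le> k"
  proof (cases "{t\<in>B. t < \<tau>} = {}")
    case True
    then have e: "{i\<in>A. c i < \<tau>} = {}" "{i\<in>A. c i + d i < \<tau>} = {}" by (auto simp: B_def)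
    show ?thesis unfolding e by simp
  next
    case False
    \<comment> \<open>No offer lies strictly between \<open>t\<close> and \<open>\<tau>\<close>, so
      the offers below \<open>\<tau>\<close> are exactly those up to \<open>t\<close>, and
      \<open>t\<close> does not cover the demand.\<close>
    define t where "t = Max {t\<in>B. t < \<tau>}"
    have t: "t \<in> B" "t < \<tau>" using Max_in[OF _ False] B(1) by (auto simp: t_def)
    have le: "s \<le> t" if "s \<in> B" "s < \<tau>" for s
      unfolding t_def using that B(1) by (intro Max_ge) auto
    have "{i\<in>A. c i < \<tau>} = {i\<in>A. c i \<le> t}" "{i\<in>A. c i + d i < \<tau>} = {i\<in>A. c i + d i \<le> t}"
      using le t by (force simp: B_def)+
    then show ?thesis using min[OF t] by (simp add: load_def)
  qed
  with \<tau>(2) show ?thesis unfolding load_def by blast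
qed

text \<open>\<open>\<alpha>\<close> and \<open>\<beta>\<close> are the neighbours of
  \<open>r\<close> among the fractions in [0, 1] with denominator at most \<open>G\<close>. A zero
  of \<open>u - v * s\<close> in [0, 1] is itself such a fraction, so an expression that is
  nonnegative at \<open>r\<close> cannot turn negative at a neighbour.\<close>

lemma exists_farey_interval:
  fixes r :: real
  assumes r: "0 \<le> r" "r \<le> 1" and G: "1 \<le> G"
  defines "F \<equiv> {real a / real b |a b. 1 \<le> b \<and> b \<le> G \<and> a \<le> b}"
  shows "\<exists>\<alpha>\<in>F. \<exists>\<beta>\<in>F. \<alpha> \<le> r \<and> r \<le> \<beta> \<and>
    (\<forall>u v :: int. \<bar>v\<bar> \<le> int G \<longrightarrow> 0 \<le> real_of_int u - real_of_int v * r \<longrightarrow>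
      0 \<le> real_of_int u - real_of_int v * \<alpha> \<and> 0 \<le> real_of_int u - real_of_int v * \<beta>)"
proof -
  have "F \<subseteq> (\<lambda>(a, b). real a / real b) ` ({..G} \<times> {..G})" by (auto simp: F_def)
  then have fin: "finite F" by (rule finite_subset) auto
  have "real 0 / real 1 \<in> F" "real 1 / real 1 \<in> F" using G unfolding F_def by blast+
  then have 01: "0 \<in> F" "1 \<in> F" by auto
  define \<alpha> where "\<alpha> = Max {f\<in>F. f \<le> r}"
  define \<beta> where "\<beta> = Min {f\<in>F. r \<le> f}"
  have \<alpha>: "\<alpha> \<in> F" "\<alpha> \<le> r"
  proof -
    have "finite {f\<in>F. f \<le> r}" "{f\<in>F. f \<le> r} \<noteq> {}" using fin 01 r by auto
    from Max_in[OF this] show "\<alpha> \<in> F" "\<alpha> \<le> r" by (auto simp: \<alpha>_def)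
  qed
  have \<beta>: "\<beta> \<in> F" "r \<le> \<beta>"
  proof -
    have "finite {f\<in>F. r \<le> f}" "{f\<in>F. r \<le> f} \<noteq> {}" using fin 01 r by auto
    from Min_in[OF this] show "\<beta> \<in> F" "r \<le> \<beta>" by (auto simp: \<beta>_def)
  qed
  have le\<alpha>: "f \<le> \<alpha>" if "f \<in> F" "f \<le> r" for f
    unfolding \<alpha>_def using that fin by (intro Max_ge) auto
  have le\<beta>: "\<beta> \<le> f" if "f \<in> F" "r \<le> f" for f
    unfolding \<beta>_def using that fin by (intro Min_le) auto
  have F01: "0 \<le> f \<and> f \<le> 1" if f: "f \<in> F" for f
  proof -
    obtain a b :: nat where "f = real a / real b" "1 \<le> b" "a \<le> b" using f unfolding F_def by blast
    then show ?thesis by simp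
  qed
  \<comment> \<open>Both numbers may be negative; a nonnegative quotient equals the quotient of the
    absolute values.\<close>
  have quot: "real_of_int u / real_of_int v \<in> F"
    if "0 \<le> real_of_int u / real_of_int v" "real_of_int u / real_of_int v \<le> 1" "v \<noteq> 0" "\<bar>v\<bar> \<le> int G" for u v
  proof -
    have eq: "real_of_int u / real_of_int v = real (nat \<bar>u\<bar>) / real (nat \<bar>v\<bar>)"
      using that(1) by (simp flip: abs_divide)
    have "real (nat \<bar>u\<bar>) \<le> real (nat \<bar>v\<bar>)"
      using that(2,3) unfolding eq by (simp add: divide_simps split: if_splits)
    then have "nat \<bar>u\<bar> \<le> nat \<bar>v\<bar>" by linarith
    moreover have "1 \<le> nat \<bar>v\<bar>" "nat \<bar>v\<bar> \<le> G" using that(3,4) by auto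
    ultimately show ?thesis unfolding eq F_def by blast
  qed
  have "0 \<le> real_of_int u - v * \<alpha> \<and> 0 \<le> real_of_int u - v * \<beta>" if v: "\<bar>v\<bar> \<le> int G" and g: "0 \<le> real_of_int u - v * r" for u v :: int
  proof (cases v "0::int" rule: linorder_cases)
    case equal
    then show ?thesis using g by simp
  next
    case greater
    have "v * \<alpha> \<le> v * r" using greater \<alpha>(2) by (intro mult_left_mono) auto
    moreover have "0 \<le> real_of_int u - v * \<beta>"
    proof (rule ccontr)
      assume "\<not> 0 \<le> real_of_int u - v * \<beta>"
      \<comment> \<open>The zero \<open>u / v\<close> would be a fraction at least \<open>r\<close>
        but below \<open>\<beta>\<close>, against the choice of \<open>\<beta>\<close>.\<close>
      then have lt: "u / v < \<beta>" and ge: "r \<le> u / v" using greater g by (auto simp: field_simps)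
      then show False using le\<beta>[OF quot[of u v] ge] F01[OF \<beta>(1)] greater v r by linarith
    qed
    ultimately show ?thesis using g by simp
  next
    case less
    have "v * \<beta> \<le> v * r" using less \<beta>(2) by (intro mult_left_mono_neg) auto
    moreover have "0 \<le> real_of_int u - v * \<alpha>"
    proof (rule ccontr)
      assume "\<not> 0 \<le> real_of_int u - v * \<alpha>"
      then have lt: "\<alpha> < u / v" and ge: "u / v \<le> r" using less g by (auto simp: field_simps)
      then show False using le\<alpha>[OF quot[of u v] ge] F01[OF \<alpha>(1)] less v r by linarith
    qed
    ultimately show ?thesis using g by simp
  qed
  with \<alpha> \<beta> show ?thesis by blast
qed

text \<open>
  \<open>z\<close> units out of \<open>b\<close> are bought at unit price \<open>c\<close> up to \<open>a\<close> units and \<open>c + d\<close> beyond;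
  \<open>\<tau>\<close> is the market price.
\<close>

definition unit_cost :: "nat \<Rightarrow> real \<Rightarrow> real \<Rightarrow> nat \<Rightarrow> real" where
  "unit_cost a c d z = c * z + d * real (z - a)"

text \<open>Complementary slackness: an amount between the strictly and the weakly profitable supply
  costs its market value minus the rents, \<open>\<tau> - c\<close> on \<open>a\<close> units and
  \<open>\<tau> - c - d\<close> on \<open>b - a\<close> units.\<close>

lemma unit_cost_at_price:
  fixes c d \<tau> :: real
  assumes "a \<le> b" and "0 \<le> d"
    and "(if c < \<tau> then a else 0) + (if c + d < \<tau> then b - a else 0) \<le> z"
    and "z \<le> (if c \<le> \<tau> then a else 0) + (if c + d \<le> \<tau> then b - a else 0)"
  shows "unit_cost a c d z = \<tau> * z - a * max 0 (\<tau> - c) - (real b - real a) * max 0 (\<tau> - c - d)"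
proof -
  \<comment> \<open>In this order the amount is 0, at most \<open>a\<close>, at most
    \<open>b\<close>, exactly \<open>a\<close>, at least \<open>a\<close>, exactly \<open>b\<close>.
    In the fifth case \<open>a \<le> z\<close> makes the truncated \<open>z - a\<close> a true
    difference.\<close>
  consider "\<tau> < c" | "\<tau> = c" "0 < d" | "\<tau> = c" "d = 0" | "c < \<tau>" "\<tau> < c + d" | "c < \<tau>" "\<tau> = c + d" | "c + d < \<tau>"
    using assms(2) by linarith
  then show ?thesis
  proof cases
    case 5
    then have "a \<le> z" using assms(3) by simp
    with 5 show ?thesis by (simp add: unit_cost_def of_nat_diff algebra_simps)
  qed (use assms in \<open>auto simp: unit_cost_def of_nat_diff algebra_simps\<close>)
qed

text \<open>The cost on the right does not depend on the amounts chosen, so any integral filling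
  between the two supply levels of each item will do. For fixed \<open>\<tau>\<close> it is linear
  in \<open>a\<close> and \<open>b\<close>.\<close>

lemma greedy_purchase:
  fixes c d :: "'a \<Rightarrow> real"
  assumes A: "finite A" and ab: "a \<le> b" and d: "\<And>i. i \<in> A \<Longrightarrow> 0 \<le> d i"
    and lo: "a * card {i\<in>A. c i < \<tau>} + (b - a) * card {i\<in>A. c i + d i < \<tau>} \<le> b * k"
    and hi: "b * k \<le> a * card {i\<in>A. c i \<le> \<tau>} + (b - a) * card {i\<in>A. c i + d i \<le> \<tau>}"
  shows "\<exists>z. (\<forall>i\<in>A. z i \<le> b) \<and> sum z A = b * k \<and>
    (\<Sum>i\<in>A. unit_cost a (c i) (d i) (z i)) =
      \<tau> * real (b * k) - a * (\<Sum>i\<in>A. max 0 (\<tau> - c i)) - (real b - real a) * (\<Sum>i\<in>A. max 0 (\<tau> - c i - d i))"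
proof -
  let ?lo = "\<lambda>i. (if c i < \<tau> then a else 0) + (if c i + d i < \<tau> then b - a else 0)"
  let ?hi = "\<lambda>i. (if c i \<le> \<tau> then a else 0) + (if c i + d i \<le> \<tau> then b - a else 0)"
  have ind: "(\<Sum>i\<in>A. if P i then e else 0) = e * card {i\<in>A. P i}" for P and e :: nat
    using A by (simp add: sum.If_cases Int_def conj_commute)
  have "sum ?lo A \<le> b * k" "b * k \<le> sum ?hi A"
    using lo hi by (simp_all add: sum.distrib ind)
  moreover have "?lo i \<le> ?hi i" for i by auto
  ultimately obtain z where z: "\<forall>i\<in>A. ?lo i \<le> z i \<and> z i \<le> ?hi i" "sum z A = b * k"
    using integral_fill[OF A, of ?lo ?hi "b * k"] by blast
  have "(\<Sum>i\<in>A. unit_cost a (c i) (d i) (z i)) =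
      (\<Sum>i\<in>A. \<tau> * z i - a * max 0 (\<tau> - c i) - (real b - real a) * max 0 (\<tau> - c i - d i))"
    using z(1) ab d by (intro sum.cong refl unit_cost_at_price) auto
  also have "\<dots> = \<tau> * real (sum z A) - a * (\<Sum>i\<in>A. max 0 (\<tau> - c i)) - (real b - real a) * (\<Sum>i\<in>A. max 0 (\<tau> - c i - d i))"
    by (simp add: sum_subtractf sum_distrib_left)
  finally have "(\<Sum>i\<in>A. unit_cost a (c i) (d i) (z i)) =
      \<tau> * real (b * k) - a * (\<Sum>i\<in>A. max 0 (\<tau> - c i)) - (real b - real a) * (\<Sum>i\<in>A. max 0 (\<tau> - c i - d i))"
    by (simp add: z(2))
  moreover have "\<forall>i\<in>A. z i \<le> b"
  proof
    fix i assume "i \<in> A"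
    then have "z i \<le> ?hi i" using z(1) by blast
    also have "\<dots> \<le> a + (b - a)" by (intro add_mono) auto
    finally show "z i \<le> b" using ab by simp
  qed
  ultimately show ?thesis using z(2) by (intro exI[of _ z] conjI)
qed

lemma exists_between_sets:
  fixes L U :: "real set"
  assumes "L \<noteq> {}" and "\<And>l u. l \<in> L \<Longrightarrow> u \<in> U \<Longrightarrow> l \<le> u" and "U \<noteq> {}"
  shows "\<exists>r. (\<forall>l\<in>L. l \<le> r) \<and> (\<forall>u\<in>U. r \<le> u)"
proof (intro exI conjI ballI)
  have "bdd_above L" using assms(2,3) by (meson bdd_aboveI ex_in_conv)
  then show "l \<le> Sup L" if "l \<in> L" for l using that by (rule cSup_upper[rotated])
  show "Sup L \<le> u" if "u \<in> U" for u using assms(1,2) that by (intro cSup_least) auto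
qed

section \<open>Fractional completions of a first-stage solution\<close>

locale mrs_instance =
  fixes I :: mrs
  assumes inst: "I \<in> mrs_instances"
begin

abbreviation "N \<equiv> {1..num_items I}"
abbreviation "M \<equiv> {1..num_parts I}"
abbreviation low :: "nat \<Rightarrow> real" where "low i \<equiv> of_rat (lower_cost I i)"
abbreviation dev :: "nat \<Rightarrow> real" where "dev i \<equiv> of_rat (deviation I i)"
abbreviation \<Gamma> :: real where "\<Gamma> \<equiv> of_rat (budget I)"

lemma nonneg: "i \<in> N \<Longrightarrow> 0 \<le> low i" "i \<in> N \<Longrightarrow> 0 \<le> dev i" "0 \<le> \<Gamma>"
  using inst by (auto simp: mrs_instances_def)

lemma part_inj: "i \<in> part I j \<Longrightarrow> i \<in> part I k \<Longrightarrow> j \<in> M \<Longrightarrow> k \<in> M \<Longrightarrow> j = k"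
  using inst by (fastforce simp: mrs_instances_def disjoint_family_on_def)

lemma part_of_eq: "i \<in> part I j \<Longrightarrow> j \<in> M \<Longrightarrow> part_of I i = j"
  unfolding part_of_def using part_inj by blast

lemma part_of_mem:
  assumes "i \<in> N"
  shows "part_of I i \<in> M" and "i \<in> part I (part_of I i)"
proof -
  obtain j where "j \<in> M" "i \<in> part I j"
    using assms inst unfolding mrs_instances_def by blast
  then show "part_of I i \<in> M" and "i \<in> part I (part_of I i)" using part_of_eq by auto
qed

lemma part_eq: "j \<in> M \<Longrightarrow> part I j = {i\<in>N. part_of I i = j}"
  using part_of_eq part_of_mem finite_part(2)[OF inst] by blast

lemma sum_over_parts: "(\<Sum>i\<in>N. f i) = (\<Sum>j\<in>M. \<Sum>i\<in>part I j. f i)"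
proof -
  have "N = (\<Union>j\<in>M. part I j)" using inst by (simp add: mrs_instances_def)
  then have "(\<Sum>i\<in>N. f i) = (\<Sum>i\<in>(\<Union>j\<in>M. part I j). f i)" by simp
  also have "\<dots> = (\<Sum>j\<in>M. \<Sum>i\<in>part I j. f i)"
    using finite_part[OF inst] part_inj by (intro sum.UNION_disjoint) auto
  finally show ?thesis .
qed

text \<open>\<open>z i / b\<close> plays the role of y_i; scaling by the denominator keeps
  everything in the natural numbers.\<close>

definition fractional_recourse :: "(nat \<Rightarrow> nat) \<Rightarrow> nat \<Rightarrow> (nat \<Rightarrow> nat) \<Rightarrow> bool" where
  "fractional_recourse x b z \<longleftrightarrow> (\<forall>i\<in>N. b * x i + z i \<le> b) \<and>
     (\<forall>j\<in>M. (\<Sum>i\<in>part I j. b * x i + z i) = b * demand I j)"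

text \<open>The second-stage objective of the mixed-integer program at pi = \<open>a / b\<close>,
  with the best choice rho_i = max 0 (y_i - pi), which the truncated subtraction in
  \<open>unit_cost\<close> supplies.\<close>

definition fractional_cost :: "nat \<Rightarrow> nat \<Rightarrow> (nat \<Rightarrow> nat) \<Rightarrow> real" where
  "fractional_cost a b z = (\<Gamma> * a + (\<Sum>i\<in>N. unit_cost a (low i) (dev i) (z i))) / b"

context
  fixes x :: "nat \<Rightarrow> nat"
  assumes x: "x \<in> first_stage I"
begin

definition free :: "nat \<Rightarrow> nat set" where "free j = {i\<in>part I j. x i = 0}"
definition need :: "nat \<Rightarrow> nat" where "need j = demand I j - (\<Sum>i\<in>part I j. x i)"

lemma x01: "i \<in> N \<Longrightarrow> x i = 0 \<or> x i = 1"
  using x by (auto simp: first_stage_def PiE_iff)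

lemma finite_free: "j \<in> M \<Longrightarrow> finite (free j)"
  using finite_part(1)[OF inst] by (auto simp: free_def)

lemma free_subset: "j \<in> M \<Longrightarrow> free j \<subseteq> N"
  using finite_part(2)[OF inst] by (auto simp: free_def)

lemma card_free_le: "j \<in> M \<Longrightarrow> card (free j) \<le> num_items I"
  using card_mono[OF _ free_subset, of j] by simp

lemma sum_x_need: "j \<in> M \<Longrightarrow> (\<Sum>i\<in>part I j. x i) + need j = demand I j"
  using x by (auto simp: first_stage_def need_def)

lemma need_le_card:
  assumes j: "j \<in> M"
  shows "need j \<le> card (free j)"
proof -
  have fin: "finite (part I j)" and sub: "part I j \<subseteq> N"
    using finite_part[OF inst j] by auto
  have "(\<Sum>i\<in>part I j. x i) + card (free j) = (\<Sum>i\<in>part I j. x i + (if x i = 0 then 1 else 0))"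
    using fin by (simp add: sum.distrib free_def sum.If_cases Int_def conj_commute)
  also have "\<dots> = (\<Sum>i\<in>part I j. 1)"
    using x01 sub by (intro sum.cong) force+
  finally have "(\<Sum>i\<in>part I j. x i) + card (free j) = card (part I j)" by simp
  moreover have "demand I j \<le> card (part I j)"
    using inst j by (auto simp: mrs_instances_def)
  ultimately show ?thesis using sum_x_need[OF j] by linarith
qed

text \<open>An item bought in the first stage exhausts its capacity \<open>b\<close>, so only the
  items in \<open>free j\<close> can serve the residual demand \<open>need j\<close>.\<close>

lemma fractional_recourse_iff:
  assumes b: "1 \<le> b"
  shows "fractional_recourse x b z \<longleftrightarrow>
    (\<forall>i\<in>N. z i \<le> b \<and> (x i \<noteq> 0 \<longrightarrow> z i = 0)) \<and> (\<forall>j\<in>M. sum z (free j) = b * need j)"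
proof -
  have 1: "b * x i + z i \<le> b \<longleftrightarrow> z i \<le> b \<and> (x i \<noteq> 0 \<longrightarrow> z i = 0)" if "i \<in> N" for i
    using x01[OF that] by auto
  have 2: "(\<Sum>i\<in>part I j. b * x i + z i) = b * demand I j \<longleftrightarrow> sum z (free j) = b * need j"
    if z: "\<forall>i\<in>N. z i \<le> b \<and> (x i \<noteq> 0 \<longrightarrow> z i = 0)" and j: "j \<in> M" for j
  proof -
    have "sum z (part I j) = sum z (free j)"
      using finite_part[OF inst j] z by (intro sum.mono_neutral_right) (auto simp: free_def)
    then show ?thesis
      using sum_x_need[OF j, symmetric] by (simp add: sum.distrib algebra_simps flip: sum_distrib_left)
  qed
  show ?thesis unfolding fractional_recourse_def using 1 2 by blast
qed

lemma second_stage_iff: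
  "y \<in> second_stage I x \<longleftrightarrow> y \<in> N \<rightarrow>\<^sub>E {0, 1} \<and> fractional_recourse x 1 y"
  unfolding second_stage_def fractional_recourse_def by auto

lemma sum_free:
  fixes f :: "nat \<Rightarrow> real"
  assumes "\<forall>i\<in>N. x i \<noteq> 0 \<longrightarrow> f i = 0"
  shows "(\<Sum>i\<in>N. f i) = (\<Sum>j\<in>M. \<Sum>i\<in>free j. f i)"
  unfolding sum_over_parts
proof (rule sum.cong)
  fix j assume "j \<in> M"
  then show "sum f (part I j) = sum f (free j)"
    using finite_part[OF inst] assms by (intro sum.mono_neutral_right) (auto simp: free_def)
qed simp

text \<open>Weak duality for arbitrary prices: the residual demand is valued at
  \<open>\<tau> j\<close> per unit, and each of at most \<open>b\<close> units of an item undercuts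
  this price by at most \<open>max 0 (\<tau> j - c i)\<close>.\<close>

lemma price_lower_bound:
  fixes c \<tau> :: "nat \<Rightarrow> real"
  assumes b: "1 \<le> b" and z: "fractional_recourse x b z"
  shows "(\<Sum>j\<in>M. \<tau> j * real (b * need j) - b * (\<Sum>i\<in>free j. max 0 (\<tau> j - c i))) \<le> (\<Sum>i\<in>N. c i * z i)"
proof -
  have z': "\<And>i. i \<in> N \<Longrightarrow> z i \<le> b" "\<forall>i\<in>N. x i \<noteq> 0 \<longrightarrow> z i = 0" "\<And>j. j \<in> M \<Longrightarrow> sum z (free j) = b * need j"
    using z fractional_recourse_iff[OF b] by auto
  have "\<tau> j * real (b * need j) - b * (\<Sum>i\<in>free j. max 0 (\<tau> j - c i)) \<le> (\<Sum>i\<in>free j. c i * z i)" if j: "j \<in> M" for j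
  proof -
    have "\<tau> j * real (b * need j) = (\<Sum>i\<in>free j. \<tau> j * z i)"
      by (simp add: z'(3)[OF j, symmetric] flip: sum_distrib_left of_nat_sum of_nat_mult)
    also have "\<dots> \<le> (\<Sum>i\<in>free j. c i * z i + b * max 0 (\<tau> j - c i))"
    proof (rule sum_mono)
      fix i assume "i \<in> free j"
      then have "real (z i) \<le> b" using z'(1) free_subset[OF j] by auto
      then have "z i * (\<tau> j - c i) \<le> b * max 0 (\<tau> j - c i)"
        using mult_left_mono[of "\<tau> j - c i" "max 0 (\<tau> j - c i)" "real (z i)"]
          mult_right_mono[of "real (z i)" "real b" "max 0 (\<tau> j - c i)"] by simp
      then show "\<tau> j * z i \<le> c i * z i + b * max 0 (\<tau> j - c i)" by (simp add: algebra_simps)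
    qed
    finally show ?thesis by (simp add: sum.distrib sum_distrib_left)
  qed
  then show ?thesis
    using z'(2) by (subst sum_free) (auto intro: sum_mono)
qed

lemma recourse_le: "y \<in> second_stage I x \<Longrightarrow> recourse_cost I x c \<le> (\<Sum>i\<in>N. c i * real (y i))"
  unfolding recourse_cost_def using finite_second_stage by (intro Min_le) auto

lemma recourse_attained: "\<exists>y\<in>second_stage I x. recourse_cost I x c = (\<Sum>i\<in>N. c i * real (y i))"
proof -
  have "recourse_cost I x c \<in> (\<lambda>y. \<Sum>i\<in>N. c i * real (y i)) ` second_stage I x"
    unfolding recourse_cost_def
    using finite_second_stage second_stage_nonempty[OF inst x] by (intro Min_in) auto
  then show ?thesis by auto
qed

text \<open>Integrality of the recourse problem. Prices that clear every part admit a 0/1 purchase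
  whose cost equals the dual bound, below which no fractional completion can fall.\<close>

lemma recourse_le_fractional:
  assumes b: "1 \<le> b" and z: "fractional_recourse x b z"
  shows "b * recourse_cost I x c \<le> (\<Sum>i\<in>N. c i * z i)"
proof -
  have "\<exists>\<tau>. card {i\<in>free j. c i < \<tau>} \<le> need j \<and> need j \<le> card {i\<in>free j. c i \<le> \<tau>}" if j: "j \<in> M" for j
    \<comment> \<open>With \<open>r = 1\<close> the second tier of offers has weight 0.\<close>
    using exists_threshold[OF finite_free[OF j] need_le_card[OF j], of 1 c "\<lambda>_. 0"] by simp
  then have "\<forall>j\<in>M. \<exists>\<tau>. card {i\<in>free j. c i < \<tau>} \<le> need j \<and> need j \<le> card {i\<in>free j. c i \<le> \<tau>}"
    by blast
  from bchoice[OF this] obtain \<tau> where \<tau>: "\<And>j. j \<in> M \<Longrightarrow> card {i\<in>free j. c i < \<tau> j} \<le> need j"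
    "\<And>j. j \<in> M \<Longrightarrow> need j \<le> card {i\<in>free j. c i \<le> \<tau> j}"
    by blast
  have "\<forall>j\<in>M. \<exists>y. (\<forall>i\<in>free j. y i \<le> Suc 0) \<and> sum y (free j) = need j \<and>
      (\<Sum>i\<in>free j. c i * y i) = \<tau> j * need j - (\<Sum>i\<in>free j. max 0 (\<tau> j - c i))"
  proof
    fix j assume j: "j \<in> M"
    show "\<exists>y. (\<forall>i\<in>free j. y i \<le> Suc 0) \<and> sum y (free j) = need j \<and>
        (\<Sum>i\<in>free j. c i * y i) = \<tau> j * need j - (\<Sum>i\<in>free j. max 0 (\<tau> j - c i))"
      using greedy_purchase[OF finite_free[OF j], of 1 1 "\<lambda>_. 0" c "\<tau> j" "need j"] \<tau>[OF j]
      by (simp add: unit_cost_def)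
  qed
  from bchoice[OF this] obtain Y where Y: "\<And>j i. j \<in> M \<Longrightarrow> i \<in> free j \<Longrightarrow> Y j i \<le> Suc 0"
    "\<And>j. j \<in> M \<Longrightarrow> sum (Y j) (free j) = need j"
    "\<And>j. j \<in> M \<Longrightarrow> (\<Sum>i\<in>free j. c i * Y j i) = \<tau> j * need j - (\<Sum>i\<in>free j. max 0 (\<tau> j - c i))"
    by blast
  define y where "y = (\<lambda>i\<in>N. if x i = 0 then Y (part_of I i) i else 0)"
  have yY: "y i = Y j i" if "i \<in> free j" "j \<in> M" for i j
    using that part_of_eq[of i j] free_subset[OF that(2)] by (auto simp: y_def free_def)
  have y1: "y i \<le> 1" if "i \<in> N" for i
    using Y(1)[of "part_of I i" i] part_of_mem[OF that] that by (auto simp: y_def free_def)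
  have "y \<in> N \<rightarrow>\<^sub>E {0, 1}" using y1 by (auto simp: y_def PiE_iff le_Suc_eq)
  moreover have "fractional_recourse x 1 y"
    unfolding fractional_recourse_iff[OF order_refl]
  proof (intro conjI ballI)
    show "y i \<le> 1" if "i \<in> N" for i using y1[OF that] .
    show "x i \<noteq> 0 \<longrightarrow> y i = 0" if "i \<in> N" for i using that by (simp add: y_def)
    show "sum y (free j) = 1 * need j" if "j \<in> M" for j
      using Y(2)[OF that] that by (simp add: yY)
  qed
  ultimately have "y \<in> second_stage I x" by (simp add: second_stage_iff)
  then have "recourse_cost I x c \<le> (\<Sum>i\<in>N. c i * real (y i))" by (rule recourse_le)
  also have "\<dots> = (\<Sum>j\<in>M. \<Sum>i\<in>free j. c i * real (y i))"
    by (rule sum_free) (auto simp: y_def)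
  also have "\<dots> = (\<Sum>j\<in>M. \<tau> j * need j - (\<Sum>i\<in>free j. max 0 (\<tau> j - c i)))"
    using Y(3) by (intro sum.cong refl) (simp add: yY)
  finally have "b * recourse_cost I x c \<le> b * (\<Sum>j\<in>M. \<tau> j * need j - (\<Sum>i\<in>free j. max 0 (\<tau> j - c i)))"
    by (intro mult_left_mono) auto
  also have "\<dots> = (\<Sum>j\<in>M. \<tau> j * real (b * need j) - b * (\<Sum>i\<in>free j. max 0 (\<tau> j - c i)))"
    by (simp add: sum_distrib_left algebra_simps)
  also have "\<dots> \<le> (\<Sum>i\<in>N. c i * z i)" by (rule price_lower_bound[OF b z])
  finally show ?thesis .
qed

text \<open>Weak duality in the multiplier: the deviation paid on \<open>z i\<close> units is at
  most \<open>dev i\<close> on each unit beyond \<open>a\<close> plus \<open>\<delta> i\<close> on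
  \<open>a\<close> units, and the latter sum to at most \<open>\<Gamma> * a\<close>. This covers
  every \<open>a\<close>, including those above \<open>b\<close>.\<close>

lemma worst_case_le_fractional:
  assumes b: "1 \<le> b" and z: "fractional_recourse x b z"
  shows "worst_case_cost I x \<le> fractional_cost a b z"
proof -
  obtain c where c: "c \<in> uncertainty_set I" "worst_case_cost I x = recourse_cost I x c"
    using worst_case_attained[OF inst x] by blast
  obtain \<delta> where \<delta>: "\<And>i. i \<in> N \<Longrightarrow> 0 \<le> \<delta> i" "\<And>i. i \<in> N \<Longrightarrow> \<delta> i \<le> dev i"
    "\<And>i. i \<in> N \<Longrightarrow> c i = low i + \<delta> i" "(\<Sum>i\<in>N. \<delta> i) \<le> \<Gamma>"
  proof -
    obtain \<delta> where "\<delta> \<in> (\<Pi>\<^sub>E i\<in>N. {0..dev i})" "\<forall>i\<in>N. c i = low i + \<delta> i" "(\<Sum>i\<in>N. \<delta> i) \<le> \<Gamma>"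
      using c(1) unfolding uncertainty_set_def by blast
    then show ?thesis by (intro that[of \<delta>]) (force simp: PiE_iff)+
  qed
  have "b * worst_case_cost I x \<le> (\<Sum>i\<in>N. c i * z i)"
    unfolding c(2) by (rule recourse_le_fractional[OF b z])
  also have "\<dots> \<le> (\<Sum>i\<in>N. unit_cost a (low i) (dev i) (z i) + \<delta> i * a)"
  proof (rule sum_mono)
    fix i assume i: "i \<in> N"
    have "\<delta> i * z i \<le> \<delta> i * (real (z i - a) + a)"
      using \<delta>(1)[OF i] by (intro mult_left_mono) auto
    also have "\<dots> \<le> dev i * real (z i - a) + \<delta> i * a"
      using \<delta>(2)[OF i] by (simp add: distrib_left mult_right_mono)
    finally show "c i * z i \<le> unit_cost a (low i) (dev i) (z i) + \<delta> i * a"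
      by (simp add: unit_cost_def \<delta>(3)[OF i] algebra_simps)
  qed
  also have "\<dots> = (\<Sum>i\<in>N. unit_cost a (low i) (dev i) (z i)) + (\<Sum>i\<in>N. \<delta> i) * a"
    by (simp add: sum.distrib sum_distrib_right)
  also have "\<dots> \<le> (\<Sum>i\<in>N. unit_cost a (low i) (dev i) (z i)) + \<Gamma> * a"
    using \<delta>(4) by (intro add_left_mono mult_right_mono) auto
  finally show ?thesis
    using b by (simp add: fractional_cost_def field_simps)
qed

section \<open>Lagrangian relaxation of the budget constraint\<close>

definition perturbed :: "(nat \<Rightarrow> real) \<Rightarrow> real" where
  "perturbed \<delta> = recourse_cost I x (\<lambda>i. low i + \<delta> i)"

definition box :: "(nat \<Rightarrow> real) set" where
  "box = {\<delta>. \<forall>i\<in>N. 0 \<le> \<delta> i \<and> \<delta> i \<le> dev i}"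

lemma perturbed_le_worst_case:
  assumes "\<delta> \<in> box" and "(\<Sum>i\<in>N. \<delta> i) \<le> \<Gamma>"
  shows "perturbed \<delta> \<le> worst_case_cost I x"
proof -
  let ?c = "\<lambda>i\<in>N. low i + \<delta> i"
  have "?c \<in> uncertainty_set I"
    unfolding uncertainty_set_def
    using assms nonneg by (auto simp: box_def add_nonneg_nonneg intro!: bexI[of _ "\<lambda>i\<in>N. \<delta> i"])
  then have "recourse_cost I x ?c \<le> worst_case_cost I x"
    using worst_case_attained[OF inst x] by auto
  moreover have "recourse_cost I x ?c = perturbed \<delta>"
    unfolding perturbed_def recourse_cost_def
    by (intro arg_cong[where f = Min] image_cong sum.cong refl) auto
  ultimately show ?thesis by simp
qed

text \<open>A minimum of affine functions is concave: a completion that is optimal at the mixture is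
  feasible at both ends.\<close>

lemma perturbed_concave:
  assumes "0 \<le> t" "t \<le> 1"
  shows "t * perturbed \<delta> + (1 - t) * perturbed \<epsilon> \<le> perturbed (\<lambda>i. t * \<delta> i + (1 - t) * \<epsilon> i)"
proof -
  obtain y where y: "y \<in> second_stage I x"
    "perturbed (\<lambda>i. t * \<delta> i + (1 - t) * \<epsilon> i) = (\<Sum>i\<in>N. (low i + (t * \<delta> i + (1 - t) * \<epsilon> i)) * real (y i))"
    using recourse_attained unfolding perturbed_def by blast
  have "t * perturbed \<delta> \<le> t * (\<Sum>i\<in>N. (low i + \<delta> i) * real (y i))"
    unfolding perturbed_def using assms recourse_le[OF y(1)] by (intro mult_left_mono) auto
  moreover have "(1 - t) * perturbed \<epsilon> \<le> (1 - t) * (\<Sum>i\<in>N. (low i + \<epsilon> i) * real (y i))"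
    unfolding perturbed_def using assms recourse_le[OF y(1)] by (intro mult_left_mono) auto
  moreover have "t * (\<Sum>i\<in>N. (low i + \<delta> i) * real (y i)) + (1 - t) * (\<Sum>i\<in>N. (low i + \<epsilon> i) * real (y i))
      = (\<Sum>i\<in>N. (low i + (t * \<delta> i + (1 - t) * \<epsilon> i)) * real (y i))"
    by (simp add: sum_distrib_left algebra_simps flip: sum.distrib)
  ultimately show ?thesis using y(2) by linarith
qed

text \<open>No item is bought more than once, so raising its cost raises the total by at most the
  same amount. This is what keeps the multiplier below 1.\<close>

lemma perturbed_lipschitz:
  assumes "\<And>i. i \<in> N \<Longrightarrow> \<epsilon> i \<le> \<delta> i"
  shows "perturbed \<delta> \<le> perturbed \<epsilon> + (\<Sum>i\<in>N. \<delta> i - \<epsilon> i)"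
proof -
  obtain y where y: "y \<in> second_stage I x" "perturbed \<epsilon> = (\<Sum>i\<in>N. (low i + \<epsilon> i) * real (y i))"
    using recourse_attained unfolding perturbed_def by blast
  have "perturbed \<delta> \<le> (\<Sum>i\<in>N. (low i + \<delta> i) * real (y i))"
    unfolding perturbed_def by (rule recourse_le[OF y(1)])
  also have "\<dots> \<le> (\<Sum>i\<in>N. (low i + \<epsilon> i) * real (y i) + (\<delta> i - \<epsilon> i))"
  proof (rule sum_mono)
    fix i assume i: "i \<in> N"
    then have "y i = 0 \<or> y i = 1" using y(1) by (auto simp: second_stage_def PiE_iff)
    then show "(low i + \<delta> i) * real (y i) \<le> (low i + \<epsilon> i) * real (y i) + (\<delta> i - \<epsilon> i)"
      using assms[OF i] by auto
  qed
  finally show ?thesis by (simp add: sum.distrib y(2))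
qed

text \<open>
  Strong Lagrangian duality for the single constraint \<open>\<Sum>\<delta> \<le> \<Gamma>\<close>: every \<open>\<delta>\<close> exceeding the budget
  gives a lower bound for the multiplier, every \<open>\<delta>\<close> below the budget an upper bound, and concavity
  makes these bounds compatible.
\<close>

lemma exists_multiplier:
  "\<exists>r. 0 \<le> r \<and> r \<le> 1 \<and> (\<forall>\<delta>\<in>box. perturbed \<delta> + r * (\<Gamma> - (\<Sum>i\<in>N. \<delta> i)) \<le> worst_case_cost I x)"
proof -
  define v where "v = worst_case_cost I x"
  define S where "S \<delta> = (\<Sum>i\<in>N. \<delta> i)" for \<delta> :: "nat \<Rightarrow> real"
  \<comment> \<open>The 0 inserted here and the 1 inserted into \<open>U\<close> confine the
    separating number to [0, 1].\<close>
  define L where "L = insert 0 ((\<lambda>\<delta>. (perturbed \<delta> - v) / (S \<delta> - \<Gamma>)) ` {\<delta>\<in>box. \<Gamma> < S \<delta>})"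
  define U where "U = insert 1 ((\<lambda>\<delta>. (v - perturbed \<delta>) / (\<Gamma> - S \<delta>)) ` {\<delta>\<in>box. S \<delta> < \<Gamma>})"
  have le_v: "perturbed \<delta> \<le> v" if "\<delta> \<in> box" "S \<delta> \<le> \<Gamma>" for \<delta>
    using perturbed_le_worst_case that by (simp add: S_def v_def)
  have L1: "(perturbed \<delta> - v) / (S \<delta> - \<Gamma>) \<le> 1" if \<delta>: "\<delta> \<in> box" "\<Gamma> < S \<delta>" for \<delta>
  proof -
    \<comment> \<open>Shrinking \<open>\<delta>\<close> onto the budget lowers the value by at most
      the excess \<open>S \<delta> - \<Gamma>\<close>.\<close>
    define t where "t = \<Gamma> / S \<delta>"
    have t: "0 \<le> t" "t \<le> 1" "t * S \<delta> = \<Gamma>"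
      using \<delta>(2) nonneg(3) by (simp_all add: t_def del: zero_le_of_rat_iff)
    have tle: "t * \<delta> i \<le> \<delta> i" if "i \<in> N" for i
      using t \<delta>(1) that by (auto simp: box_def intro!: mult_left_le_one_le)
    have St: "S (\<lambda>i. t * \<delta> i) = \<Gamma>" using t(3) by (simp add: S_def sum_distrib_left)
    have "(\<lambda>i. t * \<delta> i) \<in> box"
      unfolding box_def
    proof (intro CollectI ballI conjI)
      fix i assume i: "i \<in> N"
      then have "0 \<le> \<delta> i" "\<delta> i \<le> dev i" using \<delta>(1) by (auto simp: box_def)
      then show "0 \<le> t * \<delta> i" "t * \<delta> i \<le> dev i" using t(1) tle[OF i] by auto
    qed
    then have "perturbed (\<lambda>i. t * \<delta> i) \<le> v" using le_v St by simp
    moreover have "perturbed \<delta> \<le> perturbed (\<lambda>i. t * \<delta> i) + (\<Sum>i\<in>N. \<delta> i - t * \<delta> i)"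
      using tle by (rule perturbed_lipschitz)
    moreover have "(\<Sum>i\<in>N. \<delta> i - t * \<delta> i) = S \<delta> - \<Gamma>" using St by (simp add: S_def sum_subtractf)
    ultimately show ?thesis using \<delta>(2) by (simp add: divide_simps)
  qed
  have LU: "(perturbed \<delta> - v) / (S \<delta> - \<Gamma>) \<le> (v - perturbed \<epsilon>) / (\<Gamma> - S \<epsilon>)"
    if \<delta>: "\<delta> \<in> box" "\<Gamma> < S \<delta>" and \<epsilon>: "\<epsilon> \<in> box" "S \<epsilon> < \<Gamma>" for \<delta> \<epsilon>
  proof -
    \<comment> \<open>The weight for which the mixture of the two deviations spends exactly
      \<open>\<Gamma>\<close>.\<close>
    define t where "t = (\<Gamma> - S \<epsilon>) / (S \<delta> - S \<epsilon>)"
    have pos: "0 < S \<delta> - S \<epsilon>" using \<delta> \<epsilon> by simp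
    have t: "0 \<le> t" "t \<le> 1" "t * (S \<delta> - S \<epsilon>) = \<Gamma> - S \<epsilon>"
      using \<delta> \<epsilon> by (auto simp: t_def)
    let ?m = "\<lambda>i. t * \<delta> i + (1 - t) * \<epsilon> i"
    have "S ?m = t * S \<delta> + (1 - t) * S \<epsilon>" by (simp add: S_def sum.distrib sum_distrib_left)
    then have Sm: "S ?m = \<Gamma>" using t(3) by (simp add: algebra_simps)
    have "?m \<in> box"
      unfolding box_def
    proof (intro CollectI ballI conjI)
      fix i assume "i \<in> N"
      then have b: "0 \<le> \<delta> i" "\<delta> i \<le> dev i" "0 \<le> \<epsilon> i" "\<epsilon> i \<le> dev i" using \<delta> \<epsilon> by (auto simp: box_def)
      show "0 \<le> t * \<delta> i + (1 - t) * \<epsilon> i" using t b by simp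
      show "t * \<delta> i + (1 - t) * \<epsilon> i \<le> dev i" using t b by (intro convex_bound_le) auto
    qed
    then have "t * perturbed \<delta> + (1 - t) * perturbed \<epsilon> \<le> v"
      using perturbed_concave[OF t(1,2), of \<delta> \<epsilon>] le_v[of ?m] Sm by simp
    then have "t * (perturbed \<delta> - v) \<le> (1 - t) * (v - perturbed \<epsilon>)" by (simp add: algebra_simps)
    then have "(S \<delta> - S \<epsilon>) * (t * (perturbed \<delta> - v)) \<le> (S \<delta> - S \<epsilon>) * ((1 - t) * (v - perturbed \<epsilon>))"
      using pos by (intro mult_left_mono) auto
    moreover have "(S \<delta> - S \<epsilon>) * t = \<Gamma> - S \<epsilon>" "(S \<delta> - S \<epsilon>) * (1 - t) = S \<delta> - \<Gamma>"
      using t(3) by (simp_all add: algebra_simps)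
    ultimately have "(\<Gamma> - S \<epsilon>) * (perturbed \<delta> - v) \<le> (S \<delta> - \<Gamma>) * (v - perturbed \<epsilon>)"
      by (simp flip: mult.assoc)
    then show ?thesis using \<delta> \<epsilon> by (simp add: divide_simps mult.commute)
  qed
  have "\<exists>r. (\<forall>l\<in>L. l \<le> r) \<and> (\<forall>u\<in>U. r \<le> u)"
  proof (rule exists_between_sets)
    show "l \<le> u" if "l \<in> L" "u \<in> U" for l u
      using that L1 LU le_v unfolding L_def U_def
      by (auto simp: divide_nonneg_pos less_imp_le)
  qed (auto simp: L_def U_def)
  then obtain r where r: "\<And>l. l \<in> L \<Longrightarrow> l \<le> r" "\<And>u. u \<in> U \<Longrightarrow> r \<le> u" by blast
  have "perturbed \<delta> + r * (\<Gamma> - S \<delta>) \<le> v" if \<delta>: "\<delta> \<in> box" for \<delta>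
  proof (cases "S \<delta>" \<Gamma> rule: linorder_cases)
    case equal
    then show ?thesis using le_v[OF \<delta>] by simp
  next
    case less
    then have "r \<le> (v - perturbed \<delta>) / (\<Gamma> - S \<delta>)" using \<delta> by (intro r(2)) (auto simp: U_def)
    then show ?thesis using less by (simp add: field_simps)
  next
    case greater
    then have "(perturbed \<delta> - v) / (S \<delta> - \<Gamma>) \<le> r" using \<delta> by (intro r(1)) (auto simp: L_def)
    then show ?thesis using greater by (simp add: field_simps)
  qed
  moreover have "0 \<le> r" "r \<le> 1" using r by (auto simp: L_def U_def)
  ultimately show ?thesis by (auto simp: v_def S_def)
qed

text \<open>Prices that clear the market at an optimal multiplier \<open>r\<close> yield an affine
  dual value \<open>l\<close> with \<open>l r\<close> at most the worst case. They still clear it at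
  both Farey neighbours of \<open>r\<close>; at one of these \<open>l\<close> is no larger, and a
  greedy purchase there realizes the dual value by a completion.\<close>

lemma fractional_le_worst_case:
  assumes G: "num_items I \<le> G" "1 \<le> G"
  shows "\<exists>a b z. 1 \<le> b \<and> b \<le> G \<and> a \<le> b \<and> fractional_recourse x b z \<and>
    fractional_cost a b z \<le> worst_case_cost I x"
proof -
  obtain r where r: "0 \<le> r" "r \<le> 1"
    and mult: "\<And>\<delta>. \<delta> \<in> box \<Longrightarrow> perturbed \<delta> + r * (\<Gamma> - (\<Sum>i\<in>N. \<delta> i)) \<le> worst_case_cost I x"
    using exists_multiplier by blast
  \<comment> \<open>The price \<open>t\<close> clears part \<open>j\<close> at multiplier
    \<open>q\<close>.\<close>
  define P where "P q j t \<longleftrightarrow>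
      q * card {i\<in>free j. low i < t} + (1 - q) * card {i\<in>free j. low i + dev i < t} \<le> need j \<and>
      need j \<le> q * card {i\<in>free j. low i \<le> t} + (1 - q) * card {i\<in>free j. low i + dev i \<le> t}"
    for q :: real and j t
  have "\<forall>j\<in>M. \<exists>t. P r j t"
    unfolding P_def by (intro ballI exists_threshold finite_free need_le_card)
  from bchoice[OF this] obtain \<tau> where \<tau>: "\<And>j. j \<in> M \<Longrightarrow> P r j (\<tau> j)" by blast
  define p where "p j = (\<Sum>i\<in>free j. max 0 (\<tau> j - low i))" for j
  define q where "q j = (\<Sum>i\<in>free j. max 0 (\<tau> j - low i - dev i))" for j
  \<comment> \<open>Price of the budget plus market value of the demand minus the rents; affine in
    \<open>s\<close> because \<open>\<tau>\<close> is fixed.\<close>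
  define l where "l s = \<Gamma> * s + (\<Sum>j\<in>M. \<tau> j * need j - s * p j - (1 - s) * q j)" for s
  \<comment> \<open>The adversary raises a free item towards its market price, not beyond it and by
    at most \<open>dev i\<close>. The rents that remain at these costs are those collected in
    \<open>q\<close>.\<close>
  define \<delta> where "\<delta> i = (if x i = 0 then min (dev i) (max 0 (\<tau> (part_of I i) - low i)) else 0)" for i
  have \<delta>box: "\<delta> \<in> box" using nonneg(2) by (auto simp: box_def \<delta>_def)
  have \<delta>_free: "\<delta> i = max 0 (\<tau> j - low i) - max 0 (\<tau> j - low i - dev i)"
    "max 0 (\<tau> j - (low i + \<delta> i)) = max 0 (\<tau> j - low i - dev i)" if "j \<in> M" "i \<in> free j" for i j
  proof -
    have "0 \<le> dev i" using nonneg(2) free_subset[OF that(1)] that(2) by blast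
    moreover have "\<delta> i = min (dev i) (max 0 (\<tau> j - low i))"
      using that part_of_eq[of i j] by (auto simp: \<delta>_def free_def)
    ultimately show "\<delta> i = max 0 (\<tau> j - low i) - max 0 (\<tau> j - low i - dev i)"
      "max 0 (\<tau> j - (low i + \<delta> i)) = max 0 (\<tau> j - low i - dev i)"
      by linarith+
  qed
  have "l r \<le> worst_case_cost I x"
  proof -
    obtain y where y: "y \<in> second_stage I x" "perturbed \<delta> = (\<Sum>i\<in>N. (low i + \<delta> i) * real (y i))"
      using recourse_attained unfolding perturbed_def by blast
    have "(\<Sum>j\<in>M. \<tau> j * need j - (\<Sum>i\<in>free j. max 0 (\<tau> j - (low i + \<delta> i)))) \<le> perturbed \<delta>"
      using price_lower_bound[of 1 y \<tau> "\<lambda>i. low i + \<delta> i"] y second_stage_iff by simp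
    moreover have "(\<Sum>j\<in>M. \<tau> j * need j - (\<Sum>i\<in>free j. max 0 (\<tau> j - (low i + \<delta> i)))) = (\<Sum>j\<in>M. \<tau> j * need j - q j)"
      by (intro sum.cong refl) (simp add: q_def \<delta>_free(2))
    moreover have "(\<Sum>i\<in>N. \<delta> i) = (\<Sum>j\<in>M. p j - q j)"
    proof -
      have "(\<Sum>i\<in>N. \<delta> i) = (\<Sum>j\<in>M. \<Sum>i\<in>free j. \<delta> i)" by (rule sum_free) (auto simp: \<delta>_def)
      also have "\<dots> = (\<Sum>j\<in>M. \<Sum>i\<in>free j. max 0 (\<tau> j - low i) - max 0 (\<tau> j - low i - dev i))"
        by (intro sum.cong refl \<delta>_free(1))
      finally show ?thesis by (simp add: p_def q_def sum_subtractf)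
    qed
    ultimately have "(\<Sum>j\<in>M. \<tau> j * need j - q j) + r * (\<Gamma> - (\<Sum>j\<in>M. p j - q j)) \<le> worst_case_cost I x"
      using mult[OF \<delta>box] by simp
    moreover have "l r = (\<Sum>j\<in>M. \<tau> j * need j - q j) + r * (\<Gamma> - (\<Sum>j\<in>M. p j - q j))"
      by (simp add: l_def sum_subtractf sum.distrib sum_distrib_left algebra_simps)
    ultimately show ?thesis by simp
  qed
  obtain \<alpha> \<beta> where F: "\<alpha> \<in> {real a / real b |a b. 1 \<le> b \<and> b \<le> G \<and> a \<le> b}"
      "\<beta> \<in> {real a / real b |a b. 1 \<le> b \<and> b \<le> G \<and> a \<le> b}"
    and between: "\<alpha> \<le> r" "r \<le> \<beta>"
    and sign: "\<And>u v :: int. \<bar>v\<bar> \<le> int G \<Longrightarrow> 0 \<le> real_of_int u - real_of_int v * r \<Longrightarrow>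
      0 \<le> real_of_int u - real_of_int v * \<alpha> \<and> 0 \<le> real_of_int u - real_of_int v * \<beta>"
    using exists_farey_interval[OF r G(2)] by blast
  have "P \<alpha> j (\<tau> j) \<and> P \<beta> j (\<tau> j)" if j: "j \<in> M" for j
  proof -
    have small: "\<bar>int (card {i\<in>free j. Q i}) - int (card {i\<in>free j. R i})\<bar> \<le> int G" for Q R
    proof -
      have "card {i\<in>free j. S i} \<le> G" for S
        using card_mono[OF finite_free[OF j], of "{i\<in>free j. S i}"] card_free_le[OF j] G by auto
      from this[of Q] this[of R] show ?thesis by linarith
    qed
    define e1 w1 e2 w2 where "e1 = int (card {i\<in>free j. low i < \<tau> j})"
      and "w1 = int (card {i\<in>free j. low i + dev i < \<tau> j})"
      and "e2 = int (card {i\<in>free j. low i \<le> \<tau> j})"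
      and "w2 = int (card {i\<in>free j. low i + dev i \<le> \<tau> j})"
    note defs = this
    \<comment> \<open>Each clearing condition is the nonnegativity of an affine function of
      \<open>s\<close> whose slope is a difference of two item counts, hence at most
      \<open>G\<close> in absolute value.\<close>
    have P: "P s j (\<tau> j) \<longleftrightarrow>
        0 \<le> real_of_int (int (need j) - w1) - real_of_int (e1 - w1) * s \<and>
        0 \<le> real_of_int (w2 - int (need j)) - real_of_int (w2 - e2) * s" for s
      unfolding P_def defs by (auto simp: algebra_simps)
    have "\<bar>e1 - w1\<bar> \<le> int G" "\<bar>w2 - e2\<bar> \<le> int G" unfolding defs by (rule small)+
    then show ?thesis
      using \<tau>[OF j] sign[of "e1 - w1" "int (need j) - w1"] sign[of "w2 - e2" "w2 - int (need j)"]
      unfolding P by simp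
  qed
  moreover have "l \<alpha> \<le> l r \<or> l \<beta> \<le> l r"
  proof -
    define g where "g = \<Gamma> - (\<Sum>j\<in>M. p j - q j)"
    have l: "l s = l 0 + g * s" for s
      by (simp add: l_def g_def sum_subtractf sum.distrib sum_distrib_left algebra_simps)
    show ?thesis
    proof (cases "0 \<le> g")
      case True
      then have "g * \<alpha> \<le> g * r" using between(1) by (intro mult_left_mono)
      then show ?thesis using l[of \<alpha>] l[of r] by simp
    next
      case False
      then have "g * \<beta> \<le> g * r" using between(2) by (intro mult_left_mono_neg) auto
      then show ?thesis using l[of \<beta>] l[of r] by simp
    qed
  qed
  ultimately obtain s where s: "s \<in> {\<alpha>, \<beta>}" "\<And>j. j \<in> M \<Longrightarrow> P s j (\<tau> j)" "l s \<le> l r" by auto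
  obtain a b where ab: "s = real a / real b" "1 \<le> b" "b \<le> G" "a \<le> b" using s(1) F by blast
  have bs: "real b * s = a" using ab by simp
  have "\<exists>z. (\<forall>i\<in>free j. z i \<le> b) \<and> sum z (free j) = b * need j \<and>
      (\<Sum>i\<in>free j. unit_cost a (low i) (dev i) (z i)) =
        \<tau> j * real (b * need j) - a * p j - (real b - real a) * q j" if j: "j \<in> M" for j
    unfolding p_def q_def
  proof (rule greedy_purchase[OF finite_free[OF j] ab(4)])
    show "0 \<le> dev i" if "i \<in> free j" for i using that free_subset[OF j] nonneg(2) by blast
    \<comment> \<open>Multiplication by \<open>b\<close> turns the clearing conditions at
      \<open>s = a / b\<close> into conditions on natural numbers.\<close>
    have *: "s * e + (1 - s) * w \<le> k \<longleftrightarrow> a * e + (b - a) * w \<le> b * k"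
      "k \<le> s * e + (1 - s) * w \<longleftrightarrow> b * k \<le> a * e + (b - a) * w" for e w k :: nat
    proof -
      have "b * (s * e + (1 - s) * w) = (b * s) * e + (b - b * s) * w" by (simp add: algebra_simps)
      also have "\<dots> = real (a * e + (b - a) * w)" using ab(4) by (simp add: bs of_nat_diff)
      finally have *: "b * (s * e + (1 - s) * w) = real (a * e + (b - a) * w)" .
      have b: "0 < real b" using ab(2) by simp
      then show "s * e + (1 - s) * w \<le> k \<longleftrightarrow> a * e + (b - a) * w \<le> b * k"
        "k \<le> s * e + (1 - s) * w \<longleftrightarrow> b * k \<le> a * e + (b - a) * w"
        using mult_le_cancel_left_pos[OF b, of "s * e + (1 - s) * w" k]
          mult_le_cancel_left_pos[OF b, of k "s * e + (1 - s) * w"]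
        unfolding * by (simp_all only: of_nat_le_iff flip: of_nat_mult)
    qed
    show "a * card {i\<in>free j. low i < \<tau> j} + (b - a) * card {i\<in>free j. low i + dev i < \<tau> j} \<le> b * need j"
      "b * need j \<le> a * card {i\<in>free j. low i \<le> \<tau> j} + (b - a) * card {i\<in>free j. low i + dev i \<le> \<tau> j}"
      using s(2)[OF j] unfolding P_def * by auto
  qed
  then have "\<forall>j\<in>M. \<exists>z. (\<forall>i\<in>free j. z i \<le> b) \<and> sum z (free j) = b * need j \<and>
      (\<Sum>i\<in>free j. unit_cost a (low i) (dev i) (z i)) =
        \<tau> j * real (b * need j) - a * p j - (real b - real a) * q j"
    by blast
  from bchoice[OF this] obtain Z where Z: "\<And>j i. j \<in> M \<Longrightarrow> i \<in> free j \<Longrightarrow> Z j i \<le> b"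
    "\<And>j. j \<in> M \<Longrightarrow> sum (Z j) (free j) = b * need j"
    "\<And>j. j \<in> M \<Longrightarrow> (\<Sum>i\<in>free j. unit_cost a (low i) (dev i) (Z j i)) =
        \<tau> j * real (b * need j) - a * p j - (real b - real a) * q j"
    by blast
  define z where "z i = (if x i = 0 then Z (part_of I i) i else 0)" for i
  have zZ: "z i = Z j i" if "i \<in> free j" "j \<in> M" for i j
    using that part_of_eq[of i j] by (auto simp: z_def free_def)
  have z1: "z i \<le> b" if "i \<in> N" for i
    using Z(1)[of "part_of I i" i] part_of_mem[OF that] that by (auto simp: z_def free_def)
  have "fractional_recourse x b z"
    unfolding fractional_recourse_iff[OF ab(2)]
  proof (intro conjI ballI)
    show "z i \<le> b" if "i \<in> N" for i using z1[OF that] .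
    show "x i \<noteq> 0 \<longrightarrow> z i = 0" if "i \<in> N" for i by (simp add: z_def)
    show "sum z (free j) = b * need j" if "j \<in> M" for j
      using Z(2)[OF that] that by (simp add: zZ)
  qed
  moreover have "fractional_cost a b z = l s"
  proof -
    have "(\<Sum>i\<in>N. unit_cost a (low i) (dev i) (z i)) = (\<Sum>j\<in>M. \<Sum>i\<in>free j. unit_cost a (low i) (dev i) (z i))"
      by (rule sum_free) (auto simp: z_def unit_cost_def)
    also have "\<dots> = (\<Sum>j\<in>M. \<tau> j * real (b * need j) - a * p j - (real b - real a) * q j)"
      by (intro sum.cong refl trans[OF _ Z(3)]) (simp_all add: zZ)
    also have "\<dots> = (\<Sum>j\<in>M. b * (\<tau> j * need j - s * p j - (1 - s) * q j))"
      by (intro sum.cong refl) (simp add: algebra_simps flip: bs)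
    finally show ?thesis
      using ab(1,2) by (simp add: fractional_cost_def l_def add_divide_distrib flip: sum_distrib_left)
  qed
  ultimately show ?thesis using ab s(3) \<open>l r \<le> worst_case_cost I x\<close> by (intro exI[of _ a] exI[of _ b] exI[of _ z]) auto
qed

end

end

section \<open>A knapsack with groups\<close>

text \<open>\<open>h j i s\<close> stands for the least cost once the groups below \<open>j\<close>
  are complete and the items up to \<open>i\<close> have put \<open>s\<close> units into group
  \<open>j\<close>; \<open>big\<close> plays infinity. The recursion is assumed rather than defined,
  since \<open>h\<close> will be read off an array. \<open>dem 0\<close> only addresses the entry
  that carries \<open>start\<close>.\<close>

locale group_knapsack =
  fixes n m b S :: nat and group dem :: "nat \<Rightarrow> nat" and W :: "nat \<Rightarrow> nat \<Rightarrow> int"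
    and h :: "nat \<Rightarrow> nat \<Rightarrow> nat \<Rightarrow> int" and start big :: int
  assumes group: "\<And>k. k \<in> {1..n} \<Longrightarrow> 1 \<le> group k \<and> group k \<le> m"
    and dem: "\<And>j. j \<le> m \<Longrightarrow> b * dem j < S"
    and layer0: "h 0 n (b * dem 0) = start"
    and initial: "\<And>j s. 1 \<le> j \<Longrightarrow> j \<le> m \<Longrightarrow> s < S \<Longrightarrow>
      h j 0 s = (if s = 0 then h (j - 1) n (b * dem (j - 1)) else big)"
    and skip: "\<And>j i s. 1 \<le> j \<Longrightarrow> j \<le> m \<Longrightarrow> i < n \<Longrightarrow> s < S \<Longrightarrow> group (Suc i) \<noteq> j \<Longrightarrow>
      h j (Suc i) s = h j i s"
    and step_le: "\<And>j i s u. 1 \<le> j \<Longrightarrow> j \<le> m \<Longrightarrow> i < n \<Longrightarrow> s < S \<Longrightarrow> group (Suc i) = j \<Longrightarrow>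
      u \<le> b \<Longrightarrow> u \<le> s \<Longrightarrow> h j (Suc i) s \<le> h j i (s - u) + W (Suc i) u"
    and step_eq: "\<And>j i s. 1 \<le> j \<Longrightarrow> j \<le> m \<Longrightarrow> i < n \<Longrightarrow> s < S \<Longrightarrow> group (Suc i) = j \<Longrightarrow>
      \<exists>u\<le>b. u \<le> s \<and> h j (Suc i) s = h j i (s - u) + W (Suc i) u"
    and W_nonneg: "\<And>k u. k \<in> {1..n} \<Longrightarrow> 0 \<le> W k u"
begin

definition seen :: "nat \<Rightarrow> nat \<Rightarrow> nat set" where
  "seen j i = {k\<in>{1..n}. group k < j \<or> group k = j \<and> k \<le> i}"

definition current :: "nat \<Rightarrow> nat \<Rightarrow> nat set" where
  "current j i = {k\<in>{1..n}. group k = j \<and> k \<le> i}"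

definition partial :: "nat \<Rightarrow> nat \<Rightarrow> nat \<Rightarrow> (nat \<Rightarrow> nat) \<Rightarrow> bool" where
  "partial j i s \<zeta> \<longleftrightarrow> (\<forall>k. \<zeta> k \<le> b) \<and> (\<forall>j'\<in>{1..<j}. sum \<zeta> (current j' n) = b * dem j') \<and>
     sum \<zeta> (current j i) = s"

lemma finite_seen[simp]: "finite (seen j i)" by (simp add: seen_def)
lemma finite_current[simp]: "finite (current j i)" by (simp add: current_def)

lemma seen_Suc:
  assumes "i < n"
  shows "seen j (Suc i) = (if group (Suc i) = j then insert (Suc i) (seen j i) else seen j i)"
  using assms by (auto simp: seen_def le_Suc_eq)

lemma current_Suc:
  assumes "i < n"
  shows "current j (Suc i) = (if group (Suc i) = j then insert (Suc i) (current j i) else current j i)"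
  using assms by (auto simp: current_def le_Suc_eq)

lemma seen_first: "seen (Suc 0) 0 = {}"
  using group by (force simp: seen_def)

lemma seen_0: "seen (Suc j) 0 = seen j n"
  by (auto simp: seen_def)

lemma current_0: "current j 0 = {}"
  by (auto simp: current_def)

lemma Suc_notin: "Suc i \<notin> seen j i \<or> group (Suc i) < j" "Suc i \<notin> current j i"
  by (auto simp: seen_def current_def)

text \<open>The amount \<open>\<zeta> (Suc i)\<close> is one of the candidates in
  \<open>step_le\<close>. The outer induction goes from one completed group to the next, the inner
  one from item to item.\<close>

lemma h_le:
  "1 \<le> j \<Longrightarrow> j \<le> m \<Longrightarrow> i \<le> n \<Longrightarrow> s < S \<Longrightarrow> partial j i s \<zeta> \<Longrightarrow> h j i s \<le> start + (\<Sum>k\<in>seen j i. W k (\<zeta> k))"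
proof (induction j arbitrary: i s)
  case (Suc j)
  show ?case
    using Suc.prems
  proof (induction i arbitrary: s)
    case 0
    then have s: "s = 0" by (simp add: partial_def current_0)
    have "h j n (b * dem j) \<le> start + (\<Sum>k\<in>seen (Suc j) 0. W k (\<zeta> k))"
    proof (cases "j = 0")
      case True
      then show ?thesis using layer0 by (simp add: seen_first)
    next
      case False
      then show ?thesis
        using Suc.IH[of n "b * dem j"] 0 dem[of j] by (simp add: partial_def seen_0)
    qed
    then show ?case using initial[of "Suc j" 0] 0 s by simp
  next
    case (Suc i)
    show ?case
    proof (cases "group (Suc i) = Suc j")
      case True
      have sum: "sum \<zeta> (current (Suc j) (Suc i)) = \<zeta> (Suc i) + sum \<zeta> (current (Suc j) i)"
        using Suc.prems True by (simp add: current_Suc Suc_notin)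
      then have s: "\<zeta> (Suc i) \<le> s" "\<zeta> (Suc i) \<le> b" "partial (Suc j) i (s - \<zeta> (Suc i)) \<zeta>"
        using Suc.prems(5) by (auto simp: partial_def)
      have "h (Suc j) (Suc i) s \<le> h (Suc j) i (s - \<zeta> (Suc i)) + W (Suc i) (\<zeta> (Suc i))"
        using Suc.prems True s by (intro step_le) auto
      also have "h (Suc j) i (s - \<zeta> (Suc i)) \<le> start + (\<Sum>k\<in>seen (Suc j) i. W k (\<zeta> k))"
        using Suc.prems s by (intro Suc.IH) auto
      finally show ?thesis
        using Suc.prems True Suc_notin(1)[of i "Suc j"] by (simp add: seen_Suc)
    next
      case False
      then have "partial (Suc j) i s \<zeta>" using Suc.prems by (simp add: partial_def current_Suc)
      then show ?thesis using Suc.IH[of s] Suc.prems False by (simp add: skip seen_Suc)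
    qed
  qed
qed simp

text \<open>The minimizing amounts are traced backwards. Costs are nonnegative, so the predecessors
  of a value below \<open>big\<close> are also below \<open>big\<close> and the trace cannot end in
  an infeasible start.\<close>

lemma h_attained:
  "1 \<le> j \<Longrightarrow> j \<le> m \<Longrightarrow> i \<le> n \<Longrightarrow> s < S \<Longrightarrow> h j i s < big \<Longrightarrow>
    \<exists>\<zeta>. partial j i s \<zeta> \<and> h j i s = start + (\<Sum>k\<in>seen j i. W k (\<zeta> k))"
proof (induction j arbitrary: i s)
  case (Suc j)
  show ?case
    using Suc.prems
  proof (induction i arbitrary: s)
    case 0
    have h0: "h (Suc j) 0 s = (if s = 0 then h j n (b * dem j) else big)"
      using initial[of "Suc j" s] 0 by simp
    then have s: "s = 0" using 0 by (auto split: if_splits)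
    show ?case
    proof (cases "j = 0")
      case True
      then show ?thesis
        using layer0 h0 s by (intro exI[of _ "\<lambda>_. 0"]) (simp add: partial_def seen_first current_0)
    next
      case False
      obtain \<zeta> where "partial j n (b * dem j) \<zeta>" "h j n (b * dem j) = start + (\<Sum>k\<in>seen j n. W k (\<zeta> k))"
        using Suc.IH[of n "b * dem j"] 0 dem[of j] h0 s False by auto
      then show ?thesis
        using h0 s by (intro exI[of _ \<zeta>]) (auto simp: partial_def seen_0 current_0 less_Suc_eq)
    qed
  next
    case (Suc i)
    show ?case
    proof (cases "group (Suc i) = Suc j")
      case True
      obtain u where u: "u \<le> b" "u \<le> s" "h (Suc j) (Suc i) s = h (Suc j) i (s - u) + W (Suc i) u"
        using step_eq[of "Suc j" i s] Suc.prems True by auto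
      moreover have "0 \<le> W (Suc i) u" using Suc.prems by (intro W_nonneg) auto
      ultimately have "h (Suc j) i (s - u) < big" using Suc.prems by linarith
      then obtain \<zeta> where \<zeta>: "partial (Suc j) i (s - u) \<zeta>"
        "h (Suc j) i (s - u) = start + (\<Sum>k\<in>seen (Suc j) i. W k (\<zeta> k))"
        using Suc.IH[of "s - u"] Suc.prems less_imp_diff_less[of s S u] by auto
      let ?\<zeta> = "\<zeta>(Suc i := u)"
      have ni: "Suc i \<notin> seen (Suc j) i" "Suc i \<notin> current (Suc j) i"
        using True by (auto simp: seen_def current_def)
      have 1: "sum ?\<zeta> (current (Suc j) i) = sum \<zeta> (current (Suc j) i)"
        using ni by (intro sum.cong) auto
      have 2: "(\<Sum>k\<in>seen (Suc j) i. W k (?\<zeta> k)) = (\<Sum>k\<in>seen (Suc j) i. W k (\<zeta> k))"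
        using ni by (intro sum.cong) auto
      have 3: "sum ?\<zeta> (current j' n) = sum \<zeta> (current j' n)" if "j' \<in> {1..<Suc j}" for j'
        using that True by (intro sum.cong) (auto simp: current_def)
      have 4: "sum ?\<zeta> (current (Suc j) (Suc i)) = u + sum ?\<zeta> (current (Suc j) i)"
        using Suc.prems True ni by (simp add: current_Suc)
      have 5: "(\<Sum>k\<in>seen (Suc j) (Suc i). W k (?\<zeta> k)) = W (Suc i) u + (\<Sum>k\<in>seen (Suc j) i. W k (?\<zeta> k))"
        using Suc.prems True ni by (simp add: seen_Suc)
      have "partial (Suc j) (Suc i) s ?\<zeta>"
        unfolding partial_def 4 1 using \<zeta>(1) u(1,2) 3 by (simp add: partial_def)
      moreover have "h (Suc j) (Suc i) s = start + (\<Sum>k\<in>seen (Suc j) (Suc i). W k (?\<zeta> k))"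
        unfolding 5 2 using u(3) \<zeta>(2) by simp
      ultimately show ?thesis by blast
    next
      case False
      then have eq: "h (Suc j) (Suc i) s = h (Suc j) i s" using Suc.prems by (intro skip) auto
      then obtain \<zeta> where \<zeta>: "partial (Suc j) i s \<zeta>" "h (Suc j) i s = start + (\<Sum>k\<in>seen (Suc j) i. W k (\<zeta> k))"
        using Suc.IH[of s] Suc.prems by auto
      then have "partial (Suc j) (Suc i) s \<zeta>" using Suc.prems False by (simp add: partial_def current_Suc)
      moreover have "h (Suc j) (Suc i) s = start + (\<Sum>k\<in>seen (Suc j) (Suc i). W k (\<zeta> k))"
        using eq \<zeta>(2) Suc.prems False by (simp add: seen_Suc)
      ultimately show ?thesis by blast
    qed
  qed
qed simp

definition complete :: "(nat \<Rightarrow> nat) \<Rightarrow> bool" where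
  "complete \<zeta> \<longleftrightarrow> (\<forall>k\<in>{1..n}. \<zeta> k \<le> b) \<and> (\<forall>j\<in>{1..m}. (\<Sum>k | k \<in> {1..n} \<and> group k = j. \<zeta> k) = b * dem j)"

lemma current_n: "current j n = {k. k \<in> {1..n} \<and> group k = j}"
  by (auto simp: current_def)

lemma seen_n: "seen m n = {1..n}"
  using group by (force simp: seen_def)

lemma n_zero: "m = 0 \<Longrightarrow> n = 0"
  using group[of 1] by (cases n) auto

lemma final_le:
  assumes \<zeta>: "complete \<zeta>"
  shows "h m n (b * dem m) \<le> start + (\<Sum>k\<in>{1..n}. W k (\<zeta> k))"
proof (cases "m = 0")
  case True
  then show ?thesis using layer0 n_zero by simp
next
  case False
  \<comment> \<open>\<open>partial\<close> bounds the amounts at every index,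
    \<open>complete\<close> only on the items.\<close>
  let ?\<zeta> = "\<lambda>k. if k \<in> {1..n} then \<zeta> k else 0"
  have "sum ?\<zeta> (current j n) = sum \<zeta> (current j n)" for j
    by (intro sum.cong) (auto simp: current_def)
  then have "partial m n (b * dem m) ?\<zeta>"
    using \<zeta> False by (simp add: partial_def complete_def current_n)
  then have "h m n (b * dem m) \<le> start + (\<Sum>k\<in>seen m n. W k (?\<zeta> k))"
    using False dem by (intro h_le) auto
  also have "(\<Sum>k\<in>seen m n. W k (?\<zeta> k)) = (\<Sum>k\<in>{1..n}. W k (\<zeta> k))"
    unfolding seen_n by (intro sum.cong) auto
  finally show ?thesis .
qed

lemma final_attained:
  assumes "h m n (b * dem m) < big"
  shows "\<exists>\<zeta>. complete \<zeta> \<and> h m n (b * dem m) = start + (\<Sum>k\<in>{1..n}. W k (\<zeta> k))"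
proof (cases "m = 0")
  case True
  then have "complete (\<lambda>_. 0)" unfolding complete_def by simp
  then show ?thesis using layer0 n_zero True by (intro exI[of _ "\<lambda>_. 0"]) simp
next
  case False
  then obtain \<zeta> where \<zeta>: "partial m n (b * dem m) \<zeta>"
      "h m n (b * dem m) = start + (\<Sum>k\<in>seen m n. W k (\<zeta> k))"
    using h_attained[of m n "b * dem m"] assms dem by auto
  have "complete \<zeta>"
    unfolding complete_def
  proof (intro conjI ballI)
    fix j assume "j \<in> {1..m}"
    then show "(\<Sum>k | k \<in> {1..n} \<and> group k = j. \<zeta> k) = b * dem j"
      using \<zeta>(1) by (cases "j = m") (auto simp: partial_def current_n)
  qed (use \<zeta>(1) in \<open>simp add: partial_def\<close>)
  then show ?thesis using \<zeta>(2) by (auto simp: seen_n)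
qed

end

section \<open>Scaled integer costs carrying x in their low-order bits\<close>

lemma binary_digits:
  fixes x :: "nat \<Rightarrow> nat"
  assumes "\<And>i. i \<in> {1..n} \<Longrightarrow> x i \<le> 1"
  shows "(\<Sum>i\<in>{1..n}. 2 ^ (i - 1) * int (x i)) < 2 ^ n \<and>
    (\<forall>i\<in>{1..n}. (\<Sum>i\<in>{1..n}. 2 ^ (i - 1) * int (x i)) div 2 ^ (i - 1) mod 2 = int (x i))"
  using assms
proof (induction n)
  case (Suc n)
  define s where "s = (\<Sum>i\<in>{1..n}. 2 ^ (i - 1) * int (x i))"
  have IH: "s < 2 ^ n" "\<And>i. i \<in> {1..n} \<Longrightarrow> s div 2 ^ (i - 1) mod 2 = int (x i)"
    using Suc by (auto simp: s_def)
  have s0: "0 \<le> s" unfolding s_def by (intro sum_nonneg) auto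
  have x: "x (Suc n) = 0 \<or> x (Suc n) = 1" using Suc.prems[of "Suc n"] by auto
  have sum: "(\<Sum>i\<in>{1..Suc n}. 2 ^ (i - 1) * int (x i)) = s + 2 ^ n * int (x (Suc n))"
    by (simp add: s_def)
  have "(s + 2 ^ n * int (x (Suc n))) div 2 ^ (i - 1) mod 2 = int (x i)" if i: "i \<in> {1..Suc n}" for i
  proof (cases "i = Suc n")
    case True
    then show ?thesis using x IH(1) s0 by (auto simp: div_pos_pos_trivial)
  next
    case False
    then have i: "i \<in> {1..n}" using i by auto
    define e where "e = n - i"
    have "n = (i - 1) + Suc e" using i by (auto simp: e_def)
    then have "2 ^ n = (2::int) ^ (i - 1) * 2 ^ Suc e" by (simp only: power_add)
    then have "s + 2 ^ n * int (x (Suc n)) = s + 2 ^ (i - 1) * (2 * (2 ^ e * int (x (Suc n))))" by simp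
    also have "\<dots> div 2 ^ (i - 1) = s div 2 ^ (i - 1) + 2 * (2 ^ e * int (x (Suc n)))"
      by (simp add: div_mult_self2)
    finally have "(s + 2 ^ n * int (x (Suc n))) div 2 ^ (i - 1) = s div 2 ^ (i - 1) + 2 * (2 ^ e * int (x (Suc n)))" .
    then show ?thesis using IH(2)[OF i] by simp
  qed
  moreover have "s + 2 ^ n * int (x (Suc n)) < 2 ^ Suc n" using x IH(1) s0 by auto
  ultimately show ?case unfolding sum by blast
qed simp

locale scaled_instance = mrs_instance +
  fixes D g :: int and C c d :: "nat \<Rightarrow> int"
  assumes D: "0 < D"
    and C: "\<And>i. i \<in> {1..num_items I} \<Longrightarrow> real_of_int (C i) = D * of_rat (first_cost I i)"
    and c: "\<And>i. i \<in> {1..num_items I} \<Longrightarrow> real_of_int (c i) = D * of_rat (lower_cost I i)"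
    and d: "\<And>i. i \<in> {1..num_items I} \<Longrightarrow> real_of_int (d i) = D * of_rat (deviation I i)"
    and g: "real_of_int g = D * of_rat (budget I)"
begin

abbreviation "n \<equiv> num_items I"

definition pay :: "nat \<Rightarrow> nat \<Rightarrow> nat \<Rightarrow> int" where
  "pay a i u = c i * int u + d i * int (u - a)"

definition cost :: "nat \<Rightarrow> nat \<Rightarrow> (nat \<Rightarrow> nat) \<Rightarrow> (nat \<Rightarrow> nat) \<Rightarrow> int" where
  "cost a b x z = int a * g + (\<Sum>i\<in>N. int b * C i * int (x i) + pay a i (z i))"

text \<open>The first-stage decisions ride along in the low-order bits of the cost.\<close>

definition tagged_cost :: "nat \<Rightarrow> nat \<Rightarrow> (nat \<Rightarrow> nat) \<Rightarrow> (nat \<Rightarrow> nat) \<Rightarrow> int" where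
  "tagged_cost a b x z = 2 ^ n * cost a b x z + (\<Sum>i\<in>N. 2 ^ (i - 1) * int (x i))"

text \<open>The size of item \<open>i\<close> is \<open>b * x i + z i\<close>. A size below
  \<open>b\<close> forces x_i = 0, whereas size \<open>b\<close> means either a first-stage purchase
  or \<open>z i = b\<close>; the cheaper reading is taken, and the former adds the tag
  \<open>2 ^ (i - 1)\<close>.\<close>

definition weight :: "nat \<Rightarrow> nat \<Rightarrow> nat \<Rightarrow> nat \<Rightarrow> int" where
  "weight a b i u =
     (let y = 2 ^ n * pay a i u; x = 2 ^ n * (int b * C i) + 2 ^ (i - 1)
      in if u = b \<and> x < y then x else y)"

lemma scaled_nonneg: "i \<in> N \<Longrightarrow> 0 \<le> C i" "i \<in> N \<Longrightarrow> 0 \<le> c i" "i \<in> N \<Longrightarrow> 0 \<le> d i" "0 \<le> g"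
proof -
  have *: "0 \<le> k" if "real_of_int k = D * of_rat r" "0 \<le> r" for k r
  proof -
    have "0 \<le> real_of_int D * of_rat r" using D that(2) by simp
    then show ?thesis using that(1) by (metis of_int_0_le_iff)
  qed
  show "i \<in> N \<Longrightarrow> 0 \<le> C i" "i \<in> N \<Longrightarrow> 0 \<le> c i" "i \<in> N \<Longrightarrow> 0 \<le> d i" "0 \<le> g"
    using inst by (auto intro!: *[OF C] *[OF c] *[OF d] *[OF g] simp: mrs_instances_def)
qed

lemma real_cost:
  assumes "1 \<le> b"
  shows "real_of_int (cost a b x z) =
    D * b * ((\<Sum>i\<in>N. of_rat (first_cost I i) * real (x i)) + fractional_cost a b z)"
proof -
  have pay: "real_of_int (pay a i u) = D * unit_cost a (low i) (dev i) u" if "i \<in> N" for i u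
    by (simp add: pay_def unit_cost_def c[OF that] d[OF that] algebra_simps)
  have "real_of_int (cost a b x z) = a * (D * \<Gamma>) +
      (\<Sum>i\<in>N. D * b * (of_rat (first_cost I i) * real (x i)) + D * unit_cost a (low i) (dev i) (z i))"
    unfolding cost_def using C pay by (simp add: g mult_ac)
  also have "\<dots> = D * b * ((\<Sum>i\<in>N. of_rat (first_cost I i) * real (x i)) + fractional_cost a b z)"
    using assms by (simp add: fractional_cost_def sum.distrib field_simps flip: sum_distrib_left)
  finally show ?thesis .
qed

lemma pay_nonneg: "i \<in> N \<Longrightarrow> 0 \<le> pay a i u"
  using scaled_nonneg by (simp add: pay_def)

lemma weight_nonneg: "i \<in> N \<Longrightarrow> 0 \<le> weight a b i u"
  using scaled_nonneg pay_nonneg[of i a u] by (simp add: weight_def Let_def)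

lemma x_le_1: "x \<in> first_stage I \<Longrightarrow> i \<in> N \<Longrightarrow> x i \<le> 1"
  by (force simp: first_stage_def PiE_iff)

lemma tagged_cost_eq:
  "tagged_cost a b x z = 2 ^ n * (int a * g) +
    (\<Sum>i\<in>N. 2 ^ n * (int b * C i * int (x i) + pay a i (z i)) + 2 ^ (i - 1) * int (x i))"
  by (simp add: tagged_cost_def cost_def sum.distrib sum_distrib_left distrib_left)

text \<open>By weak duality the objective of the recorded \<open>x\<close> is at most the value
  \<open>q\<close> of the best pair; an optimal pair for any other \<open>x'\<close> shows that
  \<open>q\<close> is at most the objective of \<open>x'\<close>. Taking \<open>x'\<close> to be
  \<open>x\<close> gives equality. Minimal tagged costs suffice because division by
  \<open>2 ^ n\<close> is monotone.\<close>

lemma solves_mrs_best: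
  fixes h :: "nat \<Rightarrow> nat \<Rightarrow> int"
  assumes G: "n \<le> G" "1 \<le> G"
    and lower: "\<And>a b x z. 1 \<le> b \<Longrightarrow> b \<le> G \<Longrightarrow> a \<le> G \<Longrightarrow> x \<in> first_stage I \<Longrightarrow>
      fractional_recourse x b z \<Longrightarrow> h a b \<le> tagged_cost a b x z"
    and attained: "\<And>a b. 1 \<le> b \<Longrightarrow> b \<le> G \<Longrightarrow> a \<le> G \<Longrightarrow>
      \<exists>x z. x \<in> first_stage I \<and> fractional_recourse x b z \<and> h a b = tagged_cost a b x z"
    and a: "a \<le> G" and b: "1 \<le> b" "b \<le> G"
    and best: "\<And>a' b'. 1 \<le> b' \<Longrightarrow> b' \<le> G \<Longrightarrow> a' \<le> G \<Longrightarrow>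
      (h a b div 2 ^ n) * int b' \<le> (h a' b' div 2 ^ n) * int b"
  shows "solves_mrs I ([h a b div 2 ^ n, D * int b] @
    map (\<lambda>i. h a b mod 2 ^ n div 2 ^ (i - 1) mod 2) [1..<n + 1])"
proof -
  have tag: "tagged_cost a b x z div 2 ^ n = cost a b x z"
    "i \<in> N \<Longrightarrow> tagged_cost a b x z mod 2 ^ n div 2 ^ (i - 1) mod 2 = int (x i)"
    if x: "x \<in> first_stage I" for a b x z i
  proof -
    define t where "t = (\<Sum>i\<in>N. 2 ^ (i - 1) * int (x i))"
    have t: "t < 2 ^ n" "\<And>i. i \<in> N \<Longrightarrow> t div 2 ^ (i - 1) mod 2 = int (x i)"
      using binary_digits[where n = n and x = x] x_le_1[OF x] by (auto simp: t_def)
    have "0 \<le> t" unfolding t_def by (intro sum_nonneg) auto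
    moreover have "tagged_cost a b x z = t + 2 ^ n * cost a b x z" by (simp add: tagged_cost_def t_def)
    ultimately show "tagged_cost a b x z div 2 ^ n = cost a b x z"
      "i \<in> N \<Longrightarrow> tagged_cost a b x z mod 2 ^ n div 2 ^ (i - 1) mod 2 = int (x i)"
      using t by (simp_all add: div_pos_pos_trivial mod_pos_pos_trivial)
  qed
  obtain x z where x: "x \<in> first_stage I" and z: "fractional_recourse x b z" and hx: "h a b = tagged_cost a b x z"
    using attained[OF b a] by blast
  have val: "h a b div 2 ^ n = cost a b x z" using tag(1)[OF x] hx by simp
  define q where "q = real_of_int (cost a b x z) / (D * b)"
  have obj_le: "objective I x \<le> q"
    unfolding q_def objective_def real_cost[OF b(1)]
    using worst_case_le_fractional[OF x b(1) z, of a] D b(1) by simp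
  have q_le: "q \<le> objective I x'" if x': "x' \<in> first_stage I" for x'
  proof -
    obtain a' b' z' where b': "1 \<le> b'" "b' \<le> G" "a' \<le> b'" and z': "fractional_recourse x' b' z'"
      and le: "fractional_cost a' b' z' \<le> worst_case_cost I x'"
      using fractional_le_worst_case[OF x' G] by blast
    have a': "a' \<le> G" using b' by simp
    have "h a' b' div 2 ^ n \<le> tagged_cost a' b' x' z' div 2 ^ n"
      using lower[OF b'(1,2) a' x' z'] by (intro zdiv_mono1) auto
    also have "\<dots> = cost a' b' x' z'" by (rule tag(1)[OF x'])
    finally have "(h a' b' div 2 ^ n) * int b \<le> cost a' b' x' z' * int b" by (intro mult_right_mono) auto
    then have "cost a b x z * int b' \<le> cost a' b' x' z' * int b"
      using best[OF b'(1,2) a'] val by simp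
    then have "real_of_int (cost a b x z) * b' \<le> real_of_int (cost a' b' x' z') * b"
      by (metis of_int_le_iff of_int_mult of_int_of_nat_eq)
    then have "q \<le> real_of_int (cost a' b' x' z') / (D * b')"
      using D b(1) b'(1) by (simp add: q_def field_simps)
    also have "\<dots> \<le> objective I x'"
      unfolding objective_def real_cost[OF b'(1)] using le D b'(1) by simp
    finally show ?thesis .
  qed
  have "optimal_first_stage I x"
    unfolding optimal_first_stage_def is_arg_min_linorder
    using x obj_le q_le by (auto intro: order_trans)
  moreover have "objective I x = of_int (h a b div 2 ^ n) / of_int (D * int b)"
    using obj_le q_le[OF x] val by (simp add: q_def)
  moreover have "0 < D * int b" using D b by simp
  moreover have "map (\<lambda>i. h a b mod 2 ^ n div 2 ^ (i - 1) mod 2) [1..<n + 1] = map (\<lambda>i. int (x i)) [1..<n + 1]"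
    using tag(2)[OF x] hx by (intro map_cong) auto
  ultimately show ?thesis unfolding solves_mrs_def by metis
qed

text \<open>The origin of \<open>big\<close>: with amounts and denominators at most
  \<open>G\<close>, the cost is at most \<open>G\<close> times the sum of all scaled data, and the
  tag stays below \<open>2 ^ n\<close>.\<close>

lemma tagged_cost_less:
  assumes ab: "a \<le> G" "b \<le> G" and x: "x \<in> first_stage I" and z: "\<And>i. i \<in> N \<Longrightarrow> z i \<le> b"
    and t: "g + (\<Sum>i\<in>N. C i + c i + d i) \<le> t"
  shows "tagged_cost a b x z < 2 ^ n * (int G * t + 1)"
proof -
  have "cost a b x z \<le> int G * g + (\<Sum>i\<in>N. int G * (C i + c i + d i))"
    unfolding cost_def
  proof (intro add_mono sum_mono)
    show "int a * g \<le> int G * g" using ab scaled_nonneg by (intro mult_right_mono) auto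
    fix i assume i: "i \<in> N"
    have "int b * C i * int (x i) \<le> int G * C i * 1"
      using ab scaled_nonneg(1)[of i] x_le_1[OF x i] i by (intro mult_mono) auto
    moreover have "c i * int (z i) \<le> c i * int G" "d i * int (z i - a) \<le> d i * int G"
      using ab z[OF i] scaled_nonneg(2,3)[of i] i by (intro mult_left_mono; simp)+
    ultimately show "int b * C i * int (x i) + pay a i (z i) \<le> int G * (C i + c i + d i)"
      by (simp add: pay_def algebra_simps)
  qed
  also have "\<dots> = int G * (g + (\<Sum>i\<in>N. C i + c i + d i))" by (simp add: distrib_left sum_distrib_left)
  also have "\<dots> \<le> int G * t" using t by (intro mult_left_mono) auto
  finally have "2 ^ n * cost a b x z \<le> 2 ^ n * (int G * t)" by (intro mult_left_mono) auto
  then have "2 ^ n * cost a b x z + (\<Sum>i\<in>N. 2 ^ (i - 1) * int (x i)) < 2 ^ n * (int G * t) + 2 ^ n"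
    using binary_digits[where n = n and x = x] x_le_1[OF x] by (intro add_le_less_mono) auto
  then show ?thesis by (simp add: tagged_cost_def distrib_left)
qed

text \<open>Pairs (x, z) correspond to size vectors \<open>b * x + z\<close>, and
  \<open>weight\<close> chooses the cheaper pair behind each size, so the knapsack optimum is the
  optimum over pairs.\<close>

lemma knapsack_tagged:
  assumes k: "group_knapsack n (num_parts I) b S (part_of I) dem (weight a b) h (2 ^ n * (int a * g)) big"
    and b: "1 \<le> b" and dem_eq: "\<And>j. j \<in> M \<Longrightarrow> dem j = demand I j"
    and big: "\<And>x z. x \<in> first_stage I \<Longrightarrow> (\<And>i. i \<in> N \<Longrightarrow> z i \<le> b) \<Longrightarrow> tagged_cost a b x z < big"
  shows "x \<in> first_stage I \<Longrightarrow> fractional_recourse x b z \<Longrightarrow> h (num_parts I) n (b * dem (num_parts I)) \<le> tagged_cost a b x z"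
    and "\<exists>x z. x \<in> first_stage I \<and> fractional_recourse x b z \<and>
      h (num_parts I) n (b * dem (num_parts I)) = tagged_cost a b x z"
proof -
  interpret group_knapsack n "num_parts I" b S "part_of I" dem "weight a b" h "2 ^ n * (int a * g)" big
    by (rule k)
  have part: "{k. k \<in> N \<and> part_of I k = j} = part I j" if "j \<in> M" for j
    using part_eq[OF that] by auto
  show le: "h (num_parts I) n (b * dem (num_parts I)) \<le> tagged_cost a b x z"
    if x: "x \<in> first_stage I" and z: "fractional_recourse x b z" for x z
  proof -
    have "complete (\<lambda>i. b * x i + z i)"
      unfolding complete_def using z dem_eq part by (auto simp only: fractional_recourse_def)
    then have "h (num_parts I) n (b * dem (num_parts I)) \<le>
        2 ^ n * (int a * g) + (\<Sum>i\<in>N. weight a b i (b * x i + z i))"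
      by (rule final_le)
    also have "\<dots> \<le> tagged_cost a b x z"
      unfolding tagged_cost_eq
    proof (intro add_left_mono sum_mono)
      fix i assume i: "i \<in> N"
      have xz: "x i = 0 \<or> x i = 1 \<and> z i = 0"
      proof -
        have "b * x i + z i \<le> b" using z i by (simp add: fractional_recourse_def)
        then show ?thesis using x_le_1[OF x i] by (cases "x i") auto
      qed
      then show "weight a b i (b * x i + z i) \<le>
          2 ^ n * (int b * C i * int (x i) + pay a i (z i)) + 2 ^ (i - 1) * int (x i)"
        by (auto simp: weight_def Let_def pay_def)
    qed
    finally show ?thesis .
  qed
  obtain x where x: "x \<in> first_stage I" using first_stage_nonempty[OF inst] by blast
  obtain y where y: "y \<in> second_stage I x" using second_stage_nonempty[OF inst x] by blast
  \<comment> \<open>A scaled integral completion shows that the optimum lies below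
    \<open>big\<close> and is therefore attained.\<close>
  have "fractional_recourse x b (\<lambda>i. b * y i)"
    using y by (auto simp: second_stage_def fractional_recourse_def simp flip: distrib_left sum_distrib_left)
  moreover have "b * y i \<le> b" if "i \<in> N" for i
  proof -
    have "x i + y i \<le> 1" using y that by (simp add: second_stage_def)
    then show ?thesis using mult_le_mono2[of "y i" 1 b] by simp
  qed
  ultimately have "h (num_parts I) n (b * dem (num_parts I)) < big"
    using le[OF x] big[OF x] by (meson order_le_less_trans)
  then obtain \<zeta> where \<zeta>: "complete \<zeta>"
    "h (num_parts I) n (b * dem (num_parts I)) = 2 ^ n * (int a * g) + (\<Sum>i\<in>N. weight a b i (\<zeta> i))"
    using final_attained by blast
  define P where "P i \<longleftrightarrow> \<zeta> i = b \<and> 2 ^ n * (int b * C i) + 2 ^ (i - 1) < 2 ^ n * pay a i (\<zeta> i)" for i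
  define X where "X = (\<lambda>i\<in>N. if P i then 1 else 0 :: nat)"
  define Z where "Z i = (if P i then 0 else \<zeta> i)" for i
  have XZ: "b * X i + Z i = \<zeta> i" if "i \<in> N" for i
    using that by (auto simp: X_def Z_def P_def)
  have Z: "fractional_recourse X b Z"
    unfolding fractional_recourse_def
  proof (intro conjI ballI)
    show "b * X i + Z i \<le> b" if "i \<in> N" for i using \<zeta>(1) XZ that by (simp add: complete_def)
    fix j assume j: "j \<in> M"
    have "(\<Sum>i\<in>part I j. b * X i + Z i) = sum \<zeta> (part I j)"
      using XZ finite_part(2)[OF inst j] by (intro sum.cong) auto
    then show "(\<Sum>i\<in>part I j. b * X i + Z i) = b * demand I j"
      using \<zeta>(1) j dem_eq[OF j] unfolding complete_def by (metis part)
  qed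
  have "X \<in> first_stage I"
    unfolding first_stage_def
  proof (intro CollectI conjI ballI)
    show "X \<in> N \<rightarrow>\<^sub>E {0, 1}" by (auto simp: X_def)
    fix j assume j: "j \<in> M"
    have "b * (\<Sum>i\<in>part I j. X i) \<le> b * demand I j"
    proof -
      have "(\<Sum>i\<in>part I j. b * X i + Z i) = b * demand I j" using Z j unfolding fractional_recourse_def by blast
      then show ?thesis unfolding sum.distrib sum_distrib_left by linarith
    qed
    then show "(\<Sum>i\<in>part I j. X i) \<le> demand I j" using b by simp
  qed
  moreover have "(\<Sum>i\<in>N. weight a b i (\<zeta> i)) =
      (\<Sum>i\<in>N. 2 ^ n * (int b * C i * int (X i) + pay a i (Z i)) + 2 ^ (i - 1) * int (X i))"
    by (intro sum.cong refl) (auto simp: weight_def Let_def X_def Z_def P_def pay_def)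
  then have "h (num_parts I) n (b * dem (num_parts I)) = tagged_cost a b X Z"
    using \<zeta>(2) unfolding tagged_cost_eq by simp
  ultimately show "\<exists>x z. x \<in> first_stage I \<and> fractional_recourse x b z \<and>
      h (num_parts I) n (b * dem (num_parts I)) = tagged_cost a b x z"
    using Z by blast
qed

end

section \<open>The table of the dynamic program\<close>

locale table_instance = scaled_instance +
  fixes dem :: "nat \<Rightarrow> nat" and total :: int
  assumes dem_le: "\<And>j. j \<le> num_parts I \<Longrightarrow> dem j \<le> num_items I"
    and dem_eq: "\<And>j. j \<in> {1..num_parts I} \<Longrightarrow> dem j = demand I j"
    and total: "g + (\<Sum>i\<in>{1..num_items I}. C i + c i + d i) \<le> total"
begin

abbreviation "m \<equiv> num_parts I"
abbreviation "G \<equiv> Suc n"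
abbreviation "H \<equiv> Suc m"
abbreviation "S \<equiv> G * G"

definition big :: int where "big = 2 ^ n * (int G * total + 1)"

text \<open>
  The index of an array entry has the digits \<open>b - 1\<close>, \<open>a\<close>, part \<open>j \<le> m\<close>, item \<open>i \<le> n\<close>, used
  capacity \<open>s\<close>, units \<open>u\<close> tried so far for item \<open>i\<close>.  Part \<open>0\<close> and item \<open>0\<close> initialize, so that
  \<open>Q - 1\<close> is always the stage from which stage \<open>Q\<close> continues; the completed value of a stage is at
  \<open>u = G\<close>.
\<close>

definition cell :: "nat \<Rightarrow> nat \<Rightarrow> nat \<Rightarrow> nat" where
  "cell Q s u = (Q * S + s) * Suc G + u"

definition stage :: "nat \<Rightarrow> nat \<Rightarrow> nat \<Rightarrow> nat \<Rightarrow> nat" where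
  "stage a b j i = (((b - 1) * Suc G + a) * H + j) * G + i"

text \<open>Along the digit \<open>u\<close> an entry keeps the minimum over all amounts up to
  \<open>u\<close>. It thus depends on at most two earlier entries and needs no inner loop.\<close>

definition table_entry :: "(nat \<Rightarrow> int) \<Rightarrow> nat \<Rightarrow> int" where
  "table_entry A k =
    (let u = k mod Suc G; s = k div Suc G mod S; Q = k div Suc G div S;
         i = Q mod G; j = Q div G mod H; v = Q div G div H; a = v mod Suc G; b = v div Suc G + 1
     in if j = 0 then int a * (2 ^ n * g)
        else if i = 0 then if s = 0 then A (cell (Q - 1) (b * dem (j - 1)) G) else big
        else if u = 0 then A (cell (Q - 1) s G)
        else if part_of I i = j \<and> u \<le> b \<and> u \<le> s
             then min (A (k - 1)) (A (cell (Q - 1) (s - u) G) + weight a b i u)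
        else A (k - 1))"

definition table_size :: nat where
  "table_size = G * Suc G * H * G * S * Suc G"

lemma div_mod_digit: "y < B \<Longrightarrow> (x * B + y) div B = (x::nat)" "y < B \<Longrightarrow> (x * B + y) mod B = (y::nat)"
  by (cases "B = 0"; simp add: div_mult_self3)+

lemma digit_less: "x < X \<Longrightarrow> y < B \<Longrightarrow> x * B + y < X * (B::nat)"
proof -
  assume "x < X" "y < B"
  then have "x * B + y < Suc x * B" by simp
  also have "\<dots> \<le> X * B" using \<open>x < X\<close> by (intro mult_le_mono1) simp
  finally show ?thesis .
qed

lemma cell_pred_less: "0 < Q \<Longrightarrow> s < S \<Longrightarrow> cell (Q - 1) s G < Q * S * Suc G"
  unfolding cell_def by (intro digit_less) auto

lemma cell_less_table:
  assumes "1 \<le> b" "b \<le> G" "a \<le> G" "j \<le> m" "i \<le> n" "s < S" "u \<le> G"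
  shows "cell (stage a b j i) s u < table_size"
  unfolding cell_def stage_def table_size_def
  using assms by (intro digit_less) (auto intro: order.strict_trans2)

lemma demand_index_less: "b \<le> G \<Longrightarrow> j \<le> m \<Longrightarrow> b * dem j < S"
  using mult_le_mono[of b G "dem j" n] dem_le[of j] by simp

lemma big_nonneg: "0 \<le> total" "0 \<le> big"
proof -
  have "0 \<le> g + (\<Sum>i\<in>{1..n}. C i + c i + d i)"
    using scaled_nonneg by (intro add_nonneg_nonneg sum_nonneg) auto
  then show "0 \<le> total" using total by simp
  then show "0 \<le> big" by (simp add: big_def)
qed

lemma start_le_big: "a \<le> G \<Longrightarrow> int a * (2 ^ n * g) \<le> big"
proof -
  assume a: "a \<le> G"
  have "0 \<le> (\<Sum>i\<in>{1..n}. C i + c i + d i)"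
    using scaled_nonneg by (intro add_nonneg_nonneg sum_nonneg) auto
  then have "g \<le> total" using total by simp
  then have "int a * g \<le> int G * total" using a scaled_nonneg(4) by (intro mult_mono) auto
  then have "2 ^ n * (int a * g) \<le> 2 ^ n * (int G * total + 1)" by (intro mult_left_mono) auto
  then show ?thesis by (simp add: big_def mult.left_commute)
qed

text \<open>An entry reads only \<open>k - 1\<close> and cells of the previous stage; the latter
  have smaller index because their capacity digit is below \<open>S\<close>. Later writes therefore
  leave filled entries valid.\<close>

lemma table_entry_cong:
  assumes "\<And>p. p < k \<Longrightarrow> A p = A' p" and "k < table_size"
  shows "table_entry A k = table_entry A' k"
proof -
  define Q where "Q = k div Suc G div S"
  define v where "v = Q div G div H"
  have "v < G * Suc G"
  proof -
    have "k div Suc G < G * Suc G * H * G * S"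
      using assms(2) unfolding table_size_def by (rule less_mult_imp_div_less)
    then have "Q < G * Suc G * H * G" unfolding Q_def by (rule less_mult_imp_div_less)
    then have "Q div G < G * Suc G * H" by (rule less_mult_imp_div_less)
    then show ?thesis unfolding v_def by (rule less_mult_imp_div_less)
  qed
  then have b: "v div Suc G + 1 \<le> G" using less_mult_imp_div_less[of v G "Suc G"] by simp
  have k: "Q * S * Suc G \<le> k"
  proof -
    have "Q * S * Suc G \<le> k div Suc G * Suc G" unfolding Q_def
      by (intro mult_le_mono1 div_times_less_eq_dividend)
    also have "\<dots> \<le> k" by (rule div_times_less_eq_dividend)
    finally show ?thesis .
  qed
  have cell: "A (cell (Q - 1) s G) = A' (cell (Q - 1) s G)" if "0 < Q" "s < S" for s
    using cell_pred_less[OF that] k by (intro assms(1)) simp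
  have Q0: "0 < Q" if "Q div G mod H \<noteq> 0" using that by (cases "Q = 0") auto
  have s: "k div Suc G mod S < S" by simp
  \<comment> \<open>The demand must be a legal capacity digit: it is at most \<open>G * n\<close>,
    which is less than \<open>G * G\<close>.\<close>
  have d: "(v div Suc G + 1) * dem (Q div G mod H - 1) < S" if "Q div G mod H \<noteq> 0"
  proof (rule demand_index_less[OF b])
    have "Q div G mod H < H" by simp
    then show "Q div G mod H - 1 \<le> m" by linarith
  qed
  have k1: "A (k - 1) = A' (k - 1)" if "k mod Suc G \<noteq> 0" using that by (intro assms(1)) (cases k; simp)
  have su: "k div Suc G mod S - u < S" for u using s by (rule less_imp_diff_less)
  show ?thesis
    unfolding table_entry_def Let_def Q_def[symmetric] v_def[symmetric]
    using cell[OF Q0 d] cell[OF Q0 s] cell[OF Q0 su] k1 by (simp del: mult_Suc mult_Suc_right)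
qed

text \<open>Taking minima never exceeds the old entry \<open>A (k - 1)\<close>, and all other values
  are copied or at most \<open>big\<close>. The memory bound of the table loop rests on
  this.\<close>

lemma table_entry_bounds:
  assumes A: "\<And>p. 0 \<le> A p \<and> A p \<le> big"
  shows "0 \<le> table_entry A k \<and> table_entry A k \<le> big"
proof -
  have "int (v mod Suc G) * (2 ^ n * g) \<le> big" for v
    using mod_less_divisor[of "Suc G" v] by (intro start_le_big) simp
  moreover have "0 \<le> weight a b (Q mod G) u" if "Q mod G \<noteq> 0" for a b Q u
    using that mod_less_divisor[of G Q] by (intro weight_nonneg) auto
  then have "0 \<le> A p + weight a b (Q mod G) u" if "Q mod G \<noteq> 0" for a b Q u p
    using that A by (intro add_nonneg_nonneg) auto
  ultimately show ?thesis
    using A big_nonneg scaled_nonneg(4)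
    by (auto simp: table_entry_def Let_def min.coboundedI1 simp del: mult_Suc mult_Suc_right)
qed

lemma table_entry_cell:
  assumes "1 \<le> b" "b \<le> G" "a \<le> G" "j \<le> m" "i \<le> n" "s < S" "u \<le> G"
  shows "table_entry A (cell (stage a b j i) s u) =
     (if j = 0 then int a * (2 ^ n * g)
      else if i = 0 then if s = 0 then A (cell (stage a b (j - 1) n) (b * dem (j - 1)) G) else big
      else if u = 0 then A (cell (stage a b j (i - 1)) s G)
      else if part_of I i = j \<and> u \<le> b \<and> u \<le> s
        then min (A (cell (stage a b j i) s (u - 1))) (A (cell (stage a b j (i - 1)) (s - u) G) + weight a b i u)
      else A (cell (stage a b j i) s (u - 1)))"
proof -
  define Q where "Q = stage a b j i"
  have 1: "cell Q s u div Suc G = Q * S + s" "cell Q s u mod Suc G = u"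
    unfolding cell_def using assms by (intro div_mod_digit; simp)+
  have 2: "(Q * S + s) div S = Q" "(Q * S + s) mod S = s"
    using assms by (intro div_mod_digit; simp)+
  have 3: "Q div G = ((b - 1) * Suc G + a) * H + j" "Q mod G = i"
    unfolding Q_def stage_def using assms by (intro div_mod_digit; simp)+
  have 4: "(((b - 1) * Suc G + a) * H + j) div H = (b - 1) * Suc G + a"
    "(((b - 1) * Suc G + a) * H + j) mod H = j"
    using assms by (intro div_mod_digit; simp)+
  have 5: "((b - 1) * Suc G + a) div Suc G = b - 1" "((b - 1) * Suc G + a) mod Suc G = a"
    using assms by (intro div_mod_digit; simp)+
  \<comment> \<open>Subtracting 1 at item digit 0 borrows from the part digit and lands on item
    \<open>n\<close> of part \<open>j - 1\<close>.\<close>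
  have 6: "Q - 1 = stage a b (j - 1) n" if "i = 0" "j \<noteq> 0"
    using that by (cases j) (simp_all add: Q_def stage_def)
  have 7: "Q - 1 = stage a b j (i - 1)" if "i \<noteq> 0" using that by (simp add: Q_def stage_def)
  have 8: "cell Q s u - 1 = cell Q s (u - 1)" if "u \<noteq> 0" for s
    using that by (simp add: cell_def)
  have 9: "b - 1 + 1 = b" using assms by simp
  show ?thesis
    unfolding Q_def[symmetric] table_entry_def Let_def 1 2 3 4 5 9
    using 6 7 8 by (simp del: mult_Suc mult_Suc_right)
qed

lemma table_knapsack:
  assumes A: "\<And>k. k < table_size \<Longrightarrow> A k = table_entry A k"
    and ab: "1 \<le> b" "b \<le> G" "a \<le> G"
  shows "group_knapsack n m b S (part_of I) dem (weight a b)
    (\<lambda>j i s. A (cell (stage a b j i) s G)) (2 ^ n * (int a * g)) big"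
proof -
  have entry: "A (cell (stage a b j i) s u) = table_entry A (cell (stage a b j i) s u)"
    if "j \<le> m" "i \<le> n" "s < S" "u \<le> G" for j i s u
    using ab that by (intro A cell_less_table)
  note rec = trans[OF entry table_entry_cell[OF ab]]
  have zero: "A (cell (stage a b j (Suc i)) s 0) = A (cell (stage a b j i) s G)"
    if "1 \<le> j" "j \<le> m" "i < n" "s < S" for j i s
    using that by (subst rec) auto
  have keep: "A (cell (stage a b j (Suc i)) s (Suc u)) = A (cell (stage a b j (Suc i)) s u)"
    if "1 \<le> j" "j \<le> m" "i < n" "s < S" "Suc u \<le> G" "part_of I (Suc i) \<noteq> j \<or> b < Suc u \<or> s < Suc u" for j i s u
    using that by (subst rec) auto
  have relax: "A (cell (stage a b j (Suc i)) s (Suc u)) = min (A (cell (stage a b j (Suc i)) s u))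
      (A (cell (stage a b j i) (s - Suc u) G) + weight a b (Suc i) (Suc u))"
    if "1 \<le> j" "j \<le> m" "i < n" "s < S" "Suc u \<le> G" "part_of I (Suc i) = j" "Suc u \<le> b" "Suc u \<le> s" for j i s u
    using that by (subst rec) auto
  \<comment> \<open>Zero units are free, so the entry at \<open>u = 0\<close>, copied from the
    previous item, is the first candidate of the minimum.\<close>
  have w0: "weight a b i 0 = 0" for i
    using ab(1) by (simp add: weight_def pay_def Let_def)
  have row_le: "A (cell (stage a b j (Suc i)) s U) \<le> A (cell (stage a b j i) (s - u) G) + weight a b (Suc i) u"
    if *: "1 \<le> j" "j \<le> m" "i < n" "s < S" "part_of I (Suc i) = j" and "u \<le> b" "u \<le> s" "U \<le> G" "u \<le> U" for j i s u U
    using that(8,9)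
  proof (induction U)
    case 0
    then show ?case using zero * w0 by simp
  next
    case (Suc U)
    show ?case
    proof (cases "u = Suc U")
      case True
      have "Suc U \<le> b" "Suc U \<le> s" using True \<open>u \<le> b\<close> \<open>u \<le> s\<close> by simp_all
      from relax[OF *(1-4) Suc.prems(1) *(5) this] show ?thesis unfolding True by linarith
    next
      case False
      have "A (cell (stage a b j (Suc i)) s (Suc U)) \<le> A (cell (stage a b j (Suc i)) s U)"
      proof (cases "b < Suc U \<or> s < Suc U")
        case True
        then show ?thesis using keep[OF *(1-4) Suc.prems(1)] by simp
      next
        case False
        then have "Suc U \<le> b" "Suc U \<le> s" by simp_all
        from relax[OF *(1-4) Suc.prems(1) *(5) this] show ?thesis by linarith
      qed
      moreover have "U \<le> G" "u \<le> U" using Suc.prems False by simp_all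
      ultimately show ?thesis using Suc.IH by linarith
    qed
  qed
  have row_eq: "\<exists>u\<le>b. u \<le> s \<and> A (cell (stage a b j (Suc i)) s U) = A (cell (stage a b j i) (s - u) G) + weight a b (Suc i) u"
    if *: "1 \<le> j" "j \<le> m" "i < n" "s < S" "part_of I (Suc i) = j" and "U \<le> G" for j i s U
    using that(6)
  proof (induction U)
    case 0
    then show ?case using zero * w0 by (intro exI[of _ 0]) simp
  next
    case (Suc U)
    then obtain u where u: "u \<le> b" "u \<le> s"
      "A (cell (stage a b j (Suc i)) s U) = A (cell (stage a b j i) (s - u) G) + weight a b (Suc i) u"
      by auto
    show ?case
    proof (cases "b < Suc U \<or> s < Suc U")
      case True
      then have "A (cell (stage a b j (Suc i)) s (Suc U)) = A (cell (stage a b j (Suc i)) s U)"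
        by (intro keep[OF *(1-4) Suc.prems]) blast
      then show ?thesis using u by metis
    next
      case False
      then have U: "Suc U \<le> b" "Suc U \<le> s" by simp_all
      show ?thesis
        using relax[OF *(1-4) Suc.prems *(5) U] u U unfolding min_def by metis
    qed
  qed
  show ?thesis
  proof
    show "1 \<le> part_of I k \<and> part_of I k \<le> m" if "k \<in> {1..n}" for k
      using part_of_mem(1)[OF that] by simp
    show "b * dem j < S" if "j \<le> m" for j using demand_index_less ab that by simp
    show "A (cell (stage a b 0 n) (b * dem 0) G) = 2 ^ n * (int a * g)"
      using demand_index_less[of b 0] ab by (subst rec) auto
    show "A (cell (stage a b j 0) s G) =
        (if s = 0 then A (cell (stage a b (j - 1) n) (b * dem (j - 1)) G) else big)"
      if "1 \<le> j" "j \<le> m" "s < S" for j s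
      using that by (subst rec) auto
    show "A (cell (stage a b j (Suc i)) s G) = A (cell (stage a b j i) s G)"
      if *: "1 \<le> j" "j \<le> m" "i < n" "s < S" "part_of I (Suc i) \<noteq> j" for j i s
    proof -
      have "A (cell (stage a b j (Suc i)) s U) = A (cell (stage a b j i) s G)" if "U \<le> G" for U
        using that by (induction U) (use * zero keep in auto)
      then show ?thesis by simp
    qed
    show "A (cell (stage a b j (Suc i)) s G) \<le> A (cell (stage a b j i) (s - u) G) + weight a b (Suc i) u"
      if "1 \<le> j" "j \<le> m" "i < n" "s < S" "part_of I (Suc i) = j" "u \<le> b" "u \<le> s" for j i s u
      using that ab by (intro row_le) auto
    show "\<exists>u\<le>b. u \<le> s \<and> A (cell (stage a b j (Suc i)) s G) = A (cell (stage a b j i) (s - u) G) + weight a b (Suc i) u"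
      if "1 \<le> j" "j \<le> m" "i < n" "s < S" "part_of I (Suc i) = j" for j i s
      using that by (intro row_eq) auto
    show "0 \<le> weight a b k u" if "k \<in> {1..n}" for k u using weight_nonneg[OF that] .
  qed
qed

lemma solves_mrs_table:
  assumes A: "\<And>k. k < table_size \<Longrightarrow> A k = table_entry A k"
    and ab: "a \<le> G" "1 \<le> b" "b \<le> G"
  defines "h \<equiv> \<lambda>a b. A (cell (stage a b m n) (b * dem m) G)"
  assumes best: "\<And>a' b'. 1 \<le> b' \<Longrightarrow> b' \<le> G \<Longrightarrow> a' \<le> G \<Longrightarrow>
      (h a b div 2 ^ n) * int b' \<le> (h a' b' div 2 ^ n) * int b"
  shows "solves_mrs I ([h a b div 2 ^ n, D * int b] @
    map (\<lambda>i. h a b mod 2 ^ n div 2 ^ (i - 1) mod 2) [1..<n + 1])"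
proof (rule solves_mrs_best[where G = G])
  fix a b assume ab: "1 \<le> b" "b \<le> G" "a \<le> G"
  have big: "tagged_cost a b x z < big" if "x \<in> first_stage I" "\<And>i. i \<in> {1..n} \<Longrightarrow> z i \<le> b" for x z
    unfolding big_def using ab that total by (intro tagged_cost_less)
  note knapsack_tagged[OF table_knapsack[OF A ab] ab(1) dem_eq big]
  then show "\<And>x z. x \<in> first_stage I \<Longrightarrow> fractional_recourse x b z \<Longrightarrow> h a b \<le> tagged_cost a b x z"
    and "\<exists>x z. x \<in> first_stage I \<and> fractional_recourse x b z \<and> h a b = tagged_cost a b x z"
    unfolding h_def by blast+
qed (use ab best in auto)

end

section \<open>The encoding of the input\<close>

lemma int_size_pos: "1 \<le> int_size k"
  by (simp add: int_size_def)

lemma abs_less_two_power_int_size: "\<bar>k\<bar> < 2 ^ int_size k"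
proof -
  have "nat \<bar>k\<bar> < 2 ^ floorlog 2 (nat \<bar>k\<bar>)"
    using floorlog_bounds[of "nat \<bar>k\<bar>" 2] by (cases "k = 0") auto
  then have "int (nat \<bar>k\<bar>) < int (2 ^ floorlog 2 (nat \<bar>k\<bar>))"
    by linarith
  then show ?thesis by (simp add: int_size_def)
qed

lemma length_le_list_size: "length xs \<le> list_size xs"
  by (induction xs) (use int_size_pos in \<open>auto simp: list_size_def intro: add_le_mono[of 1, simplified]\<close>)

lemma list_size_append: "list_size (xs @ ys) = list_size xs + list_size ys"
  by (simp add: list_size_def)

lemma int_size_le_list_size: "x \<in> set xs \<Longrightarrow> int_size x \<le> list_size xs"
  by (auto simp: list_size_def member_le_sum_list)

lemma prod_abs_le_two_power:
  "finite A \<Longrightarrow> (\<Prod>k\<in>A. \<bar>f k\<bar>) \<le> 2 ^ (\<Sum>k\<in>A. int_size (f k))"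
proof (induction A rule: finite_induct)
  case (insert k A)
  then show ?case
    using mult_mono[OF less_imp_le[OF abs_less_two_power_int_size[of "f k"]] insert.IH]
    by (simp add: power_add prod_nonneg)
qed simp

text \<open>Since X + Y \<le> X * Y + 1 for X, Y \<ge> 1, a sum needs no more bits than the bound
  for the product provides.\<close>

lemma sum_abs_less_two_power:
  "finite A \<Longrightarrow> (\<Sum>k\<in>A. \<bar>f k\<bar>) < 2 ^ (\<Sum>k\<in>A. int_size (f k))"
proof (induction A rule: finite_induct)
  case (insert k A)
  let ?p = "(2::int) ^ int_size (f k)" and ?q = "(2::int) ^ (\<Sum>k\<in>A. int_size (f k))"
  have "0 \<le> (?p - 1) * (?q - 1)" by simp
  then have "?p + ?q \<le> ?p * ?q + 1" by (simp add: algebra_simps)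
  then show ?case
    using insert abs_less_two_power_int_size[of "f k"] by (simp add: power_add)
qed simp

lemma nth_concat_pairs:
  assumes "k < length ks"
  shows "concat (map (\<lambda>k. [f k, g k]) ks) ! (2 * k) = f (ks ! k)"
    and "concat (map (\<lambda>k. [f k, g k]) ks) ! (2 * k + 1) = g (ks ! k)"
  using assms by (induction ks arbitrary: k) (auto simp: less_Suc_eq_0_disj)

lemma length_concat_pairs: "length (concat (map (\<lambda>k. [f k, g k]) ks)) = 2 * length ks"
  by (induction ks) auto

context mrs_instance
begin

text \<open>All rationals of the input in one sequence, in the order of the encoding and counted
  from 1, so that one loop and one address formula serve them all.\<close>

definition rats :: "nat \<Rightarrow> rat" where
  "rats k = (if k \<le> num_items I then first_cost I k
     else if k \<le> 2 * num_items I then lower_cost I (k - num_items I)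
     else if k \<le> 3 * num_items I then deviation I (k - 2 * num_items I)
     else budget I)"

definition num :: "nat \<Rightarrow> int" where "num k = fst (quotient_of (rats k))"
definition den :: "nat \<Rightarrow> int" where "den k = snd (quotient_of (rats k))"

abbreviation "R \<equiv> 3 * num_items I + 1"

lemma encode_mrs_eq:
  "encode_mrs I = [int (num_items I), int (num_parts I)]
     @ map (\<lambda>i. int (part_of I i)) [1..<num_items I + 1]
     @ map (\<lambda>j. int (demand I j)) [1..<num_parts I + 1]
     @ concat (map (\<lambda>k. [num k, den k]) [1..<R + 1])"
proof -
  let ?n = "num_items I"
  have shift: "map (\<lambda>i. encode_rat (f i)) [1..<?n + 1] = map (\<lambda>k. [num k, den k]) [p + 1..<p + ?n + 1]"
    if "\<And>i. i \<in> {1..?n} \<Longrightarrow> rats (p + i) = f i" for f p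
  proof -
    have "map (\<lambda>k. [num k, den k]) [p + 1..<p + ?n + 1] = map (\<lambda>k. [num k, den k]) (map (\<lambda>i. i + p) [1..<?n + 1])"
      by (intro nth_equalityI) (simp_all add: add_ac del: upt_Suc)
    also have "\<dots> = map (\<lambda>i. encode_rat (f i)) [1..<?n + 1]"
    proof -
      have "[num (i + p), den (i + p)] = encode_rat (f i)" if "i \<in> set [1..<?n + 1]" for i
        using that \<open>\<And>i. i \<in> {1..?n} \<Longrightarrow> rats (p + i) = f i\<close>[of i]
        by (auto simp: num_def den_def encode_rat_def add.commute)
      then show ?thesis unfolding map_map o_def by (intro map_cong refl)
    qed
    finally show ?thesis by simp
  qed
  have split: "[1..<R + 1] = [0 + 1..<0 + ?n + 1] @ [?n + 1..<?n + ?n + 1] @ [2 * ?n + 1..<2 * ?n + ?n + 1] @ [R]"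
    using upt_add_eq_append[of 1 "3 * ?n + 1" 1] upt_add_eq_append[of 1 "2 * ?n + 1" ?n] upt_add_eq_append[of 1 "?n + 1" ?n]
    by (simp add: add_ac mult_2 mult_2_right numeral_3_eq_3)
  have "[num R, den R] = encode_rat (budget I)" by (simp add: num_def den_def encode_rat_def rats_def)
  moreover have "map (\<lambda>i. encode_rat (first_cost I i)) [1..<?n + 1] = map (\<lambda>k. [num k, den k]) [0 + 1..<0 + ?n + 1]"
    by (rule shift) (simp add: rats_def)
  moreover have "map (\<lambda>i. encode_rat (lower_cost I i)) [1..<?n + 1] = map (\<lambda>k. [num k, den k]) [?n + 1..<?n + ?n + 1]"
    by (rule shift) (simp add: rats_def)
  moreover have "map (\<lambda>i. encode_rat (deviation I i)) [1..<?n + 1] = map (\<lambda>k. [num k, den k]) [2 * ?n + 1..<2 * ?n + ?n + 1]"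
    by (rule shift) (simp add: rats_def)
  ultimately show ?thesis
    unfolding encode_mrs_def split map_append concat_append
    by (simp only: list.map concat.simps append_Nil2)
qed

abbreviation "inp \<equiv> list_cells (encode_mrs I)"
abbreviation "L \<equiv> list_size (encode_mrs I)"

lemma length_encode: "length (encode_mrs I) = 2 + num_items I + num_parts I + 2 * R"
  by (simp add: encode_mrs_eq length_concat_pairs del: upt_Suc)

lemma size_bounds: "2 + num_items I + num_parts I + 2 * R \<le> L"
  using length_le_list_size[of "encode_mrs I"] by (simp add: length_encode)

lemma inp_nth: "i < length (encode_mrs I) \<Longrightarrow> inp (int i + 1) = encode_mrs I ! i"
  by (simp add: list_cells_def)

lemma inp_1: "inp 1 = int (num_items I)"
  using inp_nth[of 0] by (simp add: length_encode) (simp add: encode_mrs_eq)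

lemma inp_2: "inp 2 = int (num_parts I)"
  using inp_nth[of 1] by (simp add: length_encode) (simp add: encode_mrs_eq)

lemma inp_part:
  assumes "i \<in> N"
  shows "inp (2 + int i) = int (part_of I i)"
proof -
  have "inp (int (1 + i) + 1) = encode_mrs I ! (1 + i)"
    using assms by (intro inp_nth) (simp add: length_encode)
  also have "\<dots> = int (part_of I i)"
    using assms by (auto simp: encode_mrs_eq nth_append nth_Cons' simp del: upt_Suc)
  finally show ?thesis by (simp add: add_ac)
qed

lemma inp_demand:
  assumes "j \<in> M"
  shows "inp (2 + int (num_items I) + int j) = int (demand I j)"
proof -
  have "inp (int (1 + num_items I + j) + 1) = encode_mrs I ! (1 + num_items I + j)"
    using assms by (intro inp_nth) (simp add: length_encode)
  also have "\<dots> = int (demand I j)"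
    using assms by (auto simp: encode_mrs_eq nth_append nth_Cons' simp del: upt_Suc)
  finally show ?thesis by (simp add: add_ac)
qed

lemma inp_rat:
  assumes "k < R"
  shows "inp (2 + int (num_items I) + int (num_parts I) + (2 * int k + 1)) = num (k + 1)"
    and "inp (2 + int (num_items I) + int (num_parts I) + (2 * int k + 2)) = den (k + 1)"
proof -
  let ?b = "2 + num_items I + num_parts I"
  let ?pre = "[int (num_items I), int (num_parts I)]
     @ map (\<lambda>i. int (part_of I i)) [1..<num_items I + 1] @ map (\<lambda>j. int (demand I j)) [1..<num_parts I + 1]"
  have pre: "encode_mrs I ! (?b + l) = concat (map (\<lambda>k. [num k, den k]) [1..<R + 1]) ! l" for l
    using nth_append_length_plus[of ?pre _ l] by (simp add: encode_mrs_eq del: upt_Suc)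
  have "inp (int (?b + 2 * k) + 1) = encode_mrs I ! (?b + 2 * k)"
    using assms by (intro inp_nth) (simp add: length_encode)
  also have "\<dots> = num ([1..<R + 1] ! k)"
    unfolding pre using assms by (intro nth_concat_pairs(1)) simp
  finally show "inp (2 + int (num_items I) + int (num_parts I) + (2 * int k + 1)) = num (k + 1)"
    using assms by (simp add: add_ac del: upt_Suc)
  have "inp (int (?b + (2 * k + 1)) + 1) = encode_mrs I ! (?b + (2 * k + 1))"
    using assms by (intro inp_nth) (simp add: length_encode)
  also have "\<dots> = den ([1..<R + 1] ! k)"
    unfolding pre using assms by (intro nth_concat_pairs(2)) simp
  finally show "inp (2 + int (num_items I) + int (num_parts I) + (2 * int k + 2)) = den (k + 1)"
    using assms by (simp add: add_ac del: upt_Suc)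
qed

lemma abs_inp_le: "\<bar>inp i\<bar> \<le> 2 ^ L"
proof -
  let ?xs = "encode_mrs I"
  consider "i = 0" | "1 \<le> i" "i \<le> int (length ?xs)" | "inp i = 0"
    by (cases "i = 0"; cases "1 \<le> i \<and> i \<le> int (length ?xs)") (auto simp: list_cells_def)
  then show ?thesis
  proof cases
    case 1
    have "length ?xs < 2 ^ L"
      using length_le_list_size[of ?xs] less_exp[of L] by linarith
    then have "int (length ?xs) < int (2 ^ L)" by (simp only: of_nat_less_iff)
    then show ?thesis using 1 by (simp add: list_cells_def)
  next
    case 2
    then have "inp i \<in> set ?xs" by (auto simp: list_cells_def intro!: nth_mem)
    then have "(2::int) ^ int_size (inp i) \<le> 2 ^ L"
      by (intro power_increasing int_size_le_list_size) auto
    then show ?thesis using abs_less_two_power_int_size[of "inp i"] by linarith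
  qed simp
qed

text \<open>This makes a common denominator affordable: the sizes of all denominators add up to at
  most the input size, so their product has at most \<open>L\<close> bits.\<close>

lemma sum_sizes_le: "(\<Sum>k\<in>{1..R}. int_size (num k)) + (\<Sum>k\<in>{1..R}. int_size (den k)) \<le> L"
proof -
  have "list_size (concat (map (\<lambda>k. [num k, den k]) ks)) =
      (\<Sum>k\<leftarrow>ks. int_size (num k)) + (\<Sum>k\<leftarrow>ks. int_size (den k))" for ks
    by (induction ks) (auto simp: list_size_def)
  moreover have "(\<Sum>k\<leftarrow>[1..<R + 1]. f k) = sum f {1..R}" for f :: "nat \<Rightarrow> nat"
    using interv_sum_list_conv_sum_set_nat[of f 1 "R + 1"] by (simp add: atLeastLessThanSuc_atLeastAtMost del: upt_Suc)
  moreover have "list_size (concat (map (\<lambda>k. [num k, den k]) [1..<R + 1])) \<le> L"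
    unfolding encode_mrs_eq list_size_append by simp
  ultimately show ?thesis by (simp only:)
qed

lemma den_pos: "0 < den k"
  by (simp add: den_def quotient_of_denom_pos')

lemma rats_eq: "of_rat (rats k) = real_of_int (num k) / real_of_int (den k)"
proof -
  have "rats k = of_int (num k) / of_int (den k)"
    by (rule quotient_of_div) (simp add: num_def den_def)
  then show ?thesis by (simp add: of_rat_divide)
qed

lemma rats_nonneg: "k \<in> {1..R} \<Longrightarrow> 0 \<le> rats k"
proof -
  assume "k \<in> {1..R}"
  then have "k \<in> N \<or> k - num_items I \<in> N \<or> k - 2 * num_items I \<in> N \<or> 3 * num_items I < k" by auto
  then show ?thesis
    using inst \<open>k \<in> {1..R}\<close> unfolding rats_def mrs_instances_def by force
qed

lemma num_nonneg:
  assumes "k \<in> {1..R}"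
  shows "0 \<le> num k"
proof -
  have "0 \<le> real_of_int (num k) / real_of_int (den k)"
    using rats_nonneg[OF assms] by (simp flip: rats_eq)
  then show ?thesis using den_pos[of k] by (simp add: zero_le_divide_iff)
qed

text \<open>The product replaces the least common multiple, as it takes one multiplication per
  denominator. \<open>common * numsum\<close> serves as \<open>total\<close>, because a scaled
  number is at most \<open>common\<close> times its numerator.\<close>

definition common :: int where "common = (\<Prod>k\<in>{1..R}. den k)"
definition numsum :: int where "numsum = (\<Sum>k\<in>{1..R}. num k)"
definition scaled :: "nat \<Rightarrow> int" where "scaled k = num k * (common div den k)"

lemma common_pos: "0 < common"
  unfolding common_def using den_pos by (intro prod_pos) auto

lemma partial_prod_le: "r \<le> R \<Longrightarrow> \<bar>\<Prod>k\<in>{1..r}. den k\<bar> \<le> 2 ^ L"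
proof -
  assume r: "r \<le> R"
  have "\<bar>\<Prod>k\<in>{1..r}. den k\<bar> \<le> 2 ^ (\<Sum>k\<in>{1..r}. int_size (den k))"
    unfolding abs_prod by (rule prod_abs_le_two_power) simp
  also have "\<dots> \<le> 2 ^ L"
  proof (rule power_increasing)
    have "(\<Sum>k\<in>{1..r}. int_size (den k)) \<le> (\<Sum>k\<in>{1..R}. int_size (den k))"
      using r by (intro sum_mono2) auto
    then show "(\<Sum>k\<in>{1..r}. int_size (den k)) \<le> L" using sum_sizes_le by linarith
  qed simp
  finally show ?thesis .
qed

lemma partial_sum_le: "r \<le> R \<Longrightarrow> \<bar>\<Sum>k\<in>{1..r}. num k\<bar> \<le> 2 ^ L"
proof -
  assume r: "r \<le> R"
  have "\<bar>\<Sum>k\<in>{1..r}. num k\<bar> \<le> (\<Sum>k\<in>{1..r}. \<bar>num k\<bar>)" by (rule sum_abs)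
  also have "\<dots> \<le> 2 ^ (\<Sum>k\<in>{1..r}. int_size (num k))"
    using sum_abs_less_two_power[of "{1..r}" num] by simp
  also have "\<dots> \<le> 2 ^ L"
  proof (rule power_increasing)
    have "(\<Sum>k\<in>{1..r}. int_size (num k)) \<le> (\<Sum>k\<in>{1..R}. int_size (num k))"
      using r by (intro sum_mono2) auto
    then show "(\<Sum>k\<in>{1..r}. int_size (num k)) \<le> L" using sum_sizes_le by linarith
  qed simp
  finally show ?thesis .
qed

lemma scaled_eq:
  assumes "k \<in> {1..R}"
  shows "real_of_int (scaled k) = common * of_rat (rats k)"
proof -
  have "den k dvd common" unfolding common_def using assms by (intro dvd_prodI) auto
  then have "real_of_int (common div den k) = common / den k" by (rule real_of_int_div)
  then show ?thesis by (simp add: scaled_def rats_eq)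
qed

lemma scaled_le: "k \<in> {1..R} \<Longrightarrow> scaled k \<le> common * num k"
proof -
  assume k: "k \<in> {1..R}"
  have "common div den k \<le> common"
    using abs_div_le_abs[of common "den k"] common_pos by simp
  then show ?thesis
    using num_nonneg[OF k] by (simp add: scaled_def mult.commute[of common] mult_left_mono)
qed

text \<open>
  At \<open>j = 0\<close> this reads the cell in front of the demands, which holds \<^term>\<open>part_of I (num_items I)\<close>
  (or \<open>0\<close> if there are no items).  The table refers to that value, which only has to be at
  most \<^term>\<open>num_items I\<close>.
\<close>

definition dem :: "nat \<Rightarrow> nat" where "dem j = nat (inp (2 + int (num_items I) + int j))"

text \<open>Parts are nonempty and disjoint, so \<open>part_of I\<close> maps the items onto the
  parts. This bounds the part index that is read as \<open>dem 0\<close>.\<close>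

lemma num_parts_le: "num_parts I \<le> num_items I"
proof -
  have "j \<in> part_of I ` N" if j: "j \<in> M" for j
  proof -
    obtain i where "i \<in> part I j" using inst j by (fastforce simp: mrs_instances_def)
    then show ?thesis using part_of_eq[of i j] j finite_part(2)[OF inst j] by blast
  qed
  then have "card M \<le> card N" by (intro surj_card_le[of _ _ "part_of I"]) auto
  then show ?thesis by simp
qed

lemma inp_dem:
  assumes "j \<le> num_parts I"
  shows "inp (2 + int (num_items I) + int j) = int (dem j)" "dem j \<le> num_items I"
proof -
  have "0 \<le> inp (2 + int (num_items I) + int j) \<and> inp (2 + int (num_items I) + int j) \<le> int (num_items I)"
  proof (cases "j = 0")
    case True
    show ?thesis
    proof (cases "num_items I = 0")
      case True
      then show ?thesis using \<open>j = 0\<close> inp_2 num_parts_le by simp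
    next
      case False
      then have "inp (2 + int (num_items I)) = int (part_of I (num_items I))" by (intro inp_part) simp
      moreover have "part_of I (num_items I) \<in> M" using False by (intro part_of_mem) simp
      ultimately show ?thesis using \<open>j = 0\<close> num_parts_le by simp
    qed
  next
    case False
    then have j: "j \<in> M" using assms by simp
    have "demand I j \<le> card (part I j)" using inst j by (auto simp: mrs_instances_def)
    also have "\<dots> \<le> card N" using finite_part(2)[OF inst j] by (intro card_mono) auto
    finally show ?thesis using inp_demand[OF j] by simp
  qed
  then show "inp (2 + int (num_items I) + int j) = int (dem j)" "dem j \<le> num_items I"
    unfolding dem_def by auto
qed

lemma table_instance:
  "table_instance I common (scaled R) scaled (\<lambda>i. scaled (num_items I + i)) (\<lambda>i. scaled (2 * num_items I + i))
     dem (common * numsum)"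
proof unfold_locales
  let ?n = "num_items I"
  show "0 < common" by (rule common_pos)
  show "real_of_int (scaled i) = common * of_rat (first_cost I i)" if "i \<in> {1..?n}" for i
    using that scaled_eq[of i] by (simp add: rats_def)
  show "real_of_int (scaled (?n + i)) = common * of_rat (lower_cost I i)" if "i \<in> {1..?n}" for i
    using that scaled_eq[of "?n + i"] by (simp add: rats_def)
  show "real_of_int (scaled (2 * ?n + i)) = common * of_rat (deviation I i)" if "i \<in> {1..?n}" for i
    using that scaled_eq[of "2 * ?n + i"] by (simp add: rats_def)
  show "real_of_int (scaled R) = common * of_rat (budget I)"
    using scaled_eq[of R] by (simp add: rats_def)
  show "dem j \<le> ?n" if "j \<le> num_parts I" for j using inp_dem(2)[OF that] .
  show "dem j = demand I j" if "j \<in> {1..num_parts I}" for j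
    using inp_demand[OF that] by (simp add: dem_def)
  have shift: "(\<Sum>i\<in>{1..?n}. scaled (p + i)) = (\<Sum>k\<in>{p + 1..p + ?n}. scaled k)" for p
    using sum.shift_bounds_cl_nat_ivl[of scaled 1 p ?n] by (simp add: add_ac)
  have "(\<Sum>k\<in>{1..R}. scaled k) = (\<Sum>k\<in>{1..?n + (?n + ?n)}. scaled k) + scaled R"
    by (simp add: numeral_3_eq_3)
  also have "(\<Sum>k\<in>{1..?n + (?n + ?n)}. scaled k) =
      (\<Sum>k\<in>{1..?n}. scaled k) + (\<Sum>k\<in>{?n + 1..?n + ?n}. scaled k) + (\<Sum>k\<in>{2 * ?n + 1..2 * ?n + ?n}. scaled k)"
    using sum.ub_add_nat[of 1 "?n + ?n" scaled ?n] sum.ub_add_nat[of 1 ?n scaled ?n]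
    by (simp add: add.assoc mult_2)
  finally have "scaled R + (\<Sum>i\<in>{1..?n}. scaled i + scaled (?n + i) + scaled (2 * ?n + i)) = (\<Sum>k\<in>{1..R}. scaled k)"
    using shift[of 0] by (simp only: sum.distrib shift)
  also have "\<dots> \<le> (\<Sum>k\<in>{1..R}. common * num k)" by (intro sum_mono scaled_le)
  finally show "scaled R + (\<Sum>i\<in>{1..?n}. scaled i + scaled (?n + i) + scaled (2 * ?n + i)) \<le> common * numsum"
    unfolding numsum_def sum_distrib_left .
qed

end

section \<open>The program\<close>

fun seq :: "com list \<Rightarrow> com" where
  "seq [] = Skip"
| "seq [c] = c"
| "seq (c # cs) = Seq c (seq cs)"

text \<open>
  Cell 0 of \<open>G, B, H, S, K, M, D, T, I, g\<close> holds \<open>n + 1\<close>, \<open>n + 2\<close>, \<open>m + 1\<close>, \<open>(n + 1)\<^sup>2\<close>, the table size, \<open>2 ^ n\<close>,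
  the product of the denominators, the sum of the numerators, infinity and the scaled budget.
  Array \<open>P\<close> holds powers of two, array \<open>A\<close> the table.
\<close>

definition base_exp :: aexp where
  "base_exp = Add (Const 2) (Add (var ''n'') (var ''m''))"

definition num_exp :: "aexp \<Rightarrow> aexp" where
  "num_exp k = Read ''input'' (Add base_exp (Sub (Mul (Const 2) k) (Const 1)))"

definition den_exp :: "aexp \<Rightarrow> aexp" where
  "den_exp k = Read ''input'' (Add base_exp (Mul (Const 2) k))"

definition scaled_exp :: "aexp \<Rightarrow> aexp" where
  "scaled_exp k = Mul (num_exp k) (Quot (var ''D'') (den_exp k))"

text \<open>The counters, the sum \<open>T\<close> and the denominator \<open>e\<close> rely on the
  value 0 of all cells outside the input.\<close>

definition setup_prog :: com where
  "setup_prog = seq [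
     assign ''n'' (Read ''input'' (Const 1)),
     assign ''m'' (Read ''input'' (Const 2)),
     assign ''D'' (Const 1),
     assign ''P'' (Const 1)]"

definition product_body :: com where
  "product_body = seq [
     assign ''k'' (Add (var ''k'') (Const 1)),
     assign ''D'' (Mul (var ''D'') (den_exp (var ''k''))),
     assign ''T'' (Add (var ''T'') (num_exp (var ''k''))),
     Write ''P'' (var ''k'') (Mul (Const 2) (Read ''P'' (Sub (var ''k'') (Const 1))))]"

definition product_test :: bexp where
  "product_test = Less (var ''k'') (Add (Mul (Const 3) (var ''n'')) (Const 1))"

text \<open>\<open>f\<close> starts as \<open>2 ^ n\<close>, that is with cost part 1, so that
  together with \<open>e = 0\<close> it reads as the fraction 1/0.\<close>

definition middle_prog :: com where
  "middle_prog = seq [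
     assign ''M'' (Read ''P'' (var ''n'')),
     assign ''g'' (Mul (var ''M'') (scaled_exp (Add (Mul (Const 3) (var ''n'')) (Const 1)))),
     assign ''f'' (var ''M''),
     assign ''G'' (Add (var ''n'') (Const 1)),
     assign ''B'' (Add (var ''G'') (Const 1)),
     assign ''H'' (Add (var ''m'') (Const 1)),
     assign ''S'' (Mul (var ''G'') (var ''G'')),
     assign ''I'' (Mul (var ''M'') (Add (Mul (var ''G'') (Mul (var ''D'') (var ''T''))) (Const 1))),
     assign ''K'' (Mul (Mul (Mul (Mul (Mul (var ''G'') (var ''B'')) (var ''H'')) (var ''G'')) (var ''S'')) (var ''B''))]"

definition cell_exp :: "aexp \<Rightarrow> aexp \<Rightarrow> aexp" where
  "cell_exp Q s = Add (Mul (Add (Mul Q (var ''S'')) s) (var ''B'')) (var ''G'')"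

definition decode_prog :: com where
  "decode_prog = seq [
     assign ''x1'' (Quot (var ''t'') (var ''B'')),
     assign ''u'' (Sub (var ''t'') (Mul (var ''x1'') (var ''B''))),
     assign ''Q'' (Quot (var ''x1'') (var ''S'')),
     assign ''s'' (Sub (var ''x1'') (Mul (var ''Q'') (var ''S''))),
     assign ''x2'' (Quot (var ''Q'') (var ''G'')),
     assign ''i'' (Sub (var ''Q'') (Mul (var ''x2'') (var ''G''))),
     assign ''v'' (Quot (var ''x2'') (var ''H'')),
     assign ''j'' (Sub (var ''x2'') (Mul (var ''v'') (var ''H''))),
     assign ''x3'' (Quot (var ''v'') (var ''B'')),
     assign ''a'' (Sub (var ''v'') (Mul (var ''x3'') (var ''B''))),
     assign ''b'' (Add (var ''x3'') (Const 1))]"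

definition weight_prog :: com where
  "weight_prog = seq [
     assign ''w'' (Mul (scaled_exp (Add (var ''n'') (var ''i''))) (var ''u'')),
     Cond (Less (var ''a'') (var ''u''))
       (assign ''w'' (Add (var ''w'')
         (Mul (scaled_exp (Add (Mul (Const 2) (var ''n'')) (var ''i''))) (Sub (var ''u'') (var ''a''))))) Skip,
     assign ''w'' (Mul (var ''M'') (var ''w'')),
     assign ''y'' (Add (Mul (var ''M'') (Mul (var ''b'') (scaled_exp (var ''i'')))) (Read ''P'' (Sub (var ''i'') (Const 1)))),
     Cond (Conj (Neg (Less (var ''u'') (var ''b''))) (Less (var ''y'') (var ''w'')))
       (assign ''w'' (var ''y'')) Skip]"

definition relax_prog :: com where
  "relax_prog = seq [
     weight_prog,
     assign ''w'' (Add (Read ''A'' (cell_exp (Sub (var ''Q'') (Const 1)) (Sub (var ''s'') (var ''u'')))) (var ''w'')),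
     Cond (Less (var ''w'') (var ''r'')) (assign ''r'' (var ''w'')) Skip]"

definition entry_prog :: com where
  "entry_prog =
     Cond (Less (var ''j'') (Const 1)) (assign ''r'' (Mul (var ''a'') (var ''g'')))
     (Cond (Less (var ''i'') (Const 1))
        (Cond (Less (var ''s'') (Const 1))
           (assign ''r'' (Read ''A'' (cell_exp (Sub (var ''Q'') (Const 1))
             (Mul (var ''b'') (Read ''input'' (Add (Add (Const 2) (var ''n'')) (Sub (var ''j'') (Const 1))))))))
           (assign ''r'' (var ''I'')))
     (Cond (Less (var ''u'') (Const 1))
        (assign ''r'' (Read ''A'' (cell_exp (Sub (var ''Q'') (Const 1)) (var ''s''))))
     (Seq (assign ''r'' (Read ''A'' (Sub (var ''t'') (Const 1))))
        (Cond (Conj (Conj (Neg (Less (Read ''input'' (Add (Const 2) (var ''i''))) (var ''j'')))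
                         (Neg (Less (var ''j'') (Read ''input'' (Add (Const 2) (var ''i''))))))
                   (Conj (Neg (Less (var ''b'') (var ''u''))) (Neg (Less (var ''s'') (var ''u'')))))
           relax_prog Skip))))"

definition temps :: "string list" where
  "temps = [''x1'', ''u'', ''Q'', ''s'', ''x2'', ''i'', ''v'', ''j'', ''x3'', ''a'', ''b'', ''w'', ''y'', ''r'']"

definition clear :: "string list \<Rightarrow> com" where
  "clear xs = seq (map (\<lambda>x. assign x (Const 0)) xs)"

definition store_prog :: com where
  "store_prog = seq [Write ''A'' (var ''t'') (var ''r''), assign ''t'' (Add (var ''t'') (Const 1)), clear temps]"

definition table_body :: com where
  "table_body = Seq decode_prog (Seq entry_prog store_prog)"

definition table_test :: bexp where "table_test = Less (var ''t'') (var ''K'')"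

text \<open>\<open>z\<close> enumerates the pairs as \<open>(b - 1) * (n + 2) + a\<close>;
  \<open>x1\<close> holds \<open>b\<close>.\<close>

definition select_body :: com where
  "select_body = seq [
     assign ''x1'' (Add (Quot (var ''z'') (var ''B'')) (Const 1)),
     assign ''r'' (Read ''A'' (cell_exp (Add (Mul (Add (Mul (var ''z'') (var ''H'')) (var ''m'')) (var ''G'')) (var ''n''))
       (Mul (var ''x1'') (Read ''input'' (Add (Add (Const 2) (var ''n'')) (var ''m'')))))),
     Cond (Less (Mul (Quot (var ''r'') (var ''M'')) (var ''e'')) (Mul (Quot (var ''f'') (var ''M'')) (var ''x1'')))
       (Seq (assign ''f'' (var ''r'')) (assign ''e'' (var ''x1''))) Skip,
     assign ''z'' (Add (var ''z'') (Const 1)),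
     assign ''x1'' (Const 0), assign ''r'' (Const 0)]"

definition select_test :: bexp where "select_test = Less (var ''z'') (Mul (var ''G'') (var ''B''))"

definition answer_prog :: com where
  "answer_prog = seq [
     Write ''output'' (Const 0) (Add (var ''n'') (Const 2)),
     Write ''output'' (Const 1) (Quot (var ''f'') (var ''M'')),
     Write ''output'' (Const 2) (Mul (var ''D'') (var ''e'')),
     assign ''h'' (Sub (var ''f'') (Mul (Quot (var ''f'') (var ''M'')) (var ''M'')))]"

definition digit_exp :: aexp where
  "digit_exp = Quot (var ''h'') (Read ''P'' (var ''o''))"

definition output_body :: com where
  "output_body = seq [
     Write ''output'' (Add (var ''o'') (Const 3)) (Sub digit_exp (Mul (Const 2) (Quot digit_exp (Const 2)))),
     assign ''o'' (Add (var ''o'') (Const 1))]"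

definition output_test :: bexp where "output_test = Less (var ''o'') (var ''n'')"

lemmas prog_defs = setup_prog_def product_body_def product_test_def middle_prog_def decode_prog_def
  weight_prog_def relax_prog_def entry_prog_def clear_def temps_def store_prog_def table_body_def table_test_def
  select_body_def select_test_def answer_prog_def output_body_def output_test_def

lemma loop_free_progs:
  "loop_free setup_prog" "loop_free product_body" "loop_free middle_prog" "loop_free table_body"
  "loop_free select_body" "loop_free answer_prog" "loop_free output_body"
  by (simp_all add: prog_defs)

lemma written_decode: "written decode_prog = {''x1'', ''u'', ''Q'', ''s'', ''x2'', ''i'', ''v'', ''j'', ''x3'', ''a'', ''b''}"
  by (auto simp: prog_defs)

lemma written_entry: "written entry_prog = {''w'', ''y'', ''r''}"
  by (auto simp: prog_defs)

lemma sem_clear: "sem (clear xs) s A i = (if A \<in> set xs \<and> i = 0 then 0 else s A i)"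
proof (induction xs arbitrary: s)
  case (Cons x xs)
  have "sem (clear (x # xs)) s = sem (clear xs) (upd s x 0 0)"
    by (cases xs) (simp_all add: clear_def)
  then show ?case using Cons by (auto simp: upd_def)
qed (simp add: clear_def)

lemma sem_store:
  "sem store_prog s A i =
    (if A \<in> set temps \<and> i = 0 then 0 else if A = ''A'' \<and> i = s ''t'' 0 then s ''r'' 0
     else if A = ''t'' \<and> i = 0 then s ''t'' 0 + 1 else s A i)"
  by (auto simp: store_prog_def sem_clear upd_def temps_def)

lemma sem_decode:
  fixes k B S G H :: nat
  assumes "s ''t'' 0 = int k" "s ''B'' 0 = int B" "s ''S'' 0 = int S" "s ''G'' 0 = int G" "s ''H'' 0 = int H"
  defines "Q \<equiv> k div B div S"
  defines "v \<equiv> Q div G div H"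
  shows "sem decode_prog s ''u'' 0 = int (k mod B)"
    and "sem decode_prog s ''s'' 0 = int (k div B mod S)"
    and "sem decode_prog s ''Q'' 0 = int Q"
    and "sem decode_prog s ''i'' 0 = int (Q mod G)"
    and "sem decode_prog s ''j'' 0 = int (Q div G mod H)"
    and "sem decode_prog s ''a'' 0 = int (v mod B)"
    and "sem decode_prog s ''b'' 0 = int (v div B + 1)"
  unfolding Q_def v_def
  by (simp_all add: decode_prog_def upd_def assms(1-5) of_nat_div of_nat_mod minus_div_mult_eq_mod)

locale mrs_machine = mrs_instance

sublocale mrs_machine \<subseteq> table_instance I common "scaled R" scaled
    "\<lambda>i. scaled (num_items I + i)" "\<lambda>i. scaled (2 * num_items I + i)" dem "common * numsum"
  by (rule table_instance)

context mrs_machine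
begin

section \<open>Meaning of the expressions and of one table entry\<close>

definition input_ready :: "memory \<Rightarrow> bool" where
  "input_ready s \<longleftrightarrow> s ''input'' = inp \<and> s ''n'' 0 = int n \<and> s ''m'' 0 = int m"

definition ready :: "memory \<Rightarrow> bool" where
  "ready s \<longleftrightarrow> input_ready s \<and> s ''D'' 0 = common \<and> s ''T'' 0 = numsum \<and>
     (\<forall>k\<le>R. s ''P'' (int k) = 2 ^ k) \<and>
     s ''G'' 0 = int G \<and> s ''B'' 0 = int (Suc G) \<and> s ''H'' 0 = int H \<and> s ''S'' 0 = int S \<and>
     s ''M'' 0 = 2 ^ n \<and> s ''I'' 0 = big \<and> s ''g'' 0 = 2 ^ n * scaled R \<and> s ''K'' 0 = int table_size"

lemma aval_num:
  assumes "input_ready s" and "aval e s = int k" and "k \<in> {1..R}"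
  shows "aval (num_exp e) s = num k" and "aval (den_exp e) s = den k"
proof -
  obtain l where l: "k = Suc l" "l < R" using assms(3) by (cases k) auto
  have "2 + (int n + int m) + (2 * int k - 1) = 2 + int n + int m + (2 * int l + 1)"
    "2 + (int n + int m) + 2 * int k = 2 + int n + int m + (2 * int l + 2)"
    using l(1) by simp_all
  then show "aval (num_exp e) s = num k" and "aval (den_exp e) s = den k"
    using inp_rat[OF l(2)] assms(1,2) l(1)
    by (simp_all add: num_exp_def den_exp_def base_exp_def input_ready_def)
qed

lemma aval_scaled:
  assumes "input_ready s" and "s ''D'' 0 = common" and "aval e s = int k" and "k \<in> {1..R}"
  shows "aval (scaled_exp e) s = scaled k"
  using aval_num[OF assms(1,3,4)] assms(2) by (simp add: scaled_exp_def scaled_def)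

lemma aval_cell:
  assumes "ready s" and "aval Q s = int q" and "aval e s = int k"
  shows "aval (cell_exp Q e) s = int (cell q k G)"
  using assms by (simp add: cell_exp_def cell_def ready_def algebra_simps)

lemma sem_weight:
  assumes s: "ready s" and i: "i \<in> N"
    and digits: "s ''i'' 0 = int i" "s ''u'' 0 = int u" "s ''a'' 0 = int a" "s ''b'' 0 = int b"
    and "u \<le> b"
  shows "sem weight_prog s ''w'' 0 = weight a b i u"
proof -
  define good where "good s' \<longleftrightarrow> (\<forall>A. A \<notin> {''w'', ''y''} \<longrightarrow> s' A = s A)" for s' :: memory
  have good0: "good s" by (simp add: good_def)
  have good_upd: "good (upd s' A 0 v)" if "good s'" "A \<in> {''w'', ''y''}" for s' A v
    using that by (auto simp: good_def upd_eq)
  have good: "ready s' \<and> s' ''i'' 0 = int i \<and> s' ''u'' 0 = int u \<and> s' ''a'' 0 = int a \<and> s' ''b'' 0 = int b"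
    if "good s'" for s'
    using that s digits by (simp add: good_def ready_def input_ready_def)
  have c: "aval (scaled_exp (Add (var ''n'') (var ''i''))) s' = scaled (n + i)"
    and d: "aval (scaled_exp (Add (Mul (Const 2) (var ''n'')) (var ''i''))) s' = scaled (2 * n + i)"
    and C: "aval (scaled_exp (var ''i'')) s' = scaled i" if "good s'" for s'
    using good[OF that] i by (intro aval_scaled; simp add: ready_def input_ready_def)+
  have P: "s' ''P'' (int i - 1) = 2 ^ (i - 1)" if "good s'" for s'
  proof -
    have "i - 1 \<le> R" "int i - 1 = int (i - 1)" using i by auto
    then show ?thesis using good[OF that] by (simp only: ready_def)
  qed
  have M: "s' ''M'' 0 = 2 ^ n" if "good s'" for s' using good[OF that] by (simp add: ready_def)
  define w0 where "w0 = scaled (n + i) * int u + scaled (2 * n + i) * int (u - a)"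
  define y0 where "y0 = 2 ^ n * (int b * scaled i) + 2 ^ (i - 1)"
  define s1 where "s1 = upd s ''w'' 0 (scaled (n + i) * int u)"
  define s2 where "s2 = upd s1 ''w'' 0 w0"
  define s3 where "s3 = upd s2 ''w'' 0 (2 ^ n * w0)"
  define s4 where "s4 = upd s3 ''y'' 0 y0"
  have g: "good s1" "good s2" "good s3" "good s4"
    unfolding s1_def s2_def s3_def s4_def by (intro good_upd good0; simp)+
  have "sem weight_prog s ''w'' 0 = (if \<not> int u < int b \<and> y0 < 2 ^ n * w0 then y0 else 2 ^ n * w0)"
  proof -
    let ?c1 = "assign ''w'' (Mul (scaled_exp (Add (var ''n'') (var ''i''))) (var ''u''))"
    have 1: "sem ?c1 s = s1"
      using c[OF good0] good[OF good0] by (simp add: s1_def)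
    have 2: "sem (Cond (Less (var ''a'') (var ''u''))
       (assign ''w'' (Add (var ''w'')
         (Mul (scaled_exp (Add (Mul (Const 2) (var ''n'')) (var ''i''))) (Sub (var ''u'') (var ''a''))))) Skip) s1 = s2"
      using d[OF g(1)] good[OF g(1)] unfolding sem_Cond_assign s2_def
      by (intro arg_cong[where f = "upd s1 ''w'' 0"]) (auto simp: w0_def s1_def upd_eq)
    have 3: "sem (assign ''w'' (Mul (var ''M'') (var ''w''))) s2 = s3"
      using M[OF g(2)] by (simp add: s3_def) (simp add: s2_def upd_eq)
    have 4: "sem (assign ''y'' (Add (Mul (var ''M'') (Mul (var ''b'') (scaled_exp (var ''i'')))) (Read ''P'' (Sub (var ''i'') (Const 1))))) s3 = s4"
      using M[OF g(3)] C[OF g(3)] P[OF g(3)] good[OF g(3)] by (simp add: s4_def y0_def)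
    have w4: "s4 ''w'' 0 = 2 ^ n * w0" "s4 ''y'' 0 = y0" by (simp_all add: s4_def s3_def upd_eq)
    show ?thesis
      unfolding weight_prog_def seq.simps sem.simps(3) 1 2 3 4
      unfolding sem_Cond_assign using good[OF g(4)] w4 by (simp add: upd_eq)
  qed
  then show ?thesis
    using \<open>u \<le> b\<close> by (auto simp: weight_def Let_def pay_def w0_def y0_def)
qed

lemma sem_entry:
  assumes s: "ready s"
    and digits: "s ''u'' 0 = int (k mod Suc G)" "s ''s'' 0 = int (k div Suc G mod S)"
      "s ''Q'' 0 = int Q" "s ''i'' 0 = int (Q mod G)" "s ''j'' 0 = int (Q div G mod H)"
      "s ''a'' 0 = int (v mod Suc G)" "s ''b'' 0 = int (v div Suc G + 1)" "s ''t'' 0 = int k"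
    and Q: "Q = k div Suc G div S" and v: "v = Q div G div H"
  shows "sem entry_prog s ''r'' 0 = table_entry (\<lambda>p. s ''A'' (int p)) k"
proof -
  define u where "u = k mod Suc G"
  define z where "z = k div Suc G mod S"
  define i where "i = Q mod G"
  define j where "j = Q div G mod H"
  define a where "a = v mod Suc G"
  define b where "b = v div Suc G + 1"
  note digits' = digits[folded u_def z_def i_def j_def a_def b_def]
  have i: "i \<le> n" unfolding i_def by (simp add: less_Suc_eq_le[symmetric] del: mult_Suc)
  have j: "j \<le> m" unfolding j_def by (simp add: less_Suc_eq_le[symmetric] del: mult_Suc)
  \<comment> \<open>A nonzero part digit makes \<open>Q\<close> positive, so the integer subtraction
    agrees with the truncated one.\<close>
  have Q0: "aval (Sub (var ''Q'') (Const 1)) s = int (Q - 1)" if "j \<noteq> 0"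
    using that digits' by (cases "Q = 0") (auto simp: j_def)
  have entry: "table_entry F k =
     (if j = 0 then int a * (2 ^ n * scaled R)
        else if i = 0 then if z = 0 then F (cell (Q - 1) (b * dem (j - 1)) G) else big
        else if u = 0 then F (cell (Q - 1) z G)
        else if part_of I i = j \<and> u \<le> b \<and> u \<le> z
             then min (F (k - 1)) (F (cell (Q - 1) (z - u) G) + weight a b i u)
        else F (k - 1))" for F
    unfolding table_entry_def Let_def Q[symmetric] v[symmetric] u_def z_def i_def j_def a_def b_def ..
  have tests: "bval (Less (var ''j'') (Const 1)) s \<longleftrightarrow> j = 0" "bval (Less (var ''i'') (Const 1)) s \<longleftrightarrow> i = 0"
    "bval (Less (var ''s'') (Const 1)) s \<longleftrightarrow> z = 0" "bval (Less (var ''u'') (Const 1)) s \<longleftrightarrow> u = 0"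
    using digits' by auto
  have g: "s ''g'' 0 = 2 ^ n * scaled R" and big: "aval (var ''I'') s = big"
    using s by (simp_all add: ready_def)
  show ?thesis
  proof (cases "j = 0")
    case True
    then show ?thesis
      using g digits'(6) unfolding entry entry_prog_def sem.simps(4) tests
      by (simp only: if_True sem_assign) (simp add: upd_eq)
  next
    case j0: False
    show ?thesis
    proof (cases "i = 0")
      case True
      have "s ''input'' (2 + int n + (int j - 1)) = int (dem (j - 1))"
        using inp_dem(1)[of "j - 1"] j j0 s by (simp add: ready_def input_ready_def of_nat_diff)
      then have "aval (Mul (var ''b'') (Read ''input'' (Add (Add (Const 2) (var ''n'')) (Sub (var ''j'') (Const 1))))) s =
          int (b * dem (j - 1))"
        using digits' s by (simp add: ready_def input_ready_def)
      note cell = aval_cell[OF s Q0[OF j0] this]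
      show ?thesis
        using True j0 big unfolding entry entry_prog_def sem.simps(4) tests
        by (cases "z = 0") (simp_all only: if_True if_False simp_thms sem_assign aval.simps(2) cell)
    next
      case i0: False
      show ?thesis
      proof (cases "u = 0")
        case True
        have "aval (var ''s'') s = int z" using digits' by simp
        note cell = aval_cell[OF s Q0[OF j0] this]
        show ?thesis
          using True j0 i0 unfolding entry entry_prog_def sem.simps(4) tests
          by (simp_all only: if_True if_False simp_thms sem_assign aval.simps(2) cell)
      next
        case u0: False
        then have k0: "int k - 1 = int (k - 1)" by (cases k) (auto simp: u_def)
        define s1 where "s1 = upd s ''r'' 0 (s ''A'' (int k - 1))"
        have s1: "ready s1" "s1 ''u'' 0 = int u" "s1 ''s'' 0 = int z" "s1 ''Q'' 0 = int Q" "s1 ''i'' 0 = int i"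
          "s1 ''j'' 0 = int j" "s1 ''a'' 0 = int a" "s1 ''b'' 0 = int b" "s1 ''A'' = s ''A''"
          "s1 ''input'' = inp" "s1 ''n'' 0 = int n"
          using s digits' unfolding s1_def by (simp_all add: upd_eq ready_def input_ready_def)
        have r1: "s1 ''r'' 0 = s ''A'' (int (k - 1))" unfolding s1_def k0 by (simp add: upd_eq)
        have iN: "i \<in> N" using i i0 by simp
        have part: "inp (2 + int i) = int (part_of I i)" by (rule inp_part[OF iN])
        have step: "sem entry_prog s ''r'' 0 =
            (if part_of I i = j \<and> u \<le> b \<and> u \<le> z then sem relax_prog s1 ''r'' 0 else s1 ''r'' 0)"
        proof -
          have 1: "sem (assign ''r'' (Read ''A'' (Sub (var ''t'') (Const 1)))) s = s1"
            using digits'(8) by (simp add: s1_def)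
          have 2: "bval (Conj (Conj (Neg (Less (Read ''input'' (Add (Const 2) (var ''i''))) (var ''j'')))
                         (Neg (Less (var ''j'') (Read ''input'' (Add (Const 2) (var ''i''))))))
                   (Conj (Neg (Less (var ''b'') (var ''u''))) (Neg (Less (var ''s'') (var ''u''))))) s1
              \<longleftrightarrow> part_of I i = j \<and> u \<le> b \<and> u \<le> z"
            using s1 part by auto
          show ?thesis
            unfolding entry_prog_def sem.simps(4) tests sem.simps(3) 1 2
            using j0 i0 u0 by simp
        qed
        have "sem relax_prog s1 ''r'' 0 = min (s ''A'' (int (k - 1))) (s ''A'' (int (cell (Q - 1) (z - u) G)) + weight a b i u)"
          if uz: "u \<le> b" "u \<le> z"
        proof -
          define s2 where "s2 = sem weight_prog s1"
          have w: "s2 ''w'' 0 = weight a b i u"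
            unfolding s2_def using s1 uz by (intro sem_weight iN) auto
          have same: "s2 A = s1 A" if "A \<notin> {''w'', ''y''}" for A
            unfolding s2_def using that by (intro sem_unwritten) (auto simp: weight_prog_def)
          have s2: "ready s2" using s1(1) by (simp add: ready_def input_ready_def same)
          have Q: "aval (Sub (var ''Q'') (Const 1)) s2 = int (Q - 1)"
          proof -
            have "s2 ''Q'' 0 = s ''Q'' 0" using digits'(3) s1(4) by (simp add: same)
            then show ?thesis unfolding Q0[OF j0, symmetric] by simp
          qed
          have z: "aval (Sub (var ''s'') (var ''u'')) s2 = int (z - u)"
            using uz s1 by (simp add: same of_nat_diff)
          note cell = aval_cell[OF s2 Q z]
          show ?thesis
            unfolding relax_prog_def seq.simps sem.simps(3) s2_def[symmetric] sem_Cond_assign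
            using cell w r1 s1(9) same[of "''A''"] same[of "''r''"]
            by (simp add: upd_eq min_def)
        qed
        then show ?thesis
          using j0 i0 u0 step r1 unfolding entry by simp
      qed
    qed
  qed
qed

end

section \<open>Correctness and running time\<close>

lemma scalar_writes_progs: "scalar_writes decode_prog" "scalar_writes entry_prog"
  by (simp_all add: decode_prog_def entry_prog_def relax_prog_def weight_prog_def)

context mrs_machine
begin

text \<open>The table size sets the constant: it is a product of seven numbers of at most
  \<open>L\<close>, with \<open>S\<close> counted as two factors.\<close>

abbreviation "bits \<equiv> 7 * L"

lemma L_bounds: "Suc (Suc (Suc (n + m))) \<le> L" "Suc R \<le> L" "0 < L"
  using size_bounds by auto

lemma power_L: "k \<le> 7 \<Longrightarrow> ((2::int) ^ L) ^ k \<le> 2 ^ bits"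
proof -
  assume "k \<le> 7"
  then show ?thesis unfolding power_mult[symmetric] by (intro power_increasing) auto
qed

lemma two_le_power_L: "2 \<le> (2::int) ^ L"
  using L_bounds(3) self_le_power[of "2::int" L] by simp

lemma small: "a \<le> L \<Longrightarrow> int a \<le> 2 ^ L"
proof -
  assume "a \<le> L"
  then have "a < 2 ^ L" using less_exp[of L] by linarith
  then have "int a < int (2 ^ L)" by (simp only: of_nat_less_iff)
  then show ?thesis by simp
qed

lemma two_power_small: "k \<le> L \<Longrightarrow> \<bar>(2::int) ^ k\<bar> \<le> 2 ^ L"
  by (simp add: power_increasing)

lemma in_bits: "\<bar>x\<bar> \<le> 2 ^ L \<Longrightarrow> \<bar>x\<bar> \<le> (2::int) ^ bits"
  by (rule order_trans, assumption) (intro power_increasing, auto)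

lemma table_size_le: "table_size \<le> L ^ 7"
proof -
  have "table_size \<le> L * L * L * L * (L * L) * L"
    unfolding table_size_def using L_bounds(1) by (intro mult_le_mono) auto
  then show ?thesis by (simp add: eval_nat_numeral mult_ac)
qed

lemma int_table_size_le: "int table_size \<le> 2 ^ bits"
proof -
  have "L ^ 7 \<le> (2 ^ L) ^ 7" using less_exp[of L] by (intro power_mono) auto
  then have "int table_size \<le> int ((2 ^ L) ^ 7)" using table_size_le by linarith
  moreover have "int ((2 ^ L) ^ 7) = (2 ^ L) ^ 7" by simp
  ultimately show ?thesis using power_L[of 7] by linarith
qed

lemma numsum_nonneg: "0 \<le> numsum"
  unfolding numsum_def by (intro sum_nonneg num_nonneg)

text \<open>Five factors \<open>2 ^ L\<close>: one each for \<open>2 ^ n\<close>, \<open>G\<close>,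
  \<open>common\<close> and \<open>numsum\<close>, and one to absorb the summand 1.\<close>

lemma big_le: "big \<le> 2 ^ bits"
proof -
  define X :: int where "X = 2 ^ L"
  have X: "2 \<le> X" using two_le_power_L by (simp add: X_def)
  have cs: "common \<le> X" "numsum \<le> X" "int G \<le> X" "2 ^ n \<le> X"
    using partial_prod_le[of R] partial_sum_le[of R] common_pos numsum_nonneg small[of G] L_bounds
      two_power_small[of n]
    by (auto simp: common_def numsum_def X_def)
  have "common * numsum \<le> X * X" using cs X numsum_nonneg by (intro mult_mono) auto
  then have 1: "int G * (common * numsum) \<le> X * (X * X)"
    using cs X numsum_nonneg common_pos by (intro mult_mono) auto
  have "1 \<le> X * (X * X)" using X mult_mono[of 1 X 1 "X * X"] mult_mono[of 1 X 1 X] by simp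
  then have "int G * (common * numsum) + 1 \<le> 2 * (X * (X * X))" using 1 by linarith
  also have "\<dots> \<le> X * (X * (X * X))" using X by (intro mult_right_mono) auto
  finally have "big \<le> X * (X * (X * (X * X)))"
    unfolding big_def using cs X numsum_nonneg common_pos by (intro mult_mono) auto
  also have "\<dots> = X ^ 5" by (simp add: eval_nat_numeral)
  also have "\<dots> \<le> 2 ^ bits" unfolding X_def by (rule power_L) simp
  finally show ?thesis .
qed

lemma two_power_n_le_big: "2 ^ n \<le> big"
proof -
  have "2 ^ n * 1 \<le> 2 ^ n * (int G * (common * numsum) + 1)"
    using numsum_nonneg common_pos by (intro mult_left_mono) auto
  then show ?thesis by (simp add: big_def)
qed

text \<open>The clause on zero arrays hands the default values on to the later loops.\<close>

definition product_inv :: "nat \<Rightarrow> memory \<Rightarrow> bool" where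
  "product_inv k s \<longleftrightarrow> k \<le> R \<and> input_ready s \<and> s ''k'' 0 = int k \<and>
     s ''D'' 0 = (\<Prod>l\<in>{1..k}. den l) \<and> s ''T'' 0 = (\<Sum>l\<in>{1..k}. num l) \<and>
     (\<forall>l\<le>k. s ''P'' (int l) = 2 ^ l) \<and>
     (\<forall>A. A \<notin> {''input'', ''n'', ''m'', ''k'', ''D'', ''T'', ''P''} \<longrightarrow> s A = (\<lambda>_. 0)) \<and>
     bounded_memory bits s"

lemma sem_setup: "product_inv 0 (sem setup_prog (input_memory (encode_mrs I)))"
proof -
  let ?s = "input_memory (encode_mrs I)"
  have 0: "bounded_memory bits ?s"
    unfolding bounded_memory_def input_memory_def using in_bits[OF abs_inp_le] by simp
  have eq: "sem setup_prog ?s = upd (upd (upd (upd ?s ''n'' 0 (int n)) ''m'' 0 (int m)) ''D'' 0 1) ''P'' 0 1"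
    by (simp add: setup_prog_def upd_eq input_memory_def inp_1 inp_2)
  have "\<bar>int n\<bar> \<le> 2 ^ bits" "\<bar>int m\<bar> \<le> 2 ^ bits"
    using small[of n] small[of m] L_bounds by (intro in_bits; simp)+
  then have "bounded_memory bits (sem setup_prog ?s)"
    unfolding eq by (intro bounded_memory_upd 0) simp_all
  then show ?thesis
    unfolding product_inv_def by (simp add: eq) (simp add: upd_eq input_ready_def input_memory_def fun_eq_iff)
qed

lemma sem_product_body:
  assumes inv: "product_inv k s" and k: "k < R"
  shows "bval product_test s \<and> product_inv (k + 1) (sem product_body s)"
proof
  have s: "input_ready s" "s ''k'' 0 = int k" using inv by (auto simp: product_inv_def)
  show "bval product_test s" using s k by (simp add: product_test_def input_ready_def)
  define s1 where "s1 = upd s ''k'' 0 (int (Suc k))"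
  define s2 where "s2 = upd s1 ''D'' 0 (\<Prod>l\<in>{1..Suc k}. den l)"
  define s3 where "s3 = upd s2 ''T'' 0 (\<Sum>l\<in>{1..Suc k}. num l)"
  define s4 where "s4 = upd s3 ''P'' (int (Suc k)) (2 ^ Suc k)"
  have r: "input_ready s1" "input_ready s2"
    using s(1) by (simp_all add: input_ready_def s1_def s2_def upd_eq)
  have 1: "sem (assign ''k'' (Add (var ''k'') (Const 1))) s = s1"
    using s by (simp add: s1_def add.commute)
  have "aval (den_exp (var ''k'')) s1 = den (Suc k)"
    using k by (intro aval_num(2) r) (auto simp: s1_def upd_eq)
  then have 2: "sem (assign ''D'' (Mul (var ''D'') (den_exp (var ''k'')))) s1 = s2"
    using inv by (simp add: s2_def) (simp add: s1_def upd_eq product_inv_def)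
  have "aval (num_exp (var ''k'')) s2 = num (Suc k)"
    using k by (intro aval_num(1) r) (auto simp: s2_def s1_def upd_eq)
  then have 3: "sem (assign ''T'' (Add (var ''T'') (num_exp (var ''k'')))) s2 = s3"
    using inv by (simp add: s3_def) (simp add: s2_def s1_def upd_eq product_inv_def)
  have 4: "sem (Write ''P'' (var ''k'') (Mul (Const 2) (Read ''P'' (Sub (var ''k'') (Const 1))))) s3 = s4"
    using inv by (simp add: s4_def) (simp add: s3_def s2_def s1_def upd_eq product_inv_def)
  have eq: "sem product_body s = s4"
    unfolding product_body_def seq.simps sem.simps(3) 1 2 3 4 ..
  have "bounded_memory bits s4"
    unfolding s1_def s2_def s3_def s4_def
  proof (intro bounded_memory_upd in_bits)
    show "bounded_memory bits s" using inv by (simp add: product_inv_def)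
    show "\<bar>int (Suc k)\<bar> \<le> 2 ^ L" using small[of "Suc k"] k L_bounds by simp
    show "\<bar>\<Prod>l\<in>{1..Suc k}. den l\<bar> \<le> 2 ^ L" using k by (intro partial_prod_le) simp
    show "\<bar>\<Sum>l\<in>{1..Suc k}. num l\<bar> \<le> 2 ^ L" using k by (intro partial_sum_le) simp
    show "\<bar>(2::int) ^ Suc k\<bar> \<le> 2 ^ L" using k L_bounds by (intro two_power_small) simp
  qed
  moreover have "input_ready s4" using s(1) by (simp add: input_ready_def s1_def s2_def s3_def s4_def upd_eq)
  moreover have "\<forall>l\<le>Suc k. s4 ''P'' (int l) = 2 ^ l"
    using inv by (auto simp: s1_def s2_def s3_def s4_def upd_eq product_inv_def le_Suc_eq)
  ultimately show "product_inv (k + 1) (sem product_body s)"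
    unfolding eq product_inv_def using k inv
    by (simp add: s1_def s2_def s3_def s4_def upd_eq product_inv_def del: prod.cl_ivl_Suc sum.cl_ivl_Suc)
qed

lemma product_test_stop: "product_inv R s \<Longrightarrow> \<not> bval product_test s"
  by (simp add: product_inv_def product_test_def input_ready_def)

definition table_inv :: "nat \<Rightarrow> memory \<Rightarrow> bool" where
  "table_inv k s \<longleftrightarrow> k \<le> table_size \<and> ready s \<and> s ''t'' 0 = int k \<and>
     (\<forall>p<k. s ''A'' (int p) = table_entry (\<lambda>p. s ''A'' (int p)) p) \<and>
     (\<forall>p. 0 \<le> s ''A'' (int p) \<and> s ''A'' (int p) \<le> big) \<and>
     s ''f'' 0 = 2 ^ n \<and> s ''e'' 0 = 0 \<and> s ''z'' 0 = 0 \<and> s ''o'' 0 = 0 \<and>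
     bounded_memory bits s"

lemma sem_middle:
  assumes inv: "product_inv R s"
  shows "table_inv 0 (sem middle_prog s)"
proof -
  have s: "input_ready s" "s ''D'' 0 = common" "s ''T'' 0 = numsum" "\<And>k. k \<le> R \<Longrightarrow> s ''P'' (int k) = 2 ^ k"
    "bounded_memory bits s"
    using inv by (simp_all add: product_inv_def common_def numsum_def del: prod.cl_ivl_Suc sum.cl_ivl_Suc)
  define s1 where "s1 = upd s ''M'' 0 (2 ^ n)"
  define s2 where "s2 = upd s1 ''g'' 0 (2 ^ n * scaled R)"
  define s8 where "s8 = upd (upd (upd (upd (upd (upd (upd s2 ''f'' 0 (2 ^ n)) ''G'' 0 (int G)) ''B'' 0 (int (Suc G)))
    ''H'' 0 (int H)) ''S'' 0 (int S)) ''I'' 0 big) ''K'' 0 (int table_size)"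
  have 1: "sem (assign ''M'' (Read ''P'' (var ''n''))) s = s1"
    using s(1) s(4)[of n] by (simp add: s1_def input_ready_def)
  have "aval (scaled_exp (Add (Mul (Const 3) (var ''n'')) (Const 1))) s1 = scaled R"
    using s(1,2) by (intro aval_scaled) (auto simp: s1_def upd_eq input_ready_def)
  then have 2: "sem (assign ''g'' (Mul (var ''M'') (scaled_exp (Add (Mul (Const 3) (var ''n'')) (Const 1))))) s1 = s2"
    by (simp add: s2_def) (simp add: s1_def upd_eq)
  have 3: "s2 ''M'' 0 = 2 ^ n" "s2 ''n'' 0 = int n" "s2 ''m'' 0 = int m" "s2 ''D'' 0 = common" "s2 ''T'' 0 = numsum"
    using s(1-3) by (simp_all add: s2_def s1_def upd_eq input_ready_def)
  have 4: "int n + 1 = int G" "int G + 1 = int (Suc G)" "int m + 1 = int H" "int G * int G = int S"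
    "int G * int (Suc G) * int H * int G * int S * int (Suc G) = int table_size"
    by (simp_all only: table_size_def of_nat_mult of_nat_Suc add.commute)
  have eq: "sem middle_prog s = s8"
    unfolding middle_prog_def seq.simps sem.simps(3) 1 2
    by (simp add: s8_def upd_eq 3 4 big_def del: of_nat_Suc of_nat_mult mult_Suc mult_Suc_right)
  have ready: "ready s8"
    using s(1-4) by (simp add: ready_def input_ready_def s8_def s2_def s1_def upd_eq)
  have "bounded_memory bits s8"
    unfolding s8_def s2_def s1_def
  proof (intro bounded_memory_upd s(5))
    have big: "\<bar>x\<bar> \<le> 2 ^ bits" if "0 \<le> x" "x \<le> big" for x using that big_le by simp
    show "\<bar>(2::int) ^ n\<bar> \<le> 2 ^ bits" using two_power_n_le_big by (intro big) simp_all
    then show "\<bar>(2::int) ^ n\<bar> \<le> 2 ^ bits" .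
    show "\<bar>2 ^ n * scaled R\<bar> \<le> 2 ^ bits"
      using start_le_big[of 1] scaled_nonneg(4) by (intro big) simp_all
    show "\<bar>big\<bar> \<le> 2 ^ bits" by (intro big big_nonneg order_refl)
    show "\<bar>int table_size\<bar> \<le> 2 ^ bits" using int_table_size_le by simp
    show "\<bar>int G\<bar> \<le> 2 ^ bits" using small[of G] L_bounds by (intro in_bits) simp
    show "\<bar>int (Suc G)\<bar> \<le> 2 ^ bits" using small[of "Suc G"] L_bounds by (intro in_bits) simp
    show "\<bar>int H\<bar> \<le> 2 ^ bits" using small[of H] L_bounds by (intro in_bits) simp
    have "int G * int G \<le> 2 ^ L * 2 ^ L" using small[of G] L_bounds by (intro mult_mono) auto
    also have "\<dots> \<le> 2 ^ bits" using power_L[of 2] by (simp add: power2_eq_square)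
    finally show "\<bar>int S\<bar> \<le> 2 ^ bits" by (simp only: of_nat_mult[symmetric] abs_of_nat)
  qed
  moreover have "s8 ''t'' 0 = 0" "s8 ''A'' = (\<lambda>_. 0)" "s8 ''f'' 0 = 2 ^ n" "s8 ''e'' 0 = 0" "s8 ''z'' 0 = 0" "s8 ''o'' 0 = 0"
    using inv by (simp_all add: product_inv_def s8_def s2_def s1_def upd_eq)
  ultimately show ?thesis
    unfolding eq table_inv_def using ready big_nonneg by simp
qed

lemma sem_table_body:
  assumes inv: "table_inv k s" and k: "k < table_size"
  shows "bval table_test s \<and> table_inv (k + 1) (sem table_body s)"
proof
  have s: "ready s" "s ''t'' 0 = int k" "bounded_memory bits s"
    using inv by (auto simp: table_inv_def)
  show "bval table_test s" using s k by (simp add: table_test_def ready_def)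
  define d where "d = sem decode_prog s"
  define e where "e = sem entry_prog d"
  define s' where "s' = sem store_prog e"
  let ?A = "\<lambda>p. s ''A'' (int p)"
  have d: "d A = s A" if "A \<notin> {''x1'', ''u'', ''Q'', ''s'', ''x2'', ''i'', ''v'', ''j'', ''x3'', ''a'', ''b''}" for A
    unfolding d_def using that written_decode by (intro sem_unwritten) simp
  have e: "e A = d A" if "A \<notin> {''w'', ''y'', ''r''}" for A
    unfolding e_def using that written_entry by (intro sem_unwritten) simp
  have es: "e A = s A" if "A \<notin> set temps" for A
    using that by (simp add: e d temps_def)
  have rd: "ready d" using s(1) by (simp add: ready_def input_ready_def d)
  have "s ''B'' 0 = int (Suc G)" "s ''S'' 0 = int S" "s ''G'' 0 = int G" "s ''H'' 0 = int H"
    using s(1) by (auto simp only: ready_def)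
  note dec = sem_decode[of s k "Suc G" S G H, OF s(2) this, folded d_def]
  have r: "e ''r'' 0 = table_entry ?A k"
    unfolding e_def using sem_entry[OF rd dec(1-7) _ refl refl] s(2) by (simp add: d)
  have r_bounds: "0 \<le> table_entry ?A k \<and> table_entry ?A k \<le> big"
    using inv by (intro table_entry_bounds) (simp add: table_inv_def)
  have s': "s' A i = (if A \<in> set temps \<and> i = 0 then 0 else if A = ''A'' \<and> i = int k then table_entry ?A k
      else if A = ''t'' \<and> i = 0 then int (k + 1) else e A i)" for A i
    unfolding s'_def sem_store using r s(2) by (simp add: es temps_def)
  have s's: "s' A = s A" if "A \<notin> set temps" "A \<noteq> ''A''" "A \<noteq> ''t''" for A
    using that by (auto simp: s' es fun_eq_iff)
  have A: "s' ''A'' i = (if i = int k then table_entry ?A k else s ''A'' i)" for i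
    by (simp add: s' es temps_def)
  have "ready s'" using s(1) by (simp add: ready_def input_ready_def s's temps_def)
  moreover have "s' ''t'' 0 = int (k + 1)" by (simp add: s' temps_def)
  moreover have "s' ''A'' (int p) = table_entry (\<lambda>p. s' ''A'' (int p)) p" if "p < k + 1" for p
  proof -
    \<comment> \<open>Writing cell \<open>k\<close> does not disturb the entries up to
      \<open>k\<close>, which depend only on smaller indices.\<close>
    have "table_entry (\<lambda>p. s' ''A'' (int p)) p = table_entry ?A p"
      using that k by (intro table_entry_cong) (auto simp: A)
    then show ?thesis using that inv by (cases "p = k") (auto simp: A table_inv_def)
  qed
  moreover have "0 \<le> s' ''A'' (int p) \<and> s' ''A'' (int p) \<le> big" for p
    using inv r_bounds by (simp add: A table_inv_def)
  moreover have "bounded_memory bits s'"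
    unfolding bounded_memory_def
  proof (intro allI)
    fix A i
    \<comment> \<open>Temporaries are cleared in cell 0 and untouched in every other cell, so only
      the remaining arrays need the old bound.\<close>
    have "\<bar>e A i\<bar> \<le> 2 ^ bits" if "\<not> (A \<in> set temps \<and> i = 0)"
    proof (cases "A \<in> set temps")
      case True
      then have "i \<noteq> 0" using that by blast
      then have "e A i = s A i"
        unfolding e_def d_def using scalar_writes_progs by (simp add: sem_scalar_writes)
      then show ?thesis using s(3) by (simp add: bounded_memory_def)
    next
      case False
      then show ?thesis using s(3) by (simp add: es bounded_memory_def)
    qed
    moreover have "int (k + 1) \<le> 2 ^ bits" using k int_table_size_le by linarith
    ultimately show "\<bar>s' A i\<bar> \<le> 2 ^ bits"
      using r_bounds big_le by (simp add: s')
  qed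
  moreover have "s' ''f'' = s ''f''" "s' ''e'' = s ''e''" "s' ''z'' = s ''z''" "s' ''o'' = s ''o''"
    by (simp_all add: s's temps_def)
  ultimately show "table_inv (k + 1) (sem table_body s)"
    unfolding table_body_def sem.simps(3) d_def[symmetric] e_def[symmetric] s'_def[symmetric] table_inv_def
    using inv k by (simp add: table_inv_def)
qed

lemma table_test_stop: "table_inv table_size s \<Longrightarrow> \<not> bval table_test s"
  by (simp add: table_inv_def table_test_def ready_def)

end

context mrs_machine
begin

lemma inv_bounded:
  "product_inv k s \<Longrightarrow> bounded_memory bits s"
  "table_inv k s \<Longrightarrow> bounded_memory bits s"
  by (auto simp: product_inv_def table_inv_def)

definition final_value :: "(int \<Rightarrow> int) \<Rightarrow> nat \<Rightarrow> int" where
  "final_value A v = A (int (cell ((v * H + m) * G + n) ((v div Suc G + 1) * dem m) G))"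

text \<open>
  The fractions \<open>f div 2 ^ n\<close> over \<open>e\<close> are compared by cross multiplication; the initial
  denominator \<open>e = 0\<close> stands for infinity.
\<close>

definition select_inv :: "(int \<Rightarrow> int) \<Rightarrow> nat \<Rightarrow> memory \<Rightarrow> bool" where
  "select_inv A k s \<longleftrightarrow> k \<le> G * Suc G \<and> ready s \<and> s ''A'' = A \<and> s ''z'' 0 = int k \<and> s ''o'' 0 = 0 \<and>
     (if k = 0 then s ''e'' 0 = 0 \<and> s ''f'' 0 = 2 ^ n
      else \<exists>v<k. s ''e'' 0 = int (v div Suc G + 1) \<and> s ''f'' 0 = final_value A v) \<and>
     (\<forall>v<k. (s ''f'' 0 div 2 ^ n) * int (v div Suc G + 1) \<le> (final_value A v div 2 ^ n) * s ''e'' 0) \<and>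
     bounded_memory bits s"

lemma select_inv_bounded: "select_inv A k s \<Longrightarrow> bounded_memory bits s"
  by (simp add: select_inv_def)

lemma int_le_bits: "a \<le> L \<Longrightarrow> \<bar>int a\<bar> \<le> 2 ^ bits"
  using small[of a] by (intro in_bits) simp

lemma sem_select_body:
  assumes inv: "select_inv A k s" and k: "k < G * Suc G"
    and A: "\<And>p. 0 \<le> A (int p) \<and> A (int p) \<le> big"
  shows "bval select_test s \<and> select_inv A (k + 1) (sem select_body s)"
proof
  have s: "ready s" "s ''z'' 0 = int k" "bounded_memory bits s" "s ''A'' = A"
    using inv by (auto simp: select_inv_def)
  have z: "s ''n'' 0 = int n" "s ''m'' 0 = int m" "s ''G'' 0 = int G" "s ''B'' 0 = int (Suc G)" "s ''H'' 0 = int H"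
      "s ''M'' 0 = 2 ^ n" "s ''input'' = inp"
    using s(1) by (auto simp: ready_def input_ready_def)
  have "int k < int (G * Suc G)" using k by (simp only: of_nat_less_iff)
  then show "bval select_test s" using s(2) z by (simp only: select_test_def bval.simps aval.simps of_nat_mult)
  define b where "b = k div Suc G + 1"
  define r where "r = final_value A k"
  define s1 where "s1 = upd s ''x1'' 0 (int b)"
  define s2 where "s2 = upd s1 ''r'' 0 r"
  let ?t = "(r div 2 ^ n) * s ''e'' 0 < (s ''f'' 0 div 2 ^ n) * int b"
  define s3 where "s3 = (if ?t then upd (upd s2 ''f'' 0 r) ''e'' 0 (int b) else s2)"
  define s6 where "s6 = upd (upd (upd s3 ''z'' 0 (int (k + 1))) ''x1'' 0 0) ''r'' 0 0"
  have r1: "ready s1" using s(1) by (simp add: ready_def input_ready_def s1_def upd_eq)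
  have 1: "sem (assign ''x1'' (Add (Quot (var ''z'') (var ''B'')) (Const 1))) s = s1"
  proof -
    have "int k div int (Suc G) + 1 = int b" by (simp only: b_def of_nat_add of_nat_div of_nat_1)
    then show ?thesis using s(2) z(4) by (simp add: s1_def del: of_nat_Suc)
  qed
  have q: "aval (Add (Mul (Add (Mul (var ''z'') (var ''H'')) (var ''m'')) (var ''G'')) (var ''n'')) s1 = int ((k * H + m) * G + n)"
    using s(2) z by (simp add: s1_def upd_eq algebra_simps)
  have d: "aval (Mul (var ''x1'') (Read ''input'' (Add (Add (Const 2) (var ''n'')) (var ''m'')))) s1 = int (b * dem m)"
    using z inp_dem(1)[of m] by (simp add: s1_def upd_eq)
  have 2: "sem (assign ''r'' (Read ''A'' (cell_exp (Add (Mul (Add (Mul (var ''z'') (var ''H'')) (var ''m'')) (var ''G'')) (var ''n''))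
       (Mul (var ''x1'') (Read ''input'' (Add (Add (Const 2) (var ''n'')) (var ''m''))))))) s1 = s2"
    using s(4) unfolding sem.simps(2) aval.simps(2) aval_cell[OF r1 q d]
    by (simp add: s2_def r_def final_value_def b_def s1_def upd_eq)
  have 3: "sem (Cond (Less (Mul (Quot (var ''r'') (var ''M'')) (var ''e'')) (Mul (Quot (var ''f'') (var ''M'')) (var ''x1'')))
       (Seq (assign ''f'' (var ''r'')) (assign ''e'' (var ''x1''))) Skip) s2 = s3"
    using z by (simp add: s3_def s2_def s1_def upd_eq)
  have z3: "s3 ''z'' 0 = int k" using s(2) by (simp add: s3_def s2_def s1_def upd_eq)
  have eq: "sem select_body s = s6"
    unfolding select_body_def seq.simps sem.simps(3) 1 2 3
    using z3 by (simp add: s6_def upd_eq add.commute)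
  have f: "s6 ''f'' 0 = (if ?t then r else s ''f'' 0)" "s6 ''e'' 0 = (if ?t then int b else s ''e'' 0)"
    by (simp_all add: s6_def s3_def s2_def s1_def upd_eq)
  have "ready s6" using s(1) by (simp add: ready_def input_ready_def s6_def s3_def s2_def s1_def upd_eq)
  moreover have "s6 ''A'' = A" "s6 ''z'' 0 = int (k + 1)" "s6 ''o'' 0 = 0"
    using inv by (simp_all add: s6_def s3_def s2_def s1_def upd_eq select_inv_def)
  moreover have "bounded_memory bits s6"
  proof -
    have b: "\<bar>int b\<bar> \<le> 2 ^ bits"
      using less_mult_imp_div_less[OF k] L_bounds(1) unfolding b_def by (intro int_le_bits) linarith
    have "\<bar>r\<bar> \<le> 2 ^ bits" using A big_le unfolding r_def final_value_def by (smt (verit, best))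
    moreover have "\<bar>int (k + 1)\<bar> \<le> 2 ^ bits"
    proof -
      have "k + 1 \<le> G * Suc G" using k by simp
      also have "\<dots> \<le> L * L" using L_bounds(1) by (intro mult_le_mono) auto
      finally have "int (k + 1) \<le> int L * int L" by (simp only: of_nat_mult[symmetric] of_nat_le_iff)
      also have "\<dots> \<le> 2 ^ L * 2 ^ L" using small[of L] by (intro mult_mono) auto
      also have "\<dots> \<le> 2 ^ bits" using power_L[of 2] by (simp add: power2_eq_square)
      finally show ?thesis by simp
    qed
    ultimately have "bounded_memory bits s3"
      unfolding s3_def s2_def s1_def using b s(3) by (auto intro!: bounded_memory_upd)
    then show ?thesis
      unfolding s6_def using \<open>\<bar>int (k + 1)\<bar> \<le> 2 ^ bits\<close> by (intro bounded_memory_upd) auto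
  qed
  moreover have "\<exists>v<k + 1. s6 ''e'' 0 = int (v div Suc G + 1) \<and> s6 ''f'' 0 = final_value A v"
  proof (cases ?t)
    case True
    then show ?thesis unfolding f by (intro exI[of _ k]) (simp add: b_def r_def)
  next
    case False
    \<comment> \<open>In the first iteration \<open>e = 0\<close> and
      \<open>f div 2 ^ n = 1\<close>, so the test succeeds.\<close>
    have "k \<noteq> 0"
    proof
      assume "k = 0"
      then have "s ''e'' 0 = 0" "s ''f'' 0 = 2 ^ n" using inv by (auto simp: select_inv_def)
      then show False using False by (simp add: b_def)
    qed
    then obtain v where "v < k" "s ''e'' 0 = int (v div Suc G + 1)" "s ''f'' 0 = final_value A v"
      using inv by (auto simp: select_inv_def)
    then show ?thesis unfolding f using False by (intro exI[of _ v]) auto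
  qed
  moreover have "(s6 ''f'' 0 div 2 ^ n) * int (v div Suc G + 1) \<le> (final_value A v div 2 ^ n) * s6 ''e'' 0"
    if v: "v < k + 1" for v
  proof (cases "v = k")
    case True
    then show ?thesis unfolding f by (auto simp: r_def b_def)
  next
    case False
    then have vk: "v < k" using v by simp
    then have old: "(s ''f'' 0 div 2 ^ n) * int (v div Suc G + 1) \<le> (final_value A v div 2 ^ n) * s ''e'' 0"
      using inv by (simp add: select_inv_def)
    \<comment> \<open>After the first iteration \<open>e\<close> is a true denominator and can be
      cancelled when two cross-multiplied comparisons are chained.\<close>
    have e: "0 < s ''e'' 0"
    proof -
      have "\<exists>v<k. s ''e'' 0 = int (v div Suc G + 1) \<and> s ''f'' 0 = final_value A v"
        using inv vk by (simp add: select_inv_def split: if_splits)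
      then show ?thesis by auto
    qed
    show ?thesis
    proof (cases ?t)
      case True
      define w where "w = int (v div Suc G + 1)"
      have "((r div 2 ^ n) * w) * s ''e'' 0 = ((r div 2 ^ n) * s ''e'' 0) * w" by simp
      also have "\<dots> \<le> ((s ''f'' 0 div 2 ^ n) * int b) * w"
        using True unfolding w_def by (intro mult_right_mono) auto
      also have "\<dots> = ((s ''f'' 0 div 2 ^ n) * w) * int b" by simp
      also have "\<dots> \<le> ((final_value A v div 2 ^ n) * s ''e'' 0) * int b"
        using old unfolding w_def by (intro mult_right_mono) auto
      also have "\<dots> = ((final_value A v div 2 ^ n) * int b) * s ''e'' 0" by simp
      finally have "(r div 2 ^ n) * w \<le> (final_value A v div 2 ^ n) * int b"
        using e by (simp only: mult_le_cancel_right_pos)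
      then show ?thesis unfolding f w_def using True by simp
    next
      case False
      then show ?thesis unfolding f using old by simp
    qed
  qed
  ultimately show "select_inv A (k + 1) (sem select_body s)"
    unfolding eq select_inv_def using k by simp
qed

lemma select_test_stop: "select_inv A (G * Suc G) s \<Longrightarrow> \<not> bval select_test s"
proof -
  assume "select_inv A (G * Suc G) s"
  then have "s ''z'' 0 = int (G * Suc G)" "s ''G'' 0 = int G" "s ''B'' 0 = int (Suc G)"
    by (simp_all only: select_inv_def ready_def)
  then show ?thesis by (simp only: select_test_def bval.simps aval.simps of_nat_mult less_irrefl not_False_eq_True)
qed

definition output_inv :: "int \<Rightarrow> int \<Rightarrow> nat \<Rightarrow> memory \<Rightarrow> bool" where
  "output_inv f e k s \<longleftrightarrow> k \<le> n \<and> s ''n'' 0 = int n \<and> (\<forall>k\<le>n. s ''P'' (int k) = 2 ^ k) \<and>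
     s ''h'' 0 = f mod 2 ^ n \<and> s ''o'' 0 = int k \<and>
     s ''output'' 0 = int n + 2 \<and> s ''output'' 1 = f div 2 ^ n \<and> s ''output'' 2 = common * e \<and>
     (\<forall>i<k. s ''output'' (int i + 3) = f mod 2 ^ n div 2 ^ i mod 2) \<and>
     bounded_memory bits s"

lemma output_inv_bounded: "output_inv f e k s \<Longrightarrow> bounded_memory bits s"
  by (simp add: output_inv_def)

lemma sem_answer:
  assumes s: "ready s" "bounded_memory bits s" "s ''f'' 0 = f" "s ''e'' 0 = int b" "s ''o'' 0 = 0"
    and b: "b \<le> G" and f: "0 \<le> f" "f \<le> big"
  shows "output_inv f (int b) 0 (sem answer_prog s)"
proof -
  define s4 where "s4 = upd (upd (upd (upd s ''output'' 0 (int n + 2)) ''output'' 1 (f div 2 ^ n))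
     ''output'' 2 (common * int b)) ''h'' 0 (f mod 2 ^ n)"
  have z: "s ''n'' 0 = int n" "s ''M'' 0 = 2 ^ n" "s ''D'' 0 = common" "\<forall>k\<le>n. s ''P'' (int k) = 2 ^ k"
    using s(1) by (auto simp: ready_def input_ready_def)
  have eq: "sem answer_prog s = s4"
    unfolding answer_prog_def
    by (simp add: s4_def upd_eq z s minus_div_mult_eq_mod)
  have "bounded_memory bits s4"
    unfolding s4_def
  proof (intro bounded_memory_upd s(2))
    have f_bits: "\<bar>f\<bar> \<le> 2 ^ bits" using f big_le by simp
    show "\<bar>f div 2 ^ n\<bar> \<le> 2 ^ bits" using abs_div_le_abs[of f "2 ^ n"] f_bits by linarith
    have "0 \<le> f mod 2 ^ n" "f mod 2 ^ n \<le> f" using f zmod_le_nonneg_dividend by auto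
    then show "\<bar>f mod 2 ^ n\<bar> \<le> 2 ^ bits" using f_bits f by linarith
    have "\<bar>int (n + 2)\<bar> \<le> 2 ^ bits" using L_bounds by (intro int_le_bits) linarith
    then show "\<bar>int n + 2\<bar> \<le> 2 ^ bits" by simp
    have "int b \<le> 2 ^ L" using b L_bounds(1) by (intro small) linarith
    moreover have "common \<le> 2 ^ L" using partial_prod_le[of R] by (simp only: common_def[symmetric] abs_le_iff)
    ultimately have "common * int b \<le> 2 ^ L * 2 ^ L" by (intro mult_mono) auto
    also have "\<dots> \<le> 2 ^ bits" using power_L[of 2] by (simp add: power2_eq_square)
    finally show "\<bar>common * int b\<bar> \<le> 2 ^ bits" using common_pos by simp
  qed
  then show ?thesis
    unfolding eq output_inv_def using z s(5) by (simp add: s4_def upd_eq)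
qed

lemma sem_output_body:
  assumes inv: "output_inv f e k s" and k: "k < n"
  shows "bval output_test s \<and> output_inv f e (k + 1) (sem output_body s)"
proof
  show "bval output_test s" using inv k by (simp add: output_inv_def output_test_def)
  have P: "s ''P'' (int k) = 2 ^ k" using inv k by (simp add: output_inv_def)
  define x where "x = f mod 2 ^ n div 2 ^ k mod 2"
  define s2 where "s2 = upd (upd s ''output'' (int k + 3) x) ''o'' 0 (int k + 1)"
  have o: "s ''o'' 0 = int k" "s ''h'' 0 = f mod 2 ^ n" using inv by (auto simp: output_inv_def)
  have digit: "aval (Sub digit_exp (Mul (Const 2) (Quot digit_exp (Const 2)))) s = x"
    using o P by (simp add: digit_exp_def x_def minus_mult_div_eq_mod)
  have eq: "sem output_body s = s2"
    using o unfolding output_body_def seq.simps sem.simps(2,3) digit by (simp add: s2_def upd_eq)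
  have "0 \<le> x" "x \<le> 1" unfolding x_def using pos_mod_bound[of 2 "f mod 2 ^ n div 2 ^ k"] by simp_all
  moreover have "(1::int) \<le> 2 ^ bits" by (rule one_le_power) simp
  ultimately have "\<bar>x\<bar> \<le> 2 ^ bits" by linarith
  moreover have "\<bar>int (k + 1)\<bar> \<le> 2 ^ bits" using k L_bounds by (intro int_le_bits) linarith
  ultimately have "bounded_memory bits s2"
    unfolding s2_def using inv by (intro bounded_memory_upd) (auto simp: output_inv_def)
  moreover have "\<forall>i<k + 1. s2 ''output'' (int i + 3) = f mod 2 ^ n div 2 ^ i mod 2"
    using inv by (auto simp: s2_def upd_eq x_def output_inv_def less_Suc_eq)
  ultimately show "output_inv f e (k + 1) (sem output_body s)"
    unfolding eq output_inv_def using inv k by (simp add: s2_def upd_eq output_inv_def)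
qed

lemma output_test_stop: "output_inv f e n s \<Longrightarrow> \<not> bval output_test s"
  by (simp add: output_inv_def output_test_def)

lemma has_output_final:
  assumes inv: "output_inv f e n s"
  shows "has_output s ([f div 2 ^ n, common * e] @ map (\<lambda>i. f mod 2 ^ n div 2 ^ (i - 1) mod 2) [1..<n + 1])"
    (is "has_output s ?ys")
  unfolding has_output_def
proof
  have len: "length ?ys = n + 2" by simp
  fix i assume "i \<in> {0..int (length ?ys)}"
  then have i: "0 \<le> i" "i \<le> int n + 2" by (simp_all only: len atLeastAtMost_iff) simp_all
  consider "i = 0" | "i = 1" | "i = 2" | "3 \<le> i" using i by linarith
  then show "s ''output'' i = list_cells ?ys i"
  proof cases
    case 4
    \<comment> \<open>Cell 0 of the output holds the length and cells 1 and 2 the fraction, so bit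
      \<open>k\<close> is in cell \<open>k + 3\<close>.\<close>
    define k where "k = nat (i - 3)"
    have k: "i = int k + 3" "k < n" using 4 i by (auto simp: k_def)
    have "nat (i - 1) = Suc (Suc k)" using k(1) by simp
    then have "list_cells ?ys i = map (\<lambda>i. f mod 2 ^ n div 2 ^ (i - 1) mod 2) [1..<n + 1] ! k"
      using i 4 len by (simp add: list_cells_def del: upt_Suc)
    also have "\<dots> = f mod 2 ^ n div 2 ^ k mod 2" using k(2) by (simp del: upt_Suc)
    finally show ?thesis using inv k by (simp add: output_inv_def)
  qed (use inv in \<open>simp_all add: output_inv_def list_cells_def del: upt_Suc\<close>)
qed

end

section \<open>The assembled program and its running time\<close>

definition mrs_prog :: com where
  "mrs_prog = Seq setup_prog (Seq (While product_test product_body) (Seq middle_prog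
     (Seq (While table_test table_body) (Seq (While select_test select_body)
       (Seq answer_prog (While output_test output_body))))))"

text \<open>The 7 comes from \<open>bits = 7 * L\<close>; each 2 comes from estimating the number of
  tests of a loop by \<open>2 * L ^ 7\<close>. Together they give degree 8.\<close>

definition mrs_coef :: nat where
  "mrs_coef = 7 * (ccoef setup_prog + 2 * loop_coef product_test product_body + ccoef middle_prog
     + 2 * loop_coef table_test table_body + 2 * loop_coef select_test select_body
     + ccoef answer_prog + 2 * loop_coef output_test output_body)"

lemma (in mrs_machine) mrs_prog_correct:
  "\<exists>t s ys. runs mrs_prog (input_memory (encode_mrs I)) t s \<and> t \<le> mrs_coef * L ^ 8 \<and>
     has_output s ys \<and> solves_mrs I ys"
proof -
  let ?s0 = "input_memory (encode_mrs I)"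
  have l: "0 < bits" using L_bounds by simp
  have mem0: "bounded_memory bits ?s0"
    unfolding bounded_memory_def input_memory_def using in_bits[OF abs_inp_le] by simp
  have r1: "runs_within setup_prog ?s0 (ccoef setup_prog * bits) (sem setup_prog ?s0)"
    using loop_free_runs[OF loop_free_progs(1) mem0 l] by blast
  obtain s2 where r2: "runs_within (While product_test product_body) (sem setup_prog ?s0)
      ((R + 1) * (loop_coef product_test product_body * bits)) s2" and s2: "product_inv R s2"
    by (rule loop_runs[where Inv = product_inv and K = R, OF loop_free_progs(2) l sem_product_body product_test_stop inv_bounded(1) sem_setup])
  have r3: "runs_within middle_prog s2 (ccoef middle_prog * bits) (sem middle_prog s2)"
    using loop_free_runs[OF loop_free_progs(3) inv_bounded(1)[OF s2] l] by blast
  obtain s4 where r4: "runs_within (While table_test table_body) (sem middle_prog s2)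
      ((table_size + 1) * (loop_coef table_test table_body * bits)) s4" and s4: "table_inv table_size s4"
    by (rule loop_runs[where Inv = table_inv and K = table_size, OF loop_free_progs(4) l sem_table_body table_test_stop inv_bounded(2) sem_middle[OF s2]])
  define A where "A = s4 ''A''"
  have A_bounds: "0 \<le> A (int p) \<and> A (int p) \<le> big" for p using s4 by (simp add: table_inv_def A_def)
  have start: "select_inv A 0 s4" using s4 by (simp add: table_inv_def select_inv_def A_def)
  obtain s5 where r5: "runs_within (While select_test select_body) s4
      ((G * Suc G + 1) * (loop_coef select_test select_body * bits)) s5" and s5: "select_inv A (G * Suc G) s5"
  proof (rule loop_runs[where Inv = "select_inv A" and K = "G * Suc G" and s = s4, OF loop_free_progs(5) l])
    show "bval select_test s \<and> select_inv A (k + 1) (sem select_body s)"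
      if "select_inv A k s" "k < G * Suc G" for k s
      using that A_bounds by (rule sem_select_body)
    show "\<not> bval select_test s" if "select_inv A (G * Suc G) s" for s using that by (rule select_test_stop)
    show "bounded_memory bits s" if "select_inv A k s" for k s using that by (rule select_inv_bounded)
  qed (rule start, blast)
  obtain v where v: "v < G * Suc G" "s5 ''e'' 0 = int (v div Suc G + 1)" "s5 ''f'' 0 = final_value A v"
    and best: "\<And>v'. v' < G * Suc G \<Longrightarrow>
      (s5 ''f'' 0 div 2 ^ n) * int (v' div Suc G + 1) \<le> (final_value A v' div 2 ^ n) * s5 ''e'' 0"
    using s5 unfolding select_inv_def by (auto split: if_splits)
  define a where "a = v mod Suc G"
  define b where "b = v div Suc G + 1"
  have ab: "a \<le> G" "1 \<le> b" "b \<le> G"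
    using less_mult_imp_div_less[OF v(1)] mod_less_divisor[of "Suc G" v] unfolding a_def b_def by linarith+
  have final: "final_value A ((b - 1) * Suc G + a) = A (int (cell (stage a b m n) (b * dem m) G))"
    if "1 \<le> b" "a \<le> G" for a b
    using that div_mod_digit(1)[of a "Suc G" "b - 1"]
    by (simp add: final_value_def stage_def del: mult_Suc mult_Suc_right)
  have fv: "s5 ''f'' 0 = A (int (cell (stage a b m n) (b * dem m) G))"
    using final[OF ab(2,1)] v(3) unfolding a_def b_def by (simp add: div_mult_mod_eq del: mult_Suc mult_Suc_right)
  have f: "0 \<le> s5 ''f'' 0" "s5 ''f'' 0 \<le> big" using A_bounds unfolding fv by auto
  have mem5: "bounded_memory bits s5" using s5 by (simp add: select_inv_def)
  have r6: "runs_within answer_prog s5 (ccoef answer_prog * bits) (sem answer_prog s5)"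
    using loop_free_runs[OF loop_free_progs(6) mem5 l] by blast
  have start': "output_inv (s5 ''f'' 0) (int b) 0 (sem answer_prog s5)"
    using s5 v(2) ab f by (intro sem_answer) (auto simp: select_inv_def b_def)
  obtain s7 where r7: "runs_within (While output_test output_body) (sem answer_prog s5)
      ((n + 1) * (loop_coef output_test output_body * bits)) s7" and s7: "output_inv (s5 ''f'' 0) (int b) n s7"
  proof (rule loop_runs[where Inv = "output_inv (s5 ''f'' 0) (int b)" and K = n and s = "sem answer_prog s5",
        OF loop_free_progs(7) l])
    show "bval output_test s \<and> output_inv (s5 ''f'' 0) (int b) (k + 1) (sem output_body s)"
      if "output_inv (s5 ''f'' 0) (int b) k s" "k < n" for k s
      using that by (rule sem_output_body)
    show "\<not> bval output_test s" if "output_inv (s5 ''f'' 0) (int b) n s" for s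
      using that by (rule output_test_stop)
    show "bounded_memory bits s" if "output_inv (s5 ''f'' 0) (int b) k s" for k s
      using that by (rule output_inv_bounded)
  qed (rule start', blast)
  define T where "T = ccoef setup_prog * bits + ((R + 1) * (loop_coef product_test product_body * bits) +
    (ccoef middle_prog * bits + ((table_size + 1) * (loop_coef table_test table_body * bits) +
    ((G * Suc G + 1) * (loop_coef select_test select_body * bits) + (ccoef answer_prog * bits +
    (n + 1) * (loop_coef output_test output_body * bits))))))"
  have "runs_within mrs_prog ?s0 T s7"
    unfolding mrs_prog_def T_def by (rule runs_within_Seq[OF r1 runs_within_Seq[OF r2 runs_within_Seq[OF r3
      runs_within_Seq[OF r4 runs_within_Seq[OF r5 runs_within_Seq[OF r6 r7]]]]]])
  then obtain t where t: "t \<le> T" "runs mrs_prog ?s0 t s7" by (auto simp: runs_within_def)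
  have "T \<le> mrs_coef * L ^ 8"
  proof -
    define Z where "Z = L ^ 7"
    have pow: "L ^ k \<le> Z" if "k \<le> 7" for k unfolding Z_def using that L_bounds by (intro power_increasing) auto
    have 1: "1 \<le> Z" using pow[of 0] by simp
    then have one: "k \<le> k * Z" for k by simp
    have "L \<le> Z" using pow[of 1] by simp
    then have "R + 1 \<le> 2 * Z" "n + 1 \<le> 2 * Z" using L_bounds by linarith+
    moreover have "table_size + 1 \<le> 2 * Z" using table_size_le 1 by (simp add: Z_def)
    moreover have "G * Suc G + 1 \<le> 2 * Z"
    proof -
      have "G * Suc G \<le> L * L" using L_bounds(1) by (intro mult_le_mono) auto
      also have "\<dots> \<le> Z" using pow[of 2] by (simp add: power2_eq_square)
      finally show ?thesis using 1 by simp
    qed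
    ultimately have "T \<le> ccoef setup_prog * bits * Z + (2 * Z * (loop_coef product_test product_body * bits) +
      (ccoef middle_prog * bits * Z + (2 * Z * (loop_coef table_test table_body * bits) +
      (2 * Z * (loop_coef select_test select_body * bits) + (ccoef answer_prog * bits * Z +
      2 * Z * (loop_coef output_test output_body * bits))))))"
      unfolding T_def by (intro add_mono mult_le_mono1 one)
    also have "\<dots> = mrs_coef * (Z * L)" by (simp add: mrs_coef_def algebra_simps)
    also have "Z * L = L ^ 8" by (simp add: Z_def eval_nat_numeral)
    finally show ?thesis .
  qed
  moreover have "solves_mrs I ([s5 ''f'' 0 div 2 ^ n, common * int b] @
      map (\<lambda>i. s5 ''f'' 0 mod 2 ^ n div 2 ^ (i - 1) mod 2) [1..<n + 1])"
    unfolding fv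
  proof (rule solves_mrs_table[of "\<lambda>p. A (int p)"])
    show "A (int k) = table_entry (\<lambda>p. A (int p)) k" if "k < table_size" for k
      using s4 that by (simp add: table_inv_def A_def)
    fix a' b' assume ab': "1 \<le> b'" "b' \<le> G" "a' \<le> G"
    have lt: "(b' - 1) * Suc G + a' < G * Suc G" using ab' by (intro digit_less) auto
    have e: "((b' - 1) * Suc G + a') div Suc G + 1 = b'"
      using ab' div_mod_digit(1)[of a' "Suc G" "b' - 1"] by (simp del: mult_Suc mult_Suc_right)
    show "A (int (cell (stage a b m n) (b * dem m) G)) div 2 ^ n * int b' \<le>
        A (int (cell (stage a' b' m n) (b' * dem m) G)) div 2 ^ n * int b"
      using best[OF lt] unfolding e final[OF ab'(1,3)] v(2)[folded b_def] fv .
  qed (use ab in auto)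
  ultimately show ?thesis
    using t has_output_final[OF s7] by (meson order_trans)
qed

theorem theorem18:
  shows "polynomial_time_solvable mrs_instances encode_mrs solves_mrs"
  unfolding polynomial_time_solvable_def
proof (rule exI[of _ mrs_prog], rule exI[of _ "monom mrs_coef 8"], rule ballI)
  fix I assume "I \<in> mrs_instances"
  then interpret mrs_machine I by unfold_locales
  show "\<exists>t s ys. runs mrs_prog (input_memory (encode_mrs I)) t s \<and>
      t \<le> poly (monom mrs_coef 8) (list_size (encode_mrs I)) \<and> has_output s ys \<and> solves_mrs I ys"
    using mrs_prog_correct by (simp only: poly_monom)
qed

end
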